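(* Let $\mathcal{S}(\mathrm{R})$ be an o-minimal structure over a real closed field $\mathrm{R}$, and let $T \subset \mathrm{R}^{k+\ell}$ be a closed definable set. Then there exist constants $C_1,C_2 > 0$ depending only on $T$, and definable sets $$\{T_\alpha\}_{\alpha \in I}, \qquad T_\alpha \subset \mathrm{R}^k \times \mathrm{R}^{2(2^k -1)\cdot\ell},$$ depending only on $T$, with $|I| \leq C_1$, such that for any $(T,\pi_1,\pi_2)$-family $\mathcal{A} = \{S_1,\ldots,S_n\}$ with $S_i = T_{\mathbf{y}_i}$, $\mathbf{y}_i \in \mathrm{R}^{\ell}$, $1 \leq i \leq n$, some sub-collection of the sets $$\pi_{k+2(2^k -1)\ell}^{\leq k}\left(\left(\pi_{k+2(2^k -1)\ell}^{> k}\right)^{-1}(\mathbf{y}_{i_1},\ldots,\mathbf{y}_{i_{2(2^k -1)}}) \cap T_\alpha\right), \qquad \alpha \in I,\ 1 \leq i_1,\ldots,i_{2(2^k -1)} \leq n,$$ forms a cdcd of $\mathrm{R}^k$ compatible with (i.e. adapted to) $\mathcal{A}$. Moreover, the cdcd has at most $C_2 \cdot n^{2(2^k -1)}$ cells.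
   Context: An o-minimal structure on a real closed field $\mathrm{R}$ is a sequence $\mathcal{S}(\mathrm{R}) = (\mathcal{S}_n)_{n\in\mathbb{N}}$, each $\mathcal{S}_n$ a collection of subsets of $\mathrm{R}^n$ (the definable sets), such that: all algebraic subsets of $\mathrm{R}^n$ are in $\mathcal{S}_n$; $\mathcal{S}_n$ is closed under complementation, finite unions and finite intersections; $A\in\mathcal{S}_m$, $B\in\mathcal{S}_n$ imply $A\times B\in\mathcal{S}_{m+n}$; the image of $A\in\mathcal{S}_{n+1}$ under projection to the first $n$ coordinates is in $\mathcal{S}_n$; and the elements of $\mathcal{S}_1$ are precisely the finite unions of points and intervals. For $p\le m$, $\pi_m^{\le p}:\mathrm{R}^m\to\mathrm{R}^p$ and $\pi_m^{>p}:\mathrm{R}^m\to\mathrm{R}^{m-p}$ are the projections onto the first $p$ and the last $m-p$ coordinates. Let $\pi_1=\pi_{k+\ell}^{\le k}$, $\pi_2=\pi_{k+\ell}^{>k}$. For $\mathbf{y}\in\mathrm{R}^\ell$ put $T_{\mathbf{y}} = \pi_1(\pi_2^{-1}(\mathbf{y})\cap T)$. A $(T,\pi_1,\pi_2)$-set is a subset of $\mathrm{R}^k$ of the form $T_{\mathbf{y}}$ for some $\mathbf{y}\in\mathrm{R}^\ell$; a $(T,\pi_1,\pi_2)$-family is a finite family of $(T,\pi_1,\pi_2)$-sets (here with $n\ge1$ members). A cylindrical definable cell decomposition (cdcd) of $\mathrm{R}^k$ is a finite partition of $\mathrm{R}^k$ into definable sets, called cells, defined recursively. If $k=1$, a cdcd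 of $\mathrm{R}$ is given by a finite set of points $a_1<\cdots<a_N$, the cells being the singletons $\{a_i\}$ and the open intervals $(-\infty,a_1),(a_1,a_2),\ldots,(a_N,\infty)$. If $k>1$, a cdcd of $\mathrm{R}^k$ is given by a cdcd $(C_i')_{i\in I'}$ of $\mathrm{R}^{k-1}$ and, for each $i\in I'$, a collection of cells $\mathcal{C}_i=\{\phi_i(C_i'\times D_j)\mid j\in J_i\}$, where $(D_j)_{j\in J_i}$ is a cdcd of $\mathrm{R}$ and $\phi_i$ is a definable homeomorphism from $C_i'\times\mathrm{R}$ onto $C_i'\times\mathrm{R}\subset\mathrm{R}^k$ with $\pi\circ\phi_i=\pi$, $\pi:\mathrm{R}^k\to\mathrm{R}^{k-1}$ being the projection onto the first $k-1$ coordinates; the cdcd of $\mathrm{R}^k$ is $\bigcup_{i\in I'}\mathcal{C}_i$. A cdcd is adapted to a family $\mathcal{A}=\{S_1,\ldots,S_n\}$ of definable subsets of $\mathrm{R}^k$ if each $S_i$ is a union of cells of the cdcd. *)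

theory Defs
  imports "HOL-Analysis.Analysis" "HOL-Library.Disjoint_Sets"
begin

class real_closed_field = linordered_field +
  assumes ex_square_root: "0 \<le> a \<Longrightarrow> \<exists>x. x * x = a"
    and ex_odd_degree_root: "odd n \<Longrightarrow> c n \<noteq> 0 \<Longrightarrow> \<exists>x. (\<Sum>i\<le>n. c i * x ^ i) = 0"

text \<open>
  Points of \<open>R\<^sup>n\<close> are the lists of length \<open>n\<close>. Under the identification of
  \<open>R\<^sup>m \<times> R\<^sup>n\<close> with \<open>R\<^sup>m\<^sup>+\<^sup>n\<close> pairing is concatenation, and the projections onto the first
  \<open>p\<close> and onto the remaining coordinates are \<^const>\<open>take\<close> \<open>p\<close> and \<^const>\<open>drop\<close> \<open>p\<close>.
\<close>

definition Rn :: "nat \<Rightarrow> 'a list set" where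
  "Rn n = {x. length x = n}"

definition lprod :: "'a list set \<Rightarrow> 'a list set \<Rightarrow> 'a list set" (infixr "\<otimes>\<^sub>l" 75) where
  "A \<otimes>\<^sub>l B = {x @ y | x y. x \<in> A \<and> y \<in> B}"

definition line :: "'a set \<Rightarrow> 'a list set" where
  "line X = (\<lambda>t. [t]) ` X"

text \<open>The order topology on the field, taken to the power \<open>n\<close>; open boxes form a basis.\<close>

definition Rtop :: "nat \<Rightarrow> ('a::linorder) list topology" where
  "Rtop n = topology_generated_by
     (insert (Rn n) {{x \<in> Rn n. \<forall>i<n. a i < x ! i \<and> x ! i < b i} | a b. True})"

text \<open>The ring of polynomial functions in the coordinates \<open>x\<^sub>0, \<dots>, x\<^sub>n\<^sub>-\<^sub>1\<close>.\<close>

inductive_set poly_fun :: "nat \<Rightarrow> (('a::comm_ring_1) list \<Rightarrow> 'a) set" for n where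
  const: "(\<lambda>x. c) \<in> poly_fun n"
| coord: "i < n \<Longrightarrow> (\<lambda>x. x ! i) \<in> poly_fun n"
| add: "f \<in> poly_fun n \<Longrightarrow> g \<in> poly_fun n \<Longrightarrow> (\<lambda>x. f x + g x) \<in> poly_fun n"
| mult: "f \<in> poly_fun n \<Longrightarrow> g \<in> poly_fun n \<Longrightarrow> (\<lambda>x. f x * g x) \<in> poly_fun n"

definition algebraic_set :: "nat \<Rightarrow> ('a::comm_ring_1) list set \<Rightarrow> bool" where
  "algebraic_set n A \<longleftrightarrow> (\<exists>F \<subseteq> poly_fun n. A = {x \<in> Rn n. \<forall>f\<in>F. f x = 0})"

text \<open>
  Intervals have endpoints in \<open>R \<union> {-\<infinity>, \<infinity>}\<close>; over a general real closed field this is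
  more restrictive than being order-convex. Together with points, the open ones suffice to form
  all finite unions of points and intervals.
\<close>

definition point_or_interval :: "('a::linorder) set \<Rightarrow> bool" where
  "point_or_interval J \<longleftrightarrow>
     (\<exists>a. J = {a}) \<or> (\<exists>a b. J = {a<..<b}) \<or> (\<exists>a. J = {..<a}) \<or> (\<exists>a. J = {a<..}) \<or> J = UNIV"

locale o_minimal =
  fixes S :: "nat \<Rightarrow> ('a::real_closed_field) list set set"
  assumes definable_subset: "A \<in> S n \<Longrightarrow> A \<subseteq> Rn n"
    and algebraic_definable: "algebraic_set n A \<Longrightarrow> A \<in> S n"
    and definable_compl: "A \<in> S n \<Longrightarrow> Rn n - A \<in> S n"
    and definable_Un: "A \<in> S n \<Longrightarrow> B \<in> S n \<Longrightarrow> A \<union> B \<in> S n"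
    and definable_Int: "A \<in> S n \<Longrightarrow> B \<in> S n \<Longrightarrow> A \<inter> B \<in> S n"
    and definable_prod: "A \<in> S m \<Longrightarrow> B \<in> S n \<Longrightarrow> A \<otimes>\<^sub>l B \<in> S (m + n)"
    and definable_proj: "A \<in> S (Suc n) \<Longrightarrow> take n ` A \<in> S n"
    and definable_line: "S 1 = {line (\<Union>\<J>) | \<J>. finite \<J> \<and> (\<forall>J\<in>\<J>. point_or_interval J)}"

text \<open>\<open>T\<^sub>y = \<pi>\<^sub>1 (\<pi>\<^sub>2\<^sup>-\<^sup>1 y \<inter> T)\<close>, where \<open>\<pi>\<^sub>1\<close> keeps the first \<open>k\<close> coordinates and \<open>\<pi>\<^sub>2\<close> the others.\<close>

definition fiber :: "nat \<Rightarrow> 'a list set \<Rightarrow> 'a list \<Rightarrow> 'a list set" where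
  "fiber k T y = take k ` (drop k -` {y} \<inter> T)"

text \<open>The points of \<open>P\<close> and the open intervals between consecutive ones.\<close>

definition line_cells :: "('a::linorder) set \<Rightarrow> 'a set set" where
  "line_cells P = {{a} | a. a \<in> P} \<union>
     {{a<..<b} | a b. a \<in> P \<and> b \<in> P \<and> a < b \<and> {a<..<b} \<inter> P = {}} \<union>
     (if P = {} then {UNIV} else {{..<Min P}, {Max P<..}})"

definition definable_homeo_over ::
    "(nat \<Rightarrow> ('a::real_closed_field) list set set) \<Rightarrow> nat \<Rightarrow> 'a list set \<Rightarrow> ('a list \<Rightarrow> 'a list) \<Rightarrow> bool"
  where
  "definable_homeo_over S k C \<phi> \<longleftrightarrow>
     (let Z = C \<otimes>\<^sub>l Rn 1 in
       homeomorphic_map (subtopology (Rtop (Suc k)) Z) (subtopology (Rtop (Suc k)) Z) \<phi> \<and>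
       {z @ \<phi> z | z. z \<in> Z} \<in> S (Suc k + Suc k) \<and>
       (\<forall>z\<in>Z. take k (\<phi> z) = take k z))"

text \<open>
  The recursive description of a cdcd. In the step, the cells of the given cdcd \<open>\<C>'\<close> serve as
  their own indices: above \<open>C \<in> \<C>'\<close> one uses the homeomorphism \<open>\<phi> C\<close> and the cdcd of
  the line given by the finite set \<open>P C\<close>.
\<close>

inductive cdcd_rec ::
    "(nat \<Rightarrow> ('a::real_closed_field) list set set) \<Rightarrow> nat \<Rightarrow> 'a list set set \<Rightarrow> bool" for S where
  base: "finite P \<Longrightarrow> cdcd_rec S 1 (line ` line_cells P)"
| step: "cdcd_rec S k \<C>' \<Longrightarrow>
         (\<And>C. C \<in> \<C>' \<Longrightarrow> finite (P C) \<and> definable_homeo_over S k C (\<phi> C)) \<Longrightarrow>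
         cdcd_rec S (Suc k) (\<Union>C\<in>\<C>'. {\<phi> C ` (C \<otimes>\<^sub>l line D) | D. D \<in> line_cells (P C)})"

definition cdcd ::
    "(nat \<Rightarrow> ('a::real_closed_field) list set set) \<Rightarrow> nat \<Rightarrow> 'a list set set \<Rightarrow> bool" where
  "cdcd S k \<C> \<longleftrightarrow> finite \<C> \<and> partition_on (Rn k) \<C> \<and> \<C> \<subseteq> S k \<and> cdcd_rec S k \<C>"

definition adapted :: "'a list set set \<Rightarrow> 'a list set set \<Rightarrow> bool" where
  "adapted \<C> \<A> \<longleftrightarrow> (\<forall>A\<in>\<A>. \<exists>\<D>\<subseteq>\<C>. A = \<Union>\<D>)"

end

theory Submission
  imports Defs
begin

text \<open>
  The uniform finiteness theorem and the piecewise continuity theorem for o-minimal expansions of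
  real closed fields are proved without the monotonicity theorem and without cells. The pivot is an
  oscillation lemma: a definable function on an open box has arbitrarily small oscillation on some
  smaller box, since its image on a line either is finite or contains an interval. Together with
  definable choice it shows that a definable family of sets with interior has a common interval
  over a smaller box.

  The cells are then built by induction on \<open>k\<close>. By uniform finiteness finitely many definable
  functions \<open>g\<close> bound all fibers of \<open>T\<close> in the last coordinate. Below one asks
  for a decomposition on whose cells all \<open>g(\<cdot>, y\<^sub>i)\<close> are continuous, are ordered in a fixed way, and
  have fixed germs of the fibers of \<open>T\<close> over \<open>y\<^sub>j\<close> next to them. These conditions involve only
  two parameters at a time, so the induction hypothesis is applied with \<open>2\<ell>\<close> in place of \<open>\<ell>\<close>, and a cell
  above needs two more parameters, one for each of its bounding functions: \<open>N\<close> becomes \<open>2N + 2\<close>.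
\<close>

section \<open>Definable predicates, functions and families\<close>

context o_minimal
begin

text \<open>The germs are what keeps the conditions at two parameters. Whether the fiber of
  \<open>T\<close> over \<open>v\<close> contains the band between \<open>g\<close> at
  \<open>y\<close> and \<open>h\<close> at \<open>y'\<close> is a condition on three parameters. But
  no boundary point of that fiber lies inside a band, since its boundary points are themselves
  values of the bounding functions at \<open>v\<close>. Hence the germ at the graph of
  \<open>g\<close> already decides the whole band, and it involves only \<open>y\<close> and
  \<open>v\<close>. Starting from the one-point space with \<open>N = 0\<close>, the recursion
  solves to \<open>N = 2 * (2 ^ k - 1)\<close>.

  A second constraint comes from the form of a cdcd: all cells over a base cell are images of the
  cells of one decomposition of the line under one definable homeomorphism. The ordered functions
  over a base cell are therefore straightened simultaneously, by a map that is piecewise linear in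
  the last coordinate and takes integers to their values.

  The field need not be order complete. Connectedness arguments on the line rest instead on the
  infimum of a nonempty definable set that is bounded below.\<close>

definition def_pred :: "nat \<Rightarrow> ('a list \<Rightarrow> bool) \<Rightarrow> bool" where
  "def_pred n P \<longleftrightarrow> {x \<in> Rn n. P x} \<in> S n"

definition def_fun :: "nat \<Rightarrow> ('a list \<Rightarrow> 'a) \<Rightarrow> bool" where
  "def_fun n f \<longleftrightarrow> def_pred (Suc n) (\<lambda>z. z ! n = f (take n z))"

definition def_map :: "nat \<Rightarrow> nat \<Rightarrow> ('a list \<Rightarrow> 'a list) \<Rightarrow> bool" where
  "def_map n m F \<longleftrightarrow> (\<forall>x. length x = n \<longrightarrow> length (F x) = m) \<and> (\<forall>i<m. def_fun n (\<lambda>x. F x ! i))"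

definition def_fam :: "nat \<Rightarrow> ('a list \<Rightarrow> 'a set) \<Rightarrow> bool" where
  "def_fam n X \<longleftrightarrow> def_pred (Suc n) (\<lambda>z. z ! n \<in> X (take n z))"

section \<open>Boolean operations, projections and substitution\<close>

lemma def_pred_cong: "(\<And>x. length x = n \<Longrightarrow> P x = Q x) \<Longrightarrow> def_pred n P = def_pred n Q"
  unfolding def_pred_def Rn_def by (simp cong: conj_cong)

lemma def_fun_cong: "(\<And>x. length x = n \<Longrightarrow> f x = g x) \<Longrightarrow> def_fun n f = def_fun n g"
  unfolding def_fun_def by (rule def_pred_cong) simp

lemma def_pred_poly:
  assumes "f \<in> poly_fun n" shows "def_pred n (\<lambda>x. f x = 0)"
proof -
  have "algebraic_set n {x \<in> Rn n. f x = 0}"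
    unfolding algebraic_set_def using assms by (intro exI[of _ "{f}"]) auto
  then show ?thesis unfolding def_pred_def by (rule algebraic_definable)
qed

lemma poly_fun_diff:
  assumes "f \<in> poly_fun n" "g \<in> poly_fun n" shows "(\<lambda>x. f x - g x) \<in> poly_fun n"
proof -
  have "(\<lambda>x. f x + (- 1) * g x) \<in> poly_fun n"
    using assms by (intro poly_fun.intros)
  then show ?thesis by simp
qed

lemma def_pred_poly_eq:
  assumes "f \<in> poly_fun n" "g \<in> poly_fun n" shows "def_pred n (\<lambda>x. f x = g x)"
  using def_pred_poly[OF poly_fun_diff[OF assms]] by simp

lemma def_pred_const: "def_pred n (\<lambda>x. c)"
proof -
  have "def_pred n (\<lambda>x. (if c then 0 else 1) = (0::'a))"
    by (rule def_pred_poly) (rule poly_fun.const)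
  then show ?thesis by (simp split: if_splits)
qed

lemma def_pred_not: "def_pred n P \<Longrightarrow> def_pred n (\<lambda>x. \<not> P x)"
  unfolding def_pred_def using definable_compl[of "{x \<in> Rn n. P x}" n]
  by (simp add: set_diff_eq cong: conj_cong)

lemma def_pred_conj: "def_pred n P \<Longrightarrow> def_pred n Q \<Longrightarrow> def_pred n (\<lambda>x. P x \<and> Q x)"
  unfolding def_pred_def using definable_Int[of "{x \<in> Rn n. P x}" n "{x \<in> Rn n. Q x}"]
  by (simp add: Collect_conj_eq[symmetric] conj_ac Int_def cong: conj_cong)

lemma def_pred_disj: "def_pred n P \<Longrightarrow> def_pred n Q \<Longrightarrow> def_pred n (\<lambda>x. P x \<or> Q x)"
  using def_pred_not[OF def_pred_conj[OF def_pred_not[of n P] def_pred_not[of n Q]]] by simp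

lemma def_pred_imp: "def_pred n P \<Longrightarrow> def_pred n Q \<Longrightarrow> def_pred n (\<lambda>x. P x \<longrightarrow> Q x)"
  using def_pred_disj[OF def_pred_not[of n P], of Q] by simp

lemma def_pred_iff: "def_pred n P \<Longrightarrow> def_pred n Q \<Longrightarrow> def_pred n (\<lambda>x. P x \<longleftrightarrow> Q x)"
  using def_pred_conj[OF def_pred_imp[of n P Q] def_pred_imp[of n Q P]] by (simp add: iff_conv_conj_imp)

lemma def_pred_all_less: "(\<And>i. i < k \<Longrightarrow> def_pred n (P i)) \<Longrightarrow> def_pred n (\<lambda>x. \<forall>i<(k::nat). P i x)"
proof (induction k)
  case (Suc k)
  have "def_pred n (\<lambda>x. (\<forall>i<k. P i x) \<and> P k x)"
    using Suc by (intro def_pred_conj) auto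
  moreover have "(\<forall>i<Suc k. P i x) \<longleftrightarrow> (\<forall>i<k. P i x) \<and> P k x" for x
    by (auto simp: less_Suc_eq)
  ultimately show ?case by simp
qed (simp add: def_pred_const)

lemma definable_take:
  "A \<in> S (n + m) \<Longrightarrow> take n ` A \<in> S n"
proof (induction m arbitrary: A)
  case 0
  then have "take n ` A = id ` A" using definable_subset[OF 0] by (intro image_cong) (auto simp: Rn_def)
  then show ?case using 0 by simp
next
  case (Suc m)
  then have "take n ` (take (n + m) ` A) \<in> S n" using definable_proj[of A "n + m"] by simp
  then show ?case by (simp add: image_image min_def)
qed

lemma def_pred_take:
  assumes "def_pred (n + m) (\<lambda>z. Q (take n z) (drop n z))"
  shows "def_pred n (\<lambda>x. \<exists>w. length w = m \<and> Q x w)"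
proof -
  have "take n ` {z \<in> Rn (n + m). Q (take n z) (drop n z)} = {x \<in> Rn n. \<exists>w. length w = m \<and> Q x w}"
  proof safe
    fix z assume "z \<in> Rn (n + m)" "Q (take n z) (drop n z)"
    then show "take n z \<in> Rn n" "\<exists>w. length w = m \<and> Q (take n z) w"
      by (auto simp: Rn_def intro!: exI[of _ "drop n z"])
  next
    fix x w assume "x \<in> Rn n" "m = length w" "Q x w"
    then show "x \<in> take n ` {z \<in> Rn (n + length w). Q (take n z) (drop n z)}"
      by (intro image_eqI[of _ _ "x @ w"]) (auto simp: Rn_def)
  qed
  then show ?thesis using definable_take[of _ n m] assms unfolding def_pred_def by metis
qed

lemma def_pred_ex:
  assumes "def_pred (Suc n) (\<lambda>z. Q (take n z) (z ! n))"
  shows "def_pred n (\<lambda>x. \<exists>t. Q x t)"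
proof -
  have "def_pred (n + 1) (\<lambda>z. Q (take n z) (hd (drop n z)))"
    using assms by (subst def_pred_cong[where Q="\<lambda>z. Q (take n z) (z ! n)"]) (auto simp: hd_drop_conv_nth)
  from def_pred_take[OF this] have "def_pred n (\<lambda>x. \<exists>w. length w = 1 \<and> Q x (hd w))" .
  moreover have "(\<exists>w. length w = 1 \<and> Q x (hd w)) \<longleftrightarrow> (\<exists>t. Q x t)" for x
    by (metis (full_types) One_nat_def length_Cons list.sel(1) list.size(3))
  ultimately show ?thesis by simp
qed

lemma def_pred_all:
  assumes "def_pred (Suc n) (\<lambda>z. Q (take n z) (z ! n))"
  shows "def_pred n (\<lambda>x. \<forall>t. Q x t)"
  using def_pred_not[OF def_pred_ex[OF def_pred_not[OF assms]]] by simp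

text \<open>The axioms provide products and projections but no preimages. The preimage under a map
  of coordinates is obtained as the projection of the product of \<open>Rn n\<close> with the set of
  \<open>P\<close>, cut by the algebraic equations \<open>x ! \<sigma> i = w ! i\<close>.\<close>

lemma def_pred_reindex:
  assumes "def_pred m P" "\<And>i. i < m \<Longrightarrow> \<sigma> i < n"
  shows "def_pred n (\<lambda>x. P (map (\<lambda>i. x ! \<sigma> i) [0..<m]))"
proof -
  have "Rn n \<in> S n" using def_pred_const[of n True] by (simp add: def_pred_def)
  then have "Rn n \<otimes>\<^sub>l {w \<in> Rn m. P w} \<in> S (n + m)"
    using assms(1) definable_prod unfolding def_pred_def by blast
  moreover have "Rn n \<otimes>\<^sub>l {w \<in> Rn m. P w} = {z \<in> Rn (n + m). P (drop n z)}"
    unfolding lprod_def Rn_def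
    by auto (metis (full_types) append_take_drop_id diff_add_inverse length_drop length_take le_add1 min_absorb2)
  ultimately have "def_pred (n + m) (\<lambda>z. P (drop n z))" by (simp add: def_pred_def)
  moreover have "def_pred (n + m) (\<lambda>z. z ! \<sigma> i = z ! (n + i))" if "i < m" for i
    using that assms(2)[OF that] by (intro def_pred_poly_eq poly_fun.intros) auto
  ultimately have "def_pred (n + m) (\<lambda>z. P (drop n z) \<and> (\<forall>i<m. z ! \<sigma> i = z ! (n + i)))"
    by (intro def_pred_conj def_pred_all_less)
  moreover have "def_pred (n + m) (\<lambda>z. P (drop n z) \<and> (\<forall>i<m. z ! \<sigma> i = z ! (n + i))) \<longleftrightarrow>
      def_pred (n + m) (\<lambda>z. P (drop n z) \<and> (\<forall>i<m. take n z ! \<sigma> i = drop n z ! i))"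
    using assms(2) by (intro def_pred_cong) auto
  ultimately have *: "def_pred n (\<lambda>x. \<exists>w. length w = m \<and> P w \<and> (\<forall>i<m. x ! \<sigma> i = w ! i))"
    by (intro def_pred_take) simp
  have "(\<exists>w. length w = m \<and> P w \<and> (\<forall>i<m. x ! \<sigma> i = w ! i)) \<longleftrightarrow> P (map (\<lambda>i. x ! \<sigma> i) [0..<m])" for x
  proof
    assume "\<exists>w. length w = m \<and> P w \<and> (\<forall>i<m. x ! \<sigma> i = w ! i)"
    then obtain w where w: "length w = m" "P w" "\<forall>i<m. x ! \<sigma> i = w ! i" by auto
    then have "map (\<lambda>i. x ! \<sigma> i) [0..<m] = w" by (intro nth_equalityI) auto
    then show "P (map (\<lambda>i. x ! \<sigma> i) [0..<m])" using w by simp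
  qed (intro exI[of _ "map (\<lambda>i. x ! \<sigma> i) [0..<m]"], auto)
  then show ?thesis using * by simp
qed

lemma map_nth_take_snoc:
  assumes "n < length z" "i < length z"
  shows "map (\<lambda>j. z ! (if j < n then j else i)) [0..<Suc n] = take n z @ [z ! i]"
  using assms by (intro nth_equalityI) (auto simp: nth_append less_Suc_eq)

text \<open>The same projection as for a map of coordinates, with the graph equations
  \<open>w ! i = F x ! i\<close> in place of equations between coordinates.\<close>

lemma def_pred_subst:
  assumes "def_pred m P" "def_map n m F" shows "def_pred n (\<lambda>x. P (F x))"
proof -
  have 1: "def_pred (n + m) (\<lambda>z. P (drop n z))"
  proof -
    have "def_pred (n + m) (\<lambda>z. P (map (\<lambda>i. z ! (n + i)) [0..<m]))"
      by (rule def_pred_reindex[OF assms(1)]) auto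
    then show ?thesis
      by (subst def_pred_cong[where Q="\<lambda>z. P (map (\<lambda>i. z ! (n + i)) [0..<m])"])
         (auto intro!: arg_cong[where f=P] nth_equalityI)
  qed
  have 2: "def_pred (n + m) (\<lambda>z. drop n z ! i = F (take n z) ! i)" if "i < m" for i
  proof -
    have "def_pred (Suc n) (\<lambda>z. z ! n = F (take n z) ! i)"
      using assms(2) that by (auto simp: def_map_def def_fun_def)
    then have "def_pred (n + m) (\<lambda>z. map (\<lambda>j. z ! (if j < n then j else n + i)) [0..<Suc n] ! n =
        F (take n (map (\<lambda>j. z ! (if j < n then j else n + i)) [0..<Suc n])) ! i)"
      by (rule def_pred_reindex) (use that in auto)
    then show ?thesis
      by (subst (asm) def_pred_cong[where Q="\<lambda>z. drop n z ! i = F (take n z) ! i"])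
         (use that in \<open>auto simp: map_nth_take_snoc nth_append simp del: upt_Suc\<close>)
  qed
  have "def_pred (n + m) (\<lambda>z. P (drop n z) \<and> (\<forall>i<m. drop n z ! i = F (take n z) ! i))"
    using 1 2 by (intro def_pred_conj def_pred_all_less)
  from def_pred_take[of n m "\<lambda>x w. P w \<and> (\<forall>i<m. w ! i = F x ! i)", OF this]
  have "def_pred n (\<lambda>x. \<exists>w. length w = m \<and> P w \<and> (\<forall>i<m. w ! i = F x ! i))" .
  moreover have "(\<exists>w. length w = m \<and> P w \<and> (\<forall>i<m. w ! i = F x ! i)) \<longleftrightarrow> P (F x)"
    if "length x = n" for x
  proof -
    have "length (F x) = m" using that assms(2) by (auto simp: def_map_def)
    then show ?thesis by (metis nth_equalityI)
  qed
  ultimately show ?thesis by (subst (asm) def_pred_cong[where Q="\<lambda>x. P (F x)"])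
qed

section \<open>Definable terms\<close>

lemma def_fun_weaken:
  assumes "def_fun n f" shows "def_fun (Suc n) (\<lambda>z. f (take n z))"
proof -
  have "def_pred (Suc (Suc n)) (\<lambda>z. map (\<lambda>j. z ! (if j < n then j else Suc n)) [0..<Suc n] ! n =
        f (take n (map (\<lambda>j. z ! (if j < n then j else Suc n)) [0..<Suc n])))"
    using assms unfolding def_fun_def by (rule def_pred_reindex) auto
  then show ?thesis unfolding def_fun_def
    by (subst (asm) def_pred_cong[where Q="\<lambda>z. z ! Suc n = f (take n (take (Suc n) z))"])
       (auto simp: map_nth_take_snoc nth_append min_def simp del: upt_Suc)
qed

lemma def_fun_poly: "f \<in> poly_fun (Suc n) \<Longrightarrow> (\<And>z. length z = Suc n \<Longrightarrow> f z = g (take n z)) \<Longrightarrow> def_fun n g"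
  unfolding def_fun_def using def_pred_poly_eq[OF poly_fun.coord[of n "Suc n"], of f]
  by (metis (no_types, lifting) def_pred_cong lessI)

lemma def_fun_coord: "i < n \<Longrightarrow> def_fun n (\<lambda>x. x ! i)"
  by (rule def_fun_poly[where f="\<lambda>x. x ! i"]) (auto intro: poly_fun.intros)

lemma def_fun_const: "def_fun n (\<lambda>x. c)"
  by (rule def_fun_poly[where f="\<lambda>x. c"]) (auto intro: poly_fun.intros)

lemma def_map_append:
  assumes F: "def_map n m F" and G: "def_map n k G" and "m + k = j" shows "def_map n j (\<lambda>x. F x @ G x)"
  unfolding def_map_def
proof (intro conjI allI impI)
  fix i assume i: "i < j"
  show "def_fun n (\<lambda>x. (F x @ G x) ! i)"
  proof (cases "i < m")
    case True
    then have "def_fun n (\<lambda>x. F x ! i)" using F by (simp add: def_map_def)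
    then show ?thesis
      by (subst def_fun_cong[where g="\<lambda>x. F x ! i"]) (use True F in \<open>auto simp: def_map_def nth_append\<close>)
  next
    case False
    then have "def_fun n (\<lambda>x. G x ! (i - m))" using G i assms by (simp add: def_map_def)
    then show ?thesis
      by (subst def_fun_cong[where g="\<lambda>x. G x ! (i - m)"]) (use False F in \<open>auto simp: def_map_def nth_append\<close>)
  qed
qed (use assms in \<open>auto simp: def_map_def\<close>)

lemma def_map_single: "def_fun n f \<Longrightarrow> def_map n (Suc 0) (\<lambda>x. [f x])"
  by (simp add: def_map_def)

lemma def_fun_subst:
  assumes "def_fun m f" "def_map n m F" shows "def_fun n (\<lambda>x. f (F x))"
proof -
  have "def_map (Suc n) m (\<lambda>z. F (take n z))"
    using assms(2) def_fun_weaken unfolding def_map_def by auto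
  then have "def_map (Suc n) (Suc m) (\<lambda>z. F (take n z) @ [z ! n])"
    by (rule def_map_append) (auto intro: def_map_single def_fun_coord)
  from def_pred_subst[OF assms(1)[unfolded def_fun_def] this] show ?thesis
    unfolding def_fun_def
    by (subst (asm) def_pred_cong[where Q="\<lambda>z. z ! n = f (F (take n z))"])
       (use assms(2) in \<open>auto simp: def_map_def nth_append\<close>)
qed

lemma def_map_id: "def_map n n (\<lambda>x. x)"
  by (simp add: def_map_def def_fun_coord)

lemma def_fun_nth: "def_map n m F \<Longrightarrow> i < m \<Longrightarrow> def_fun n (\<lambda>x. F x ! i)"
  by (simp add: def_map_def)

lemma def_map_Nil: "def_map n 0 (\<lambda>x. [])"
  by (simp add: def_map_def)

lemma def_map_Cons: "def_fun n f \<Longrightarrow> def_map n m F \<Longrightarrow> def_map n (Suc m) (\<lambda>x. f x # F x)"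
  using def_map_append[OF def_map_single, of n f m F "Suc m"] by simp

lemma def_map_take: "def_map n m F \<Longrightarrow> k \<le> m \<Longrightarrow> def_map n k (\<lambda>x. take k (F x))"
  by (simp add: def_map_def)

lemma def_map_drop:
  assumes "def_map n m F" "j + k = m" shows "def_map n j (\<lambda>x. drop k (F x))"
  unfolding def_map_def
proof (intro conjI allI impI)
  fix i assume i: "i < j"
  have "def_fun n (\<lambda>x. F x ! (k + i))" using assms i by (simp add: def_map_def)
  then show "def_fun n (\<lambda>x. drop k (F x) ! i)"
    by (subst def_fun_cong[where g="\<lambda>x. F x ! (k + i)"]) (use assms in \<open>auto simp: def_map_def\<close>)
qed (use assms in \<open>auto simp: def_map_def\<close>)

lemma def_map_const: "length c = m \<Longrightarrow> def_map n m (\<lambda>x. c)"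
  by (simp add: def_map_def def_fun_const)

lemma def_pred_mem: "A \<in> S m \<Longrightarrow> def_map n m F \<Longrightarrow> def_pred n (\<lambda>x. F x \<in> A)"
proof -
  assume A: "A \<in> S m" and F: "def_map n m F"
  have "{x \<in> Rn m. x \<in> A} = A" using definable_subset[OF A] by auto
  then have "def_pred m (\<lambda>x. x \<in> A)" using A by (simp add: def_pred_def)
  from def_pred_subst[OF this F] show ?thesis .
qed

lemma def_pred_eq:
  assumes "def_fun n f" "def_fun n g" shows "def_pred n (\<lambda>x. f x = g x)"
proof -
  have "def_pred (Suc (Suc 0)) (\<lambda>w. w ! 0 = w ! Suc 0)"
    by (intro def_pred_poly_eq poly_fun.intros) auto
  from def_pred_subst[OF this, of n "\<lambda>x. [f x, g x]"] show ?thesis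
    using assms by (simp add: def_map_Cons def_map_Nil)
qed

lemma def_fun_binop:
  assumes "(\<lambda>w. h (w ! 0) (w ! Suc 0)) \<in> poly_fun (Suc (Suc (Suc 0)))" "def_fun n f" "def_fun n g"
  shows "def_fun n (\<lambda>x. h (f x) (g x))"
proof -
  have "def_fun (Suc (Suc 0)) (\<lambda>w. h (w ! 0) (w ! Suc 0))"
    by (rule def_fun_poly[OF assms(1)]) simp
  from def_fun_subst[OF this, of n "\<lambda>x. [f x, g x]"] show ?thesis
    using assms by (simp add: def_map_Cons def_map_Nil)
qed

lemma def_fun_add: "def_fun n f \<Longrightarrow> def_fun n g \<Longrightarrow> def_fun n (\<lambda>x. f x + g x)"
  by (rule def_fun_binop) (auto intro!: poly_fun.intros)

lemma def_fun_mult: "def_fun n f \<Longrightarrow> def_fun n g \<Longrightarrow> def_fun n (\<lambda>x. f x * g x)"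
  by (rule def_fun_binop) (auto intro!: poly_fun.intros)

lemma def_fun_diff: "def_fun n f \<Longrightarrow> def_fun n g \<Longrightarrow> def_fun n (\<lambda>x. f x - g x)"
  by (rule def_fun_binop) (auto intro!: poly_fun.intros poly_fun_diff)

lemma def_fun_sum: "(\<And>i. i \<in> I \<Longrightarrow> def_fun n (f i)) \<Longrightarrow> def_fun n (\<lambda>x. \<Sum>i\<in>I. f i x)"
  by (induction I rule: infinite_finite_induct) (auto intro: def_fun_const def_fun_add)

text \<open>Square roots make the order the projection of an algebraic relation, so that comparisons
  of definable functions reduce to equations and a quantifier.\<close>

lemma square_iff: "(\<exists>t. (b::'a) - a = t * t \<and> t \<noteq> 0) \<longleftrightarrow> a < b"
proof
  assume "a < b"
  then obtain x where "x * x = b - a" using ex_square_root[of "b - a"] by auto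
  then show "\<exists>t. b - a = t * t \<and> t \<noteq> 0" using \<open>a < b\<close> by (intro exI[of _ x]) auto
qed (metis diff_gt_0_iff_gt not_square_less_zero linorder_neqE mult_eq_0_iff)

lemma def_pred_less:
  assumes "def_fun n f" "def_fun n g" shows "def_pred n (\<lambda>x. f x < g x)"
proof -
  have "def_pred n (\<lambda>x. \<exists>t. g x - f x = t * t \<and> t \<noteq> 0)"
    using assms by (intro def_pred_ex def_pred_conj def_pred_not def_pred_eq def_fun_diff def_fun_mult def_fun_const
      def_fun_coord def_fun_weaken) auto
  then show ?thesis by (simp add: square_iff)
qed

lemma def_pred_le: "def_fun n f \<Longrightarrow> def_fun n g \<Longrightarrow> def_pred n (\<lambda>x. f x \<le> g x)"
  using def_pred_not[OF def_pred_less[of n g f]] by (simp add: not_less)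

lemma def_fun_if:
  assumes "def_pred n P" "def_fun n f" "def_fun n g" shows "def_fun n (\<lambda>x. if P x then f x else g x)"
proof -
  have "def_map (Suc n) n (take n)" by (rule def_map_take[OF def_map_id]) simp
  from def_pred_subst[OF assms(1) this]
  have "def_pred (Suc n) (\<lambda>z. (P (take n z) \<longrightarrow> z ! n = f (take n z)) \<and> (\<not> P (take n z) \<longrightarrow> z ! n = g (take n z)))"
    using assms by (intro def_pred_conj def_pred_imp def_pred_not) (auto simp: def_fun_def)
  moreover have "(z ! n = (if P (take n z) then f (take n z) else g (take n z))) \<longleftrightarrow>
     ((P (take n z) \<longrightarrow> z ! n = f (take n z)) \<and> (\<not> P (take n z) \<longrightarrow> z ! n = g (take n z)))" for z
    by auto
  ultimately show ?thesis unfolding def_fun_def by simp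
qed

lemma def_fun_uminus: "def_fun n f \<Longrightarrow> def_fun n (\<lambda>x. - f x)"
  using def_fun_diff[OF def_fun_const[of n 0], of f] by simp

lemma def_fun_abs: "def_fun n f \<Longrightarrow> def_fun n (\<lambda>x. \<bar>f x\<bar>)"
  using def_fun_if[OF def_pred_less[OF _ def_fun_const[of n 0], of f], of "\<lambda>x. - f x" f] 
  by (simp add: abs_if[abs_def] def_fun_uminus)

lemma def_fun_max: "def_fun n f \<Longrightarrow> def_fun n g \<Longrightarrow> def_fun n (\<lambda>x. max (f x) (g x))"
  unfolding max_def by (intro def_fun_if def_pred_le)

lemma def_fun_min: "def_fun n f \<Longrightarrow> def_fun n g \<Longrightarrow> def_fun n (\<lambda>x. min (f x) (g x))"
  unfolding min_def by (intro def_fun_if def_pred_le)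

lemma def_fun_divide:
  assumes "def_fun n f" "def_fun n g" shows "def_fun n (\<lambda>x. f x / g x)"
proof -
  \<comment> \<open>Division by zero has value \<open>0\<close>, which the first disjunct accounts
    for; the second is the graph of the quotient elsewhere.\<close>
  have "def_pred (Suc n) (\<lambda>z. (g (take n z) = 0 \<and> z ! n = 0) \<or>
      (g (take n z) \<noteq> 0 \<and> z ! n * g (take n z) = f (take n z)))"
    using assms by (intro def_pred_disj def_pred_conj def_pred_not def_pred_eq def_fun_mult def_fun_const
      def_fun_coord def_fun_weaken) auto
  moreover have "(z ! n = f (take n z) / g (take n z)) \<longleftrightarrow> (g (take n z) = 0 \<and> z ! n = 0) \<or>
      (g (take n z) \<noteq> 0 \<and> z ! n * g (take n z) = f (take n z))" for z
    by (cases "g (take n z) = 0") (simp_all add: nonzero_eq_divide_eq)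
  ultimately show ?thesis unfolding def_fun_def by simp
qed

lemma def_pred_fam:
  assumes "def_fam m X" "def_map n m F" "def_fun n g" shows "def_pred n (\<lambda>x. g x \<in> X (F x))"
proof -
  have "def_map n (Suc m) (\<lambda>x. F x @ [g x])"
    using assms by (intro def_map_append[OF _ def_map_single]) auto
  from def_pred_subst[OF assms(1)[unfolded def_fam_def] this] show ?thesis
    by (subst (asm) def_pred_cong[where Q="\<lambda>x. g x \<in> X (F x)"])
       (use assms(2) in \<open>auto simp: def_map_def nth_append\<close>)
qed

lemma def_pred_Ball:
  "def_pred (Suc n) (\<lambda>z. z ! n \<in> X (take n z) \<longrightarrow> Q (take n z) (z ! n)) \<Longrightarrow> def_pred n (\<lambda>x. \<forall>t\<in>X x. Q x t)"
  unfolding Ball_def by (rule def_pred_all)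

lemma def_pred_Bex:
  "def_pred (Suc n) (\<lambda>z. z ! n \<in> X (take n z) \<and> Q (take n z) (z ! n)) \<Longrightarrow> def_pred n (\<lambda>x. \<exists>t\<in>X x. Q x t)"
  unfolding Bex_def by (rule def_pred_ex)

text \<open>With these as introduction rules, definability is read off the shape of a defining
  formula. Later proofs prepend the instances for the families and functions at hand.\<close>

lemmas def_intros = def_pred_not def_pred_conj def_pred_disj def_pred_imp def_pred_iff def_pred_Ball def_pred_Bex def_pred_ex def_pred_all
  def_pred_eq def_pred_less def_pred_le def_pred_const
  def_fun_const def_fun_nth def_fun_add def_fun_mult def_fun_diff def_fun_divide def_fun_uminus def_fun_abs def_fun_max def_fun_min
  def_map_take def_map_drop def_map_append def_map_Cons def_map_Nil def_map_id

end

section \<open>Definable subsets of the line\<close>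

definition tame :: "('a::linorder) set \<Rightarrow> bool" where
  "tame X \<longleftrightarrow> (\<exists>\<J>. finite \<J> \<and> (\<forall>J\<in>\<J>. point_or_interval J) \<and> X = \<Union>\<J>)"

text \<open>The points where this fails form the topological boundary of \<open>X\<close> in the
  order topology. Stated with order bounds, it is first-order in \<open>X\<close>, so the boundaries
  of a definable family again form a definable family.\<close>

definition loc_const :: "('a::linorder) set \<Rightarrow> 'a \<Rightarrow> bool" where
  "loc_const X r \<longleftrightarrow> (\<exists>a b. a < r \<and> r < b \<and> (\<forall>t. a < t \<and> t < b \<longrightarrow> (t \<in> X \<longleftrightarrow> r \<in> X)))"

definition bdry :: "('a::linorder) set \<Rightarrow> 'a set" where
  "bdry X = {r. \<not> loc_const X r}"

text \<open>For finite \<open>D\<close>, these points meet every component of the complement of \<open>D\<close>.\<close>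

definition test_points :: "('a::linordered_field) set \<Rightarrow> 'a set" where
  "test_points D = {0} \<union> D \<union> {b - 1 |b. b \<in> D} \<union> {b + 1 |b. b \<in> D} \<union>
     {(b + c) / 2 |b c. b \<in> D \<and> c \<in> D}"

text \<open>The form in which o-minimality enters most arguments below: to prove a definable set
  finite, assume that it contains an interval and shrink that interval to a contradiction.\<close>

lemma tame_infinite:
  fixes X :: "('a::linordered_field) set"
  assumes "tame X" "infinite X" obtains a b where "a < b" "{a<..<b} \<subseteq> X"
proof -
  obtain \<J> where J: "finite \<J>" "\<forall>J\<in>\<J>. point_or_interval J" "X = \<Union>\<J>"
    using assms(1) unfolding tame_def by blast
  then obtain J where J': "J \<in> \<J>" "infinite J" using assms(2) by blast
  then have "point_or_interval J" using J by blast
  then consider a b where "J = {a<..<b}" | a where "J = {..<a}" | a where "J = {a<..}" | "J = UNIV"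
    using J'(2) by (auto simp: point_or_interval_def)
  then have "\<exists>a b. a < b \<and> {a<..<b} \<subseteq> J"
  proof cases
    case (1 a b)
    then have "a < b" using J'(2) by (metis finite.emptyI greaterThanLessThan_empty_iff not_le)
    then show ?thesis using 1 by blast
  next
    case (2 a) then show ?thesis by (intro exI[of _ "a - 1"] exI[of _ a]) auto
  next
    case (3 a) then show ?thesis by (intro exI[of _ a] exI[of _ "a + 1"]) auto
  next
    case 4 then show ?thesis by (intro exI[of _ 0] exI[of _ 1]) auto
  qed
  then show ?thesis using that J'(1) J(3) by blast
qed

lemma loc_const_Un:
  assumes "loc_const X r" "loc_const Y r" shows "loc_const (X \<union> Y) r"
proof -
  obtain a b where ab: "a < r" "r < b" "\<And>t. a < t \<and> t < b \<longrightarrow> (t \<in> X \<longleftrightarrow> r \<in> X)"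
    using assms(1) by (auto simp: loc_const_def)
  obtain c d where cd: "c < r" "r < d" "\<And>t. c < t \<and> t < d \<longrightarrow> (t \<in> Y \<longleftrightarrow> r \<in> Y)"
    using assms(2) by (auto simp: loc_const_def)
  have "\<forall>t. max a c < t \<and> t < min b d \<longrightarrow> (t \<in> X \<union> Y \<longleftrightarrow> r \<in> X \<union> Y)"
    using ab(3) cd(3) by simp
  moreover have "max a c < r" "r < min b d" using ab cd by simp_all
  ultimately show ?thesis unfolding loc_const_def by blast
qed

text \<open>Points and intervals have only their endpoints as boundary, and the boundary of a union
  lies in the union of the boundaries.\<close>

lemma finite_bdry:
  fixes X :: "('a::linordered_field) set"
  assumes "tame X" shows "finite (bdry X)"
proof -
  obtain \<J> where J: "finite \<J>" "\<forall>J\<in>\<J>. point_or_interval J" "X = \<Union>\<J>"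
    using assms(1) unfolding tame_def by blast
  have int: "loc_const J r" if "a < r" "r < b" "\<And>t. a < t \<Longrightarrow> t < b \<Longrightarrow> t \<in> J \<longleftrightarrow> r \<in> J"
    for J :: "'a set" and a b r using that unfolding loc_const_def by blast
  have one_end: "\<exists>E. finite E \<and> (\<forall>r. r \<notin> E \<longrightarrow> loc_const J r)" if J: "J = {a} \<or> J = {..<a} \<or> J = {a<..}"
    for J :: "'a set" and a
  proof -
    have "loc_const J r" if "r \<noteq> a" for r
    proof (cases "r < a")
      case True then show ?thesis using J by (intro int[of "r - 1" _ a]) auto
    next
      case False then show ?thesis using J that by (intro int[of a _ "r + 1"]) auto
    qed
    then show ?thesis by (intro exI[of _ "{a}"]) auto
  qed
  have 1: "finite (bdry J)" if pj: "point_or_interval J" for J :: "'a set"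
  proof -
    have ends: "\<exists>E. finite E \<and> (\<forall>r. r \<notin> E \<longrightarrow> loc_const J r)"
      using pj unfolding point_or_interval_def
    proof (elim disjE exE)
      fix a b assume Ja: "J = {a<..<b}"
      have "loc_const J r" if r: "r \<noteq> a" "r \<noteq> b" for r
      proof -
        consider "r < a" | "b < r" | "a < r" "r < b" using r by (metis linorder_neqE)
        then show ?thesis
        proof cases
          case 1 then show ?thesis by (intro int[of "r - 1" _ a]) (auto simp: Ja)
        next
          case 2 then show ?thesis by (intro int[of b _ "r + 1"]) (auto simp: Ja)
        next
          case 3 then show ?thesis by (intro int[of a _ b]) (auto simp: Ja)
        qed
      qed
      then show ?thesis by (intro exI[of _ "{a,b}"]) auto
    next
      assume "J = UNIV"
      then have "loc_const J r" for r by (intro int[of "r - 1" _ "r + 1"]) auto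
      then show ?thesis by (intro exI[of _ "{}"]) auto
    qed (use one_end in auto)
    then obtain E where "finite E" "bdry J \<subseteq> E" by (auto simp: bdry_def)
    then show ?thesis using finite_subset by blast
  qed
  have "bdry (\<Union>\<J>) \<subseteq> (\<Union>J\<in>\<J>. bdry J)"
    using J(1)
  proof (induction \<J> rule: finite_induct)
    case empty
    have "loc_const {} r" for r :: 'a by (intro int[of "r - 1" _ "r + 1"]) auto
    then show ?case by (auto simp: bdry_def)
  next
    case (insert J \<J>)
    then show ?case using loc_const_Un[of J _ "\<Union>\<J>"] by (auto simp: bdry_def)
  qed
  then show ?thesis using J 1 by (auto intro: finite_subset)
qed

text \<open>Replaces order completeness, which the field may lack. The infimum is the smallest of
  the infima of the finitely many nonempty pieces, and for a single piece it is an explicit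
  endpoint.\<close>

lemma tame_Inf:
  fixes X :: "('a::linordered_field) set"
  assumes "tame X" "X \<noteq> {}" "\<And>x. x \<in> X \<Longrightarrow> c \<le> x"
  obtains i where "\<And>x. x \<in> X \<Longrightarrow> i \<le> x" "\<And>e. i < e \<Longrightarrow> \<exists>x\<in>X. x < e"
proof -
  obtain \<J> where J: "finite \<J>" "\<forall>J\<in>\<J>. point_or_interval J" "X = \<Union>\<J>"
    using assms(1) unfolding tame_def by blast
  define inf where "inf = (\<lambda>J i. (\<forall>x\<in>J. i \<le> x) \<and> (\<forall>e>i. \<exists>x\<in>J. x < (e::'a)))"
  have 1: "\<exists>i. inf J i" if pj: "point_or_interval J" "J \<noteq> {}" "\<And>x. x \<in> J \<Longrightarrow> c \<le> x" for J :: "'a set"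
    using pj(1) unfolding point_or_interval_def
  proof (elim disjE exE)
    fix a assume "J = {a}" then show ?thesis by (intro exI[of _ a]) (auto simp: inf_def)
  next
    fix a assume "J = {..<a}"
    then have "min (a - 1) (c - 1) \<in> J" by (auto simp: min_less_iff_disj)
    then show ?thesis using pj(3)[of "min (a - 1) (c - 1)"] by (auto simp: min_def split: if_splits)
  next
    fix a assume "J = {a<..}"
    then show ?thesis by (intro exI[of _ a]) (auto simp: inf_def dest: dense)
  next
    fix a b assume Ja: "J = {a<..<b}"
    then have "a < b" using pj(2) by force
    have "\<exists>x\<in>{a<..<b}. x < e" if "a < e" for e
      using dense[of a "min b e"] that \<open>a < b\<close> by auto
    then show ?thesis using Ja by (intro exI[of _ a]) (auto simp: inf_def)
  next
    assume "J = UNIV"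
    then show ?thesis using pj(3)[of "c - 1"] by auto
  qed
  have "\<Union>\<J> \<noteq> {} \<Longrightarrow> (\<forall>J\<in>\<J>. J \<noteq> {} \<longrightarrow> (\<exists>i. inf J i)) \<Longrightarrow> \<exists>i. inf (\<Union>\<J>) i"
    using J(1)
  proof (induction \<J> rule: finite_induct)
    case (insert J \<J>)
    consider "J = {}" | "\<Union>\<J> = {}" | i j where "inf J i" "inf (\<Union>\<J>) j"
      using insert by auto
    then show ?case
    proof cases
      case 3
      then have "inf (\<Union>(insert J \<J>)) (min i j)"
        unfolding inf_def Union_insert ball_Un bex_Un by (auto simp: min_le_iff_disj min_less_iff_disj)
      then show ?thesis by blast
    next
      case 2
      then have "\<Union>(insert J \<J>) = J" by blast
      then show ?thesis using insert.prems by simp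
    qed (use insert in simp)
  qed simp
  then have "\<exists>i. inf X i" using J assms 1 by (metis Union_iff)
  then show ?thesis using that by (auto simp: inf_def)
qed

lemma test_points_exists:
  fixes D :: "('a::linordered_field) set"
  assumes "finite D"
  obtains q where "q \<in> test_points D" "q = r \<or> D \<inter> {min r q..max r q} = {}"
proof -
  define L where "L = {b \<in> D. b < r}"
  define U where "U = {b \<in> D. r < b}"
  have fin: "finite L" "finite U" using assms by (auto simp: L_def U_def)
  have L: "b \<le> Max L" if "b \<in> D" "b < r" for b using that fin by (auto simp: L_def)
  have U: "Min U \<le> b" if "b \<in> D" "r < b" for b using that fin by (auto simp: U_def)
  have maxL: "Max L \<in> D \<and> Max L < r" if "L \<noteq> {}" using Max_in[OF fin(1) that] by (auto simp: L_def)
  have minU: "Min U \<in> D \<and> r < Min U" if "U \<noteq> {}" using Min_in[OF fin(2) that] by (auto simp: U_def)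
  consider "r \<in> D" | "r \<notin> D" "L = {}" "U = {}" | "r \<notin> D" "L \<noteq> {}" "U = {}"
    | "r \<notin> D" "L = {}" "U \<noteq> {}" | "r \<notin> D" "L \<noteq> {}" "U \<noteq> {}" by blast
  then show ?thesis
  proof cases
    case 1 then show ?thesis using that[of r] by (auto simp: test_points_def)
  next
    case 2
    have "D = {}"
    proof (rule equals0I)
      fix b assume "b \<in> D"
      then show False using 2 linorder_neqE[of b r] unfolding L_def U_def by blast
    qed
    then show ?thesis using that[of 0] by (auto simp: test_points_def)
  next
    case 3
    have "b < min r (Max L + 1)" if "b \<in> D" for b
    proof -
      have "b < r" using that 3 linorder_neqE[of b r] unfolding U_def by blast
      then show ?thesis using L[OF that] by (auto intro: le_less_trans)
    qed
    then show ?thesis using that[of "Max L + 1"] maxL 3 by (force simp: test_points_def)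
  next
    case 4
    have "max r (Min U - 1) < b" if "b \<in> D" for b
    proof -
      have "r < b" using that 4 linorder_neqE[of b r] unfolding L_def by blast
      then show ?thesis using U[OF that] by (auto simp: less_le_trans diff_less_eq intro: le_less_trans)
    qed
    then show ?thesis using that[of "Min U - 1"] minU 4 by (force simp: test_points_def)
  next
    case 5
    define q where "q = (Max L + Min U) / 2"
    have q: "Max L < q" "q < Min U" using maxL[OF 5(2)] minU[OF 5(3)] by (auto simp: q_def field_simps)
    have "\<not> (min r q \<le> b \<and> b \<le> max r q)" if "b \<in> D" for b
    proof (cases "b < r")
      case True
      then show ?thesis using L[OF that True] q by (auto simp: min_le_iff_disj)
    next
      case False
      then have "r < b" using that 5 by (metis linorder_neqE)
      then show ?thesis using U[OF that] q by (auto simp: le_max_iff_disj)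
    qed
    moreover have "q \<in> test_points D" using maxL[OF 5(2)] minU[OF 5(3)] by (auto simp: q_def test_points_def)
    ultimately show ?thesis using that[of q] by fastforce
  qed
qed

lemma finite_test_points: "finite D \<Longrightarrow> finite (test_points D)"
  unfolding test_points_def by (intro finite_UnI finite_image_set2 finite_image_set) auto

lemma mem_test_points:
  "q \<in> test_points D \<longleftrightarrow> q = 0 \<or> q \<in> D \<or> (\<exists>b\<in>D. q = b - 1 \<or> q = b + 1 \<or> (\<exists>c\<in>D. q = (b + c) / 2))"
  unfolding test_points_def by blast

section \<open>Definable connectedness and definable choice\<close>

context o_minimal
begin

lemma def_pred_line: "def_pred (Suc 0) (\<lambda>z. z ! 0 \<in> X) \<longleftrightarrow> tame X"
proof -
  have "{z \<in> Rn (Suc 0). z ! 0 \<in> X} = line X"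
    by (auto simp: Rn_def line_def length_Suc_conv)
  moreover have "line X = line Y \<longleftrightarrow> X = Y" for Y :: "'a set"
    unfolding line_def by (rule inj_image_eq_iff) (simp add: inj_def)
  ultimately show ?thesis
    unfolding def_pred_def tame_def using definable_line by auto
qed

lemma def_fam_tame:
  assumes "def_fam n X" "length p = n" shows "tame (X p)"
  using def_pred_fam[OF assms(1) def_map_const[OF assms(2)] def_fun_coord[of 0 "Suc 0"]] by (simp add: def_pred_line)

text \<open>Definable connectedness of a closed segment. The points whose membership differs from
  that of \<open>r\<close> form a tame set. Local constancy at its infimum \<open>c\<close> makes
  \<open>c\<close> differ as well, and then so do points just to the left of
  \<open>c\<close>.\<close>

lemma loc_const_interval:
  fixes X :: "'a set"
  assumes X: "tame X" and "r \<le> q" and lc: "\<And>t. r \<le> t \<Longrightarrow> t \<le> q \<Longrightarrow> loc_const X t"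
  shows "r \<in> X \<longleftrightarrow> q \<in> X"
proof (rule ccontr)
  assume neq: "\<not> ?thesis"
  define Y where "Y = {t. r \<le> t \<and> t \<le> q \<and> \<not> (t \<in> X \<longleftrightarrow> r \<in> X)}"
  have "def_pred (Suc 0) (\<lambda>z. r \<le> z ! 0 \<and> z ! 0 \<le> q \<and> \<not> (z ! 0 \<in> X \<longleftrightarrow> r \<in> X))"
    using X[folded def_pred_line] by - (rule def_intros | assumption | simp)+
  then have "tame Y" using def_pred_line[of Y] by (simp add: Y_def)
  moreover have "q \<in> Y" using neq \<open>r \<le> q\<close> by (auto simp: Y_def)
  moreover have "r \<le> x" if "x \<in> Y" for x using that by (simp add: Y_def)
  ultimately obtain c where c: "\<And>x. x \<in> Y \<Longrightarrow> c \<le> x" "\<And>e. c < e \<Longrightarrow> \<exists>x\<in>Y. x < e"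
    using tame_Inf[of Y r] by blast
  have "r \<le> c"
  proof (rule ccontr)
    assume "\<not> r \<le> c"
    then show False using c(2)[of r] by (auto simp: Y_def)
  qed
  have "c \<le> q" using c(1) \<open>q \<in> Y\<close> by blast
  have "loc_const X c" using lc \<open>r \<le> c\<close> \<open>c \<le> q\<close> by blast
  then obtain a b where ab: "a < c" "c < b" "\<And>t. a < t \<Longrightarrow> t < b \<Longrightarrow> t \<in> X \<longleftrightarrow> c \<in> X"
    unfolding loc_const_def by auto
  obtain x where x: "x \<in> Y" "x < b" using c(2)[OF ab(2)] by blast
  have "c \<le> x" using c x by blast
  then have "x \<in> X \<longleftrightarrow> c \<in> X" using ab(1) ab(3)[of x] x(2) by simp
  then have cX: "\<not> (c \<in> X \<longleftrightarrow> r \<in> X)" using x by (auto simp: Y_def)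
  then have "r < c" using \<open>r \<le> c\<close> by (auto simp: le_less)
  then obtain t where t: "max a r < t" "t < c" using dense[of "max a r" c] ab by auto
  then have "t \<in> X \<longleftrightarrow> c \<in> X" using ab(2) ab(3)[of t] by simp
  then have "t \<in> Y" using cX t \<open>c \<le> q\<close> by (auto simp: Y_def)
  then show False using c(1)[of t] t by simp
qed

text \<open>The minimum is described by a first-order formula; the value \<open>0\<close> on empty
  fibers keeps the function total.\<close>

lemma def_fun_Min:
  assumes X: "def_fam n X" and fin: "\<And>p. length p = n \<Longrightarrow> finite (X p)"
  shows "def_fun n (\<lambda>p. if X p = {} then 0 else Min (X p))"
proof -
  have "def_pred (Suc n) (\<lambda>z. (z ! n \<in> X (take n z) \<and> (\<forall>s\<in>X (take n z). z ! n \<le> s)) \<or>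
     (\<not> (\<exists>s\<in>X (take n z). True) \<and> z ! n = 0))"
    by (rule def_pred_fam[OF X] def_intros | simp)+
  moreover have "z ! n = (if X (take n z) = {} then 0 else Min (X (take n z))) \<longleftrightarrow>
     (z ! n \<in> X (take n z) \<and> (\<forall>s\<in>X (take n z). z ! n \<le> s)) \<or>
     (\<not> (\<exists>s\<in>X (take n z). True) \<and> z ! n = 0)" if "length z = Suc n" for z
    using fin[of "take n z"] that by (auto simp: eq_Min_iff Min_eq_iff)
  ultimately show ?thesis unfolding def_fun_def by (subst def_pred_cong) auto
qed

lemma def_fam_bdry:
  assumes X: "def_fam n X" shows "def_fam n (\<lambda>p. bdry (X p))"
  unfolding def_fam_def bdry_def loc_const_def mem_Collect_eq
  by (rule def_pred_fam[OF X] def_intros | simp)+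

lemma def_fam_test_points:
  assumes X: "def_fam n X" shows "def_fam n (\<lambda>p. test_points (X p))"
  unfolding def_fam_def mem_test_points
  by (rule def_pred_fam[OF X] def_intros | simp)+

lemma def_fam_Int: "def_fam n X \<Longrightarrow> def_fam n Y \<Longrightarrow> def_fam n (\<lambda>p. X p \<inter> Y p)"
  unfolding def_fam_def Int_iff by (rule def_pred_conj)

text \<open>Membership in \<open>X p\<close> is constant between consecutive points of its finite
  boundary. Hence the test points of the boundary that lie in \<open>X p\<close> form a finite set,
  nonempty whenever \<open>X p\<close> is, and its minimum depends definably on
  \<open>p\<close>.\<close>

lemma definable_choice:
  assumes X: "def_fam n X"
  obtains f where "def_fun n f" "\<And>p. length p = n \<Longrightarrow> X p \<noteq> {} \<Longrightarrow> f p \<in> X p"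
proof -
  define Y where "Y = (\<lambda>p. X p \<inter> test_points (bdry (X p)))"
  have Y: "def_fam n Y" unfolding Y_def by (intro def_fam_Int def_fam_test_points def_fam_bdry X)
  have fin: "finite (Y p)" if "length p = n" for p
    unfolding Y_def using finite_test_points[OF finite_bdry[OF def_fam_tame[OF X that]]] by simp
  have ne: "Y p \<noteq> {}" if p: "length p = n" and x: "x \<in> X p" for p x
  proof -
    have t: "tame (X p)" using def_fam_tame[OF X p] .
    obtain q where q: "q \<in> test_points (bdry (X p))" "q = x \<or> bdry (X p) \<inter> {min x q..max x q} = {}"
      using test_points_exists[OF finite_bdry[OF t]] by metis
    have "q \<in> X p"
    proof (cases "q = x")
      case False
      then have "loc_const (X p) s" if "min x q \<le> s" "s \<le> max x q" for s
        using that q by (auto simp: bdry_def)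
      then have "min x q \<in> X p \<longleftrightarrow> max x q \<in> X p"
        using loc_const_interval[OF t, of "min x q" "max x q"] by (auto simp: min_le_iff_disj)
      then show ?thesis using x by (auto simp: min_def max_def split: if_splits)
    qed (use x in simp)
    then show ?thesis using q by (auto simp: Y_def)
  qed
  show ?thesis
  proof (rule that[OF def_fun_Min[OF Y fin]])
    fix p assume p: "length p = n" "X p \<noteq> {}"
    then have "Y p \<noteq> {}" using ne by blast
    then have "Min (Y p) \<in> Y p" using fin[OF p(1)] by simp
    then show "(if Y p = {} then 0 else Min (Y p)) \<in> X p" using \<open>Y p \<noteq> {}\<close> by (simp add: Y_def)
  qed
qed

end

section \<open>Oscillation on boxes\<close>

inductive open_box :: "nat \<Rightarrow> ('a::linorder) list set \<Rightarrow> bool" where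
  Nil: "open_box 0 {[]}"
| snoc: "open_box n B \<Longrightarrow> a < b \<Longrightarrow> open_box (Suc n) (B \<otimes>\<^sub>l line {a<..<b})"

definition has_interval :: "('a::linorder) set \<Rightarrow> bool" where
  "has_interval X \<longleftrightarrow> (\<exists>u v. u < v \<and> {u<..<v} \<subseteq> X)"

lemma snoc_mem_lprod_line [simp]: "p @ [t] \<in> B \<otimes>\<^sub>l line J \<longleftrightarrow> p \<in> B \<and> t \<in> J"
  by (auto simp: lprod_def line_def)

lemma lprod_lineE:
  assumes "x \<in> B \<otimes>\<^sub>l line J" obtains p t where "x = p @ [t]" "p \<in> B" "t \<in> J"
  using assms by (auto simp: lprod_def line_def)

lemma open_box_length: "open_box n B \<Longrightarrow> x \<in> B \<Longrightarrow> length x = n"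
  by (induction n B arbitrary: x rule: open_box.induct) (auto elim!: lprod_lineE)

lemma open_box_nonempty: "open_box n (B :: 'a::linordered_field list set) \<Longrightarrow> B \<noteq> {}"
proof (induction n B rule: open_box.induct)
  case (snoc n B a b)
  then obtain p where "p \<in> B" by blast
  then have "p @ [(a + b) / 2] \<in> B \<otimes>\<^sub>l line {a<..<b}" using snoc by (simp add: field_simps)
  then show ?case by blast
qed simp

lemma open_box_nhd:
  fixes B :: "'a::linordered_field list set"
  assumes "open_box n B" "x \<in> B"
  obtains e where "e > 0" "\<And>y. length y = n \<Longrightarrow> (\<And>i. i < n \<Longrightarrow> \<bar>y ! i - x ! i\<bar> < e) \<Longrightarrow> y \<in> B"
proof -
  have "\<exists>e>0. \<forall>y. length y = n \<longrightarrow> (\<forall>i<n. \<bar>y ! i - x ! i\<bar> < e) \<longrightarrow> y \<in> B"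
    using assms
  proof (induction n B arbitrary: x rule: open_box.induct)
    case Nil
    then show ?case by (intro exI[of _ 1]) auto
  next
    case (snoc n B a b)
    then obtain p t where x: "x = p @ [t]" "p \<in> B" "a < t" "t < b" by (auto elim!: lprod_lineE)
    then have p: "length p = n" using open_box_length snoc by blast
    obtain e where e: "e > 0" "\<And>y. length y = n \<Longrightarrow> \<forall>i<n. \<bar>y ! i - p ! i\<bar> < e \<Longrightarrow> y \<in> B"
      using snoc.IH[OF x(2)] by blast
    define d where "d = min e (min (t - a) (b - t))"
    have "y \<in> B \<otimes>\<^sub>l line {a<..<b}" if y: "length y = Suc n" "\<And>i. i < Suc n \<Longrightarrow> \<bar>y ! i - x ! i\<bar> < d" for y
    proof -
      obtain q s where q: "y = q @ [s]" "length q = n"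
        using y(1) by (metis append_butlast_last_id length_append_singleton list.size(3) nat.inject old.nat.distinct(1))
      have "\<bar>q ! i - p ! i\<bar> < e" if "i < n" for i
        using y(2)[of i] that q p x by (simp add: nth_append d_def)
      then have "q \<in> B" using e q by blast
      moreover have "\<bar>s - t\<bar> < d" using y(2)[of n] q p x by (simp add: nth_append)
      then have "a < s" "s < b" by (auto simp: d_def)
      ultimately show ?thesis using q by simp
    qed
    moreover have "d > 0" using e x by (simp add: d_def)
    ultimately show ?case by blast
  qed
  then show ?thesis using that by blast
qed

lemma open_box_1:
  fixes B :: "('a::linorder) list set"
  shows "open_box (Suc 0) B \<longleftrightarrow> (\<exists>a b. a < b \<and> B = line {a<..<b})"
proof -
  have J: "{[]} \<otimes>\<^sub>l line J = line J" for J :: "'a set" by (auto simp: lprod_def)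
  show ?thesis
  proof
    assume "open_box (Suc 0) B"
    then obtain B0 a b where "open_box 0 B0" "a < b" "B = B0 \<otimes>\<^sub>l line {a<..<b}"
      by (auto elim: open_box.cases)
    moreover from this(1) have "B0 = {[]}" by cases auto
    ultimately show "\<exists>a b. a < b \<and> B = line {a<..<b}" using J by auto
  next
    assume "\<exists>a b. a < b \<and> B = line {a<..<b}"
    then show "open_box (Suc 0) B" using open_box.snoc[OF open_box.Nil] J by metis
  qed
qed

context o_minimal
begin

lemma def_fun_fix: 
  assumes "def_fun (n + m) f" "length p = n" shows "def_fun m (\<lambda>x. f (p @ x))"
  by (rule def_fun_subst[OF assms(1)] def_map_append def_map_const def_map_id assms(2) refl)+

lemma def_fam_fix:
  assumes X: "def_fam (n + m) X" and p: "length p = n" shows "def_fam m (\<lambda>x. X (p @ x))"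
  unfolding def_fam_def by (rule def_pred_fam[OF X] def_map_append def_map_const def_map_take def_map_id p refl def_fun_coord | simp)+

text \<open>If the image is finite, some value is close to infinitely many others in the source, in
  fact to all points over it in an infinite set. Otherwise the image contains an interval, and
  infinitely many points are mapped near its midpoint. In both cases the infinite tame set
  \<open>X c\<close> contains an interval.\<close>

lemma osc_line:
  assumes f: "def_fun (Suc 0) f" and "a < b" "0 < e"
  shows "\<exists>c u v. u < v \<and> (\<forall>t. u < t \<and> t < v \<longrightarrow> a < t \<and> t < b \<and> \<bar>f [t] - c\<bar> < e)"
proof -
  define I where "I = (\<lambda>t. f [t]) ` {a<..<b}"
  define X where "X = (\<lambda>c. {t. a < t \<and> t < b \<and> \<bar>f [t] - c\<bar> < e})"
  have "def_pred (Suc 0) (\<lambda>z. \<exists>t. (a < t \<and> t < b) \<and> z ! 0 = f [t])"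
    by (rule def_fun_subst[OF f] def_intros | simp)+
  moreover have "(\<exists>t. (a < t \<and> t < b) \<and> s = f [t]) \<longleftrightarrow> s \<in> I" for s
    by (auto simp: I_def)
  ultimately have I: "tame I" using def_pred_line[of I] by simp
  have "def_pred (Suc 0) (\<lambda>z. a < z ! 0 \<and> z ! 0 < b \<and> \<bar>f [z ! 0] - c\<bar> < e)" for c
    by (rule def_fun_subst[OF f] def_intros | simp)+
  then have X: "tame (X c)" for c using def_pred_line[of "X c"] by (simp add: X_def)
  have "\<exists>c. infinite (X c)"
  proof (cases "finite I")
    case True
    have "{a<..<b} \<subseteq> (\<Union>c\<in>I. X c)" using \<open>0 < e\<close> by (auto simp: I_def X_def)
    then show ?thesis using True infinite_Ioo[OF \<open>a < b\<close>] by (meson finite_UN finite_subset)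
  next
    case False
    then obtain u v where uv: "u < v" "{u<..<v} \<subseteq> I" using tame_infinite[OF I] by metis
    define c where "c = (u + v) / 2"
    have "u < c" "c < v" using uv(1) by (auto simp: c_def field_simps)
    then have "max u (c - e) < min v (c + e)" using uv(1) \<open>0 < e\<close> by (simp add: less_diff_eq)
    then have inf: "infinite {max u (c - e)<..<min v (c + e)}" by (rule infinite_Ioo)
    have "{max u (c - e)<..<min v (c + e)} \<subseteq> (\<lambda>t. f [t]) ` X c"
    proof
      fix s assume s: "s \<in> {max u (c - e)<..<min v (c + e)}"
      then have "s \<in> I" using uv(2) by auto
      then obtain t where "a < t" "t < b" "s = f [t]" by (auto simp: I_def)
      then show "s \<in> (\<lambda>t. f [t]) ` X c" using s by (auto simp: X_def abs_less_iff)
    qed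
    then show ?thesis using inf finite_subset by blast
  qed
  then obtain c where "infinite (X c)" ..
  then obtain u v where "u < v" "{u<..<v} \<subseteq> X c" using tame_infinite[OF X] by metis
  then show ?thesis unfolding X_def by (intro exI[of _ c] exI[of _ u] exI[of _ v]) auto
qed

text \<open>The oscillation property in dimension \<open>n\<close> is a hypothesis because its proof
  in dimension \<open>Suc n\<close> uses this lemma. The radii of intervals inside
  \<open>Z p\<close> are bounded below on a smaller box; then the centers of intervals of one fixed
  radius are made nearly constant.\<close>

lemma fatten_aux:
  assumes osc: "\<And>f B e. def_fun n f \<Longrightarrow> open_box n B \<Longrightarrow> 0 < e \<Longrightarrow>
      \<exists>B'\<subseteq>B. open_box n B' \<and> (\<forall>x\<in>B'. \<forall>y\<in>B'. \<bar>f x - f y\<bar> < e)"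
    and Z: "def_fam n Z" and B: "open_box n B" and int: "\<And>p. p \<in> B \<Longrightarrow> has_interval (Z p)"
  shows "\<exists>B' u v. B' \<subseteq> B \<and> open_box n B' \<and> u < v \<and> (\<forall>p\<in>B'. {u<..<v} \<subseteq> Z p)"
proof -
  define D where "D = (\<lambda>p. {d. 0 < d \<and> (\<exists>c. \<forall>t. c - d < t \<and> t < c + d \<longrightarrow> t \<in> Z p)})"
  have "def_fam n D" unfolding def_fam_def D_def mem_Collect_eq
    by (rule def_pred_fam[OF Z] def_intros | simp)+
  then obtain \<delta> where \<delta>: "def_fun n \<delta>" "\<And>p. length p = n \<Longrightarrow> D p \<noteq> {} \<Longrightarrow> \<delta> p \<in> D p"
    by (rule definable_choice) blast
  have \<delta>D: "\<delta> p \<in> D p" if p: "p \<in> B" for p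
  proof (rule \<delta>(2)[OF open_box_length[OF B p]])
    obtain u v where uv: "u < v" "{u<..<v} \<subseteq> Z p" using int[OF p] by (auto simp: has_interval_def)
    have "(v - u) / 2 \<in> D p" unfolding D_def mem_Collect_eq
      by (intro conjI exI[of _ "(u + v) / 2"]) (use uv in \<open>auto simp: field_simps\<close>)
    then show "D p \<noteq> {}" by blast
  qed
  \<comment> \<open>Small oscillation of \<open>\<delta>\<close> itself would not keep it away from
    \<open>0\<close>. For \<open>1 / \<delta>\<close> it gives an upper bound, hence a positive
    lower bound \<open>d\<close> for \<open>\<delta>\<close>.\<close>
  obtain B1 where B1: "B1 \<subseteq> B" "open_box n B1" "\<And>x y. x \<in> B1 \<Longrightarrow> y \<in> B1 \<Longrightarrow> \<bar>1 / \<delta> x - 1 / \<delta> y\<bar> < 1"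
    using osc[OF def_fun_divide[OF def_fun_const \<delta>(1)] B zero_less_one, of 1] by blast
  obtain q where q: "q \<in> B1" using open_box_nonempty[OF B1(2)] by blast
  define d where "d = 1 / (1 / \<delta> q + 1)"
  have "0 < \<delta> q" using \<delta>D q B1 by (auto simp: D_def)
  then have "0 < 1 / \<delta> q + 1" by (simp add: add_pos_pos)
  then have d0: "0 < d" by (simp add: d_def)
  have d: "d < \<delta> p" if "p \<in> B1" for p
  proof -
    have "0 < \<delta> p" using \<delta>D that B1 by (auto simp: D_def)
    have "1 / \<delta> p < 1 / \<delta> q + 1" using B1(3)[OF that q] by (simp add: abs_less_iff)
    then have "1 / (1 / \<delta> q + 1) < 1 / (1 / \<delta> p)"
      using \<open>0 < \<delta> p\<close> by (intro divide_strict_left_mono) (auto simp: add_pos_pos \<open>0 < \<delta> q\<close>)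
    then show ?thesis by (simp add: d_def)
  qed
  define C where "C = (\<lambda>p. {c. \<forall>t. c - d < t \<and> t < c + d \<longrightarrow> t \<in> Z p})"
  have "def_fam n C" unfolding def_fam_def C_def mem_Collect_eq
    by (rule def_pred_fam[OF Z] def_intros | simp)+
  then obtain \<gamma> where \<gamma>: "def_fun n \<gamma>" "\<And>p. length p = n \<Longrightarrow> C p \<noteq> {} \<Longrightarrow> \<gamma> p \<in> C p"
    by (rule definable_choice) blast
  have \<gamma>C: "\<gamma> p \<in> C p" if "p \<in> B1" for p
  proof (rule \<gamma>(2)[OF open_box_length[OF B1(2) that]])
    have "\<delta> p \<in> D p" using that B1(1) \<delta>D by blast
    then obtain c where c: "\<And>t. c - \<delta> p < t \<Longrightarrow> t < c + \<delta> p \<Longrightarrow> t \<in> Z p" by (auto simp: D_def)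
    have "c \<in> C p" unfolding C_def mem_Collect_eq
    proof (intro allI impI)
      fix t assume "c - d < t \<and> t < c + d"
      then show "t \<in> Z p" using c[of t] d[OF that] by simp
    qed
    then show "C p \<noteq> {}" by blast
  qed
  \<comment> \<open>Intervals of radius \<open>d\<close> whose centers differ by less than
    \<open>d / 2\<close> all contain the interval of radius \<open>d / 2\<close> around any one of
    the centers.\<close>
  obtain B2 where B2: "B2 \<subseteq> B1" "open_box n B2" "\<And>x y. x \<in> B2 \<Longrightarrow> y \<in> B2 \<Longrightarrow> \<bar>\<gamma> x - \<gamma> y\<bar> < d / 2"
    using osc[OF \<gamma>(1) B1(2), of "d / 2"] d0 by auto
  obtain q where q: "q \<in> B2" using open_box_nonempty[OF B2(2)] by blast
  have "{\<gamma> q - d / 2<..<\<gamma> q + d / 2} \<subseteq> Z p" if "p \<in> B2" for p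
  proof
    fix t assume "t \<in> {\<gamma> q - d / 2<..<\<gamma> q + d / 2}"
    then have "\<gamma> q - d / 2 < t" "t < \<gamma> q + d / 2" by simp_all
    then have "\<bar>t - \<gamma> q\<bar> < d / 2" by linarith
    moreover have "\<bar>\<gamma> q - \<gamma> p\<bar> < d / 2" using B2(3) q that by blast
    ultimately have "\<bar>t - \<gamma> p\<bar> < d" by linarith
    moreover have "\<gamma> p \<in> C p" using \<gamma>C that B2(1) by blast
    ultimately show "t \<in> Z p" by (auto simp: C_def abs_less_iff)
  qed
  then show ?thesis using B1 B2 d0
    by (intro exI[of _ B2] exI[of _ "\<gamma> q - d / 2"] exI[of _ "\<gamma> q + d / 2"]) auto
qed

text \<open>For each \<open>p\<close> in the base, the one-variable case gives an interval of
  \<open>t\<close> on which \<open>f (p @ [t])\<close> is close to a constant. This constant is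
  chosen definably as \<open>\<gamma> p\<close>, the intervals are made common over a smaller base,
  and the induction hypothesis controls \<open>\<gamma>\<close>. Three errors below
  \<open>e / 4\<close> add up to less than \<open>e\<close>.\<close>

lemma osc_box:
  assumes "def_fun n f" "open_box n B" "0 < e"
  shows "\<exists>B'\<subseteq>B. open_box n B' \<and> (\<forall>x\<in>B'. \<forall>y\<in>B'. \<bar>f x - f y\<bar> < e)"
  using assms
proof (induction n arbitrary: f B e)
  case 0
  then have "B = {[]}" by (auto elim: open_box.cases)
  then show ?case using 0 by auto
next
  case (Suc n)
  obtain B0 a b where B: "B = B0 \<otimes>\<^sub>l line {a<..<b}" "open_box n B0" "a < b"
    using Suc.prems(2) by (auto elim: open_box.cases)
  define C where "C = (\<lambda>p. {c. \<exists>u v. u < v \<and> (\<forall>t. u < t \<and> t < v \<longrightarrow> a < t \<and> t < b \<and> \<bar>f (p @ [t]) - c\<bar> < e / 4)})"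
  have e4: "0 < e / 4" using Suc.prems by simp
  have "def_fam n C" unfolding def_fam_def C_def mem_Collect_eq
    by (rule def_fun_subst[OF Suc.prems(1)] def_intros | simp)+
  then obtain \<gamma> where \<gamma>: "def_fun n \<gamma>" "\<And>p. length p = n \<Longrightarrow> C p \<noteq> {} \<Longrightarrow> \<gamma> p \<in> C p"
    by (rule definable_choice) blast
  have \<gamma>C: "\<gamma> p \<in> C p" if "p \<in> B0" for p
  proof -
    have p: "length p = n" using open_box_length[OF B(2) that] .
    have "def_fun (Suc 0) (\<lambda>x. f (p @ x))" using def_fun_fix[of n "Suc 0" f p] Suc.prems(1) p by simp
    from osc_line[OF this B(3) e4] have "C p \<noteq> {}" unfolding C_def by blast
    then show ?thesis by (rule \<gamma>(2)[OF p])
  qed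
  define Z where "Z = (\<lambda>p. {t. a < t \<and> t < b \<and> \<bar>f (p @ [t]) - \<gamma> p\<bar> < e / 4})"
  have "def_fam n Z" unfolding def_fam_def Z_def mem_Collect_eq
    by (rule def_fun_subst[OF Suc.prems(1)] def_fun_subst[OF \<gamma>(1)] def_intros | simp)+
  moreover have "has_interval (Z p)" if "p \<in> B0" for p
    using \<gamma>C[OF that] by (fastforce simp: C_def Z_def has_interval_def)
  ultimately obtain B1 u v where B1: "B1 \<subseteq> B0" "open_box n B1" "u < v" "\<And>p. p \<in> B1 \<Longrightarrow> {u<..<v} \<subseteq> Z p"
    using fatten_aux[OF Suc.IH _ B(2), of Z] by blast
  obtain B2 where B2: "B2 \<subseteq> B1" "open_box n B2" "\<And>x y. x \<in> B2 \<Longrightarrow> y \<in> B2 \<Longrightarrow> \<bar>\<gamma> x - \<gamma> y\<bar> < e / 4"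
    using Suc.IH[OF \<gamma>(1) B1(2) e4] by blast
  have Zt: "t \<in> Z p" if "p \<in> B2" "u < t" "t < v" for p t using B1(4) B2(1) that by fastforce
  have "B2 \<otimes>\<^sub>l line {u<..<v} \<subseteq> B"
    using Zt B1 B2 unfolding B(1) by (auto elim!: lprod_lineE simp: Z_def)
  moreover have "open_box (Suc n) (B2 \<otimes>\<^sub>l line {u<..<v})" using B1 B2 by (intro open_box.snoc)
  moreover have "\<bar>f x - f y\<bar> < e" if x: "x \<in> B2 \<otimes>\<^sub>l line {u<..<v}" and y: "y \<in> B2 \<otimes>\<^sub>l line {u<..<v}" for x y
  proof -
    obtain p t where p: "x = p @ [t]" "p \<in> B2" "u < t" "t < v" using x by (auto elim!: lprod_lineE)
    obtain q s where q: "y = q @ [s]" "q \<in> B2" "u < s" "s < v" using y by (auto elim!: lprod_lineE)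
    have "\<bar>f x - \<gamma> p\<bar> < e / 4" "\<bar>f y - \<gamma> q\<bar> < e / 4" using Zt p q by (auto simp: Z_def)
    moreover have "\<bar>\<gamma> p - \<gamma> q\<bar> < e / 4" using B2(3) p q by blast
    ultimately show ?thesis using \<open>0 < e\<close> by linarith
  qed
  ultimately show ?case by blast
qed


end

section \<open>Uniform finiteness\<close>

text \<open>Closeness below \<open>e\<close> then defines an injection of \<open>X\<close> into
  \<open>Y\<close>. Cardinalities are thus compared by a condition that is first-order in both
  sets.\<close>

definition matched :: "'a::linordered_field \<Rightarrow> 'a set \<Rightarrow> 'a set \<Rightarrow> bool" where
  "matched e X Y \<longleftrightarrow> (\<forall>s\<in>X. \<exists>t\<in>Y. \<bar>s - t\<bar> < e) \<and>
     (\<forall>s\<in>X. \<forall>s'\<in>X. \<forall>t\<in>Y. \<bar>s - t\<bar> < e \<longrightarrow> \<bar>s' - t\<bar> < e \<longrightarrow> s = s')"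

text \<open>Matching is mutual off the bad points, so the cardinality of the fibers is locally constant there.\<close>

definition bad_points :: "('a::linordered_field list \<Rightarrow> 'a set) \<Rightarrow> 'a set" where
  "bad_points A = {r. \<not> (\<exists>e u v. u < r \<and> r < v \<and> (\<forall>r'. u < r' \<and> r' < v \<longrightarrow>
     matched e (A [r]) (A [r']) \<and> matched e (A [r']) (A [r])))}"

lemma matched_card:
  assumes "matched e X Y" "finite Y" shows "card X \<le> card Y"
proof -
  obtain f where f: "\<forall>s\<in>X. f s \<in> Y \<and> \<bar>s - f s\<bar> < e"
    using assms(1) unfolding matched_def by metis
  then have "inj_on f X" using assms(1) unfolding matched_def inj_on_def by metis
  then show ?thesis using f assms(2) by (intro card_inj_on_le[of f]) auto
qed

lemma finite_gap:
  fixes X :: "'a::linordered_field set"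
  assumes "finite X" obtains d where "0 < d" "\<And>s t. s \<in> X \<Longrightarrow> t \<in> X \<Longrightarrow> s \<noteq> t \<Longrightarrow> d \<le> \<bar>s - t\<bar>"
proof -
  define D where "D = insert 1 ((\<lambda>(s, t). \<bar>s - t\<bar>) ` {(s, t). s \<in> X \<and> t \<in> X \<and> s \<noteq> t})"
  have "finite {(s, t). s \<in> X \<and> t \<in> X \<and> s \<noteq> t}"
    by (rule finite_subset[of _ "X \<times> X"]) (use assms in auto)
  then have D: "finite D" by (simp add: D_def)
  then have "0 < Min D" by (subst Min_gr_iff) (auto simp: D_def)
  moreover have "Min D \<le> \<bar>s - t\<bar>" if "s \<in> X" "t \<in> X" "s \<noteq> t" for s t
    using that by (intro Min_le D) (auto simp: D_def)
  ultimately show ?thesis using that by blast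
qed

lemma finite_common_radius:
  fixes r :: "'a::linordered_field"
  assumes "finite X" "\<And>s. s \<in> X \<Longrightarrow> \<exists>d>0. \<forall>t. \<bar>t - r\<bar> < d \<longrightarrow> P s t"
  shows "\<exists>d>0. \<forall>s\<in>X. \<forall>t. \<bar>t - r\<bar> < d \<longrightarrow> P s t"
  using assms
proof (induction X rule: finite_induct)
  case empty
  show ?case by (intro exI[of _ 1]) auto
next
  case (insert x X)
  obtain d where d: "d > 0" "\<forall>s\<in>X. \<forall>t. \<bar>t - r\<bar> < d \<longrightarrow> P s t" using insert by auto
  obtain d' where d': "d' > 0" "\<forall>t. \<bar>t - r\<bar> < d' \<longrightarrow> P x t" using insert.prems by auto
  show ?case by (intro exI[of _ "min d d'"]) (use d d' in auto)
qed

section \<open>Local constancy of the cardinality of finite fibers\<close>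

context o_minimal
begin

lemma fatten:
  assumes "def_fam n Z" "open_box n B" "\<And>p. p \<in> B \<Longrightarrow> has_interval (Z p)"
  obtains B' u v where "B' \<subseteq> B" "open_box n B'" "u < v" "\<And>p. p \<in> B' \<Longrightarrow> {u<..<v} \<subseteq> Z p"
  using fatten_aux[OF osc_box assms(1,2)] assms(3) by blast

lemma osc_interval:
  assumes "def_fun (Suc 0) f" "a < b" "0 < e"
  obtains u v where "u < v" "{u<..<v} \<subseteq> {a<..<b}" "\<And>s t. s \<in> {u<..<v} \<Longrightarrow> t \<in> {u<..<v} \<Longrightarrow> \<bar>f [s] - f [t]\<bar> < e"
proof -
  have "open_box (Suc 0) (line {a<..<b})" using assms(2) open_box_1 by blast
  from osc_box[OF assms(1) this assms(3)] obtain B where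
    B: "B \<subseteq> line {a<..<b}" "open_box (Suc 0) B" "\<forall>x\<in>B. \<forall>y\<in>B. \<bar>f x - f y\<bar> < e" by blast
  then obtain u v where uv: "u < v" "B = line {u<..<v}" using open_box_1 by blast
  have "\<bar>f [s] - f [t]\<bar> < e" if "s \<in> {u<..<v}" "t \<in> {u<..<v}" for s t
    using B(3) that uv(2) by (auto simp: line_def)
  moreover have "{u<..<v} \<subseteq> {a<..<b}"
    using B(1) unfolding uv(2) line_def by blast
  ultimately show ?thesis using that uv(1) by blast
qed

text \<open>\<open>fatten\<close> applied to the positive parts of the sets: bounds that may be
  taken arbitrarily small at each point become one positive bound on a subinterval.\<close>

lemma lower_bound_interval:
  assumes D: "def_fam (Suc 0) D" and "a < b" and pos: "\<And>r. r \<in> {a<..<b} \<Longrightarrow> \<exists>d>0. {0<..<d} \<subseteq> D [r]"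
  obtains u v d where "u < v" "{u<..<v} \<subseteq> {a<..<b}" "0 < d" "\<And>r. r \<in> {u<..<v} \<Longrightarrow> d \<in> D [r]"
proof -
  have box: "open_box (Suc 0) (line {a<..<b})" using assms(2) open_box_1 by blast
  define Z where "Z = (\<lambda>p. D p \<inter> {0<..})"
  have "def_fam (Suc 0) Z" unfolding def_fam_def Z_def Int_iff greaterThan_iff
    by (rule def_pred_fam[OF D] def_intros | simp)+
  moreover have "has_interval (Z p)" if p: "p \<in> line {a<..<b}" for p
  proof -
    obtain r where r: "p = [r]" "r \<in> {a<..<b}" using p by (auto simp: line_def)
    then obtain d where "d > 0" "{0<..<d} \<subseteq> D [r]" using pos by blast
    then show ?thesis unfolding has_interval_def Z_def r(1) by (intro exI[of _ 0] exI[of _ d]) auto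
  qed
  ultimately obtain B u' v' where B: "B \<subseteq> line {a<..<b}" "open_box (Suc 0) B" "u' < v'"
      "\<And>p. p \<in> B \<Longrightarrow> {u'<..<v'} \<subseteq> Z p"
    using fatten[OF _ box, of Z] by metis
  then obtain u v where uv: "u < v" "B = line {u<..<v}" using open_box_1 by blast
  obtain d where d: "u' < d" "d < v'" using dense[OF B(3)] by blast
  have "d \<in> Z [r]" if "r \<in> {u<..<v}" for r
    using B(4)[of "[r]"] that d uv(2) by (auto simp: line_def)
  moreover have "\<exists>r. r \<in> {u<..<v}" using dense[OF uv(1)] by auto
  ultimately show ?thesis using that[of u v d] uv B(1) by (auto simp: Z_def line_def)
qed

lemma def_fam_bad_points:
  assumes A: "def_fam (Suc n) A" shows "def_fam n (\<lambda>p. bad_points (\<lambda>x. A (p @ x)))"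
  unfolding def_fam_def bad_points_def matched_def mem_Collect_eq
  by (rule def_pred_fam[OF A] def_intros | simp)+

text \<open>Otherwise the bad points contain an interval. Shrinking it three times makes the gap
  inside the fibers uniform, lets every point of a fiber persist in nearby fibers, and makes the
  range of persistence uniform. Persistence over a uniform distance can be applied from either of
  two fibers to the other, so matching is mutual near any remaining point.\<close>

lemma finite_bad_points:
  assumes A: "def_fam (Suc 0) A" and fin: "\<And>r. finite (A [r])"
  shows "finite (bad_points A)"
proof (rule ccontr)
  assume inf: "infinite (bad_points A)"
  have "tame (bad_points A)" using def_fam_tame[OF def_fam_bad_points[OF A], of "[]"] by simp
  then obtain a b where ab: "a < b" "{a<..<b} \<subseteq> bad_points A" using inf by (rule tame_infinite)

  define G where "G = (\<lambda>x. {d. \<forall>s\<in>A x. \<forall>t\<in>A x. s \<noteq> t \<longrightarrow> d \<le> \<bar>s - t\<bar>})"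
  have G: "def_fam (Suc 0) G" unfolding def_fam_def G_def mem_Collect_eq
    by (rule def_pred_fam[OF A] def_intros | simp)+
  have G2: "\<exists>d>0. {0<..<d} \<subseteq> G [r]" for r
  proof -
    obtain d where "0 < d" "\<And>s t. s \<in> A [r] \<Longrightarrow> t \<in> A [r] \<Longrightarrow> s \<noteq> t \<Longrightarrow> d \<le> \<bar>s - t\<bar>"
      using finite_gap[OF fin] by metis
    then show ?thesis by (intro exI[of _ d]) (force simp: G_def)
  qed
  obtain a1 b1 d where ab1: "a1 < b1" "{a1<..<b1} \<subseteq> {a<..<b}" "0 < d" "\<And>r. r \<in> {a1<..<b1} \<Longrightarrow> d \<in> G [r]"
    using lower_bound_interval[OF G ab(1) G2] by metis
  \<comment> \<open>Half the gap: two distinct points of one fiber cannot both be closer than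
    \<open>e\<close> to the same \<open>t\<close>.\<close>
  define e where "e = d / 2"
  have e: "0 < e" using ab1(3) by (simp add: e_def)

  \<comment> \<open>The points of a fiber without a partner within \<open>e\<close> in some fibers
    arbitrarily near. On an interval where \<open>W\<close> is nonempty, its minimum
    \<open>g\<close> would have oscillation below \<open>e\<close> on a subinterval, and
    \<open>g [r']\<close> would be a partner of \<open>g [r]\<close>.\<close>
  define W where "W = (\<lambda>x. {s. s \<in> A x \<and> (\<forall>u v. u < x ! 0 \<and> x ! 0 < v \<longrightarrow>
     (\<exists>r'. u < r' \<and> r' < v \<and> (\<forall>t\<in>A [r']. e \<le> \<bar>s - t\<bar>)))})"
  have W: "def_fam (Suc 0) W" unfolding def_fam_def W_def mem_Collect_eq
    by (rule def_pred_fam[OF A] def_intros | simp)+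
  have finW: "finite (W [r])" for r by (rule finite_subset[OF _ fin[of r]]) (auto simp: W_def)
  define g where "g = (\<lambda>x. if W x = {} then 0 else Min (W x))"
  have g: "def_fun (Suc 0) g" unfolding g_def
  proof (rule def_fun_Min[OF W])
    fix p :: "'a list" assume "length p = Suc 0"
    then show "finite (W p)" using finW by (cases p) auto
  qed
  have gW: "g [r] \<in> W [r]" if "W [r] \<noteq> {}" for r
    using Min_in[OF finW that] that by (simp add: g_def)
  define X where "X = {r. a1 < r \<and> r < b1 \<and> (\<exists>s\<in>W [r]. True)}"
  have "def_pred (Suc 0) (\<lambda>z. a1 < z ! 0 \<and> z ! 0 < b1 \<and> (\<exists>s\<in>W [z ! 0]. True))"
    by (rule def_pred_fam[OF W] def_intros | simp)+
  then have X: "tame X" using def_pred_line[of X] by (simp add: X_def)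
  have "finite X"
  proof (rule ccontr)
    assume "infinite X"
    then obtain a2 b2 where ab2: "a2 < b2" "{a2<..<b2} \<subseteq> X" by (rule tame_infinite[OF X])
    obtain u v where uv: "u < v" "{u<..<v} \<subseteq> {a2<..<b2}"
        "\<And>s t. s \<in> {u<..<v} \<Longrightarrow> t \<in> {u<..<v} \<Longrightarrow> \<bar>g [s] - g [t]\<bar> < e"
      using osc_interval[OF g ab2(1) e] by metis
    have gX: "g [s] \<in> W [s]" if "s \<in> {u<..<v}" for s
    proof (rule gW)
      have "s \<in> X" using that uv(2) ab2(2) by blast
      then show "W [s] \<noteq> {}" by (auto simp: X_def)
    qed
    obtain r where r: "u < r" "r < v" using dense[OF uv(1)] by blast
    have "g [r] \<in> W [r]" using gX r by simp
    then have "\<exists>r'. u < r' \<and> r' < v \<and> (\<forall>t\<in>A [r']. e \<le> \<bar>g [r] - t\<bar>)"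
      using r by (simp add: W_def)
    then obtain r' where r': "u < r'" "r' < v" "\<forall>t\<in>A [r']. e \<le> \<bar>g [r] - t\<bar>" by blast
    have "g [r'] \<in> A [r']" using gX[of r'] r' by (simp add: W_def)
    moreover have "\<bar>g [r] - g [r']\<bar> < e" using uv(3) r r' by simp
    ultimately show False using r'(3) by force
  qed
  define Y where "Y = {r. a1 < r \<and> r < b1 \<and> \<not> (\<exists>s\<in>W [r]. True)}"
  have "def_pred (Suc 0) (\<lambda>z. a1 < z ! 0 \<and> z ! 0 < b1 \<and> \<not> (\<exists>s\<in>W [z ! 0]. True))"
    by (rule def_pred_fam[OF W] def_intros | simp)+
  then have Y: "tame Y" using def_pred_line[of Y] by (simp add: Y_def)
  have "{a1<..<b1} \<subseteq> X \<union> Y" by (auto simp: X_def Y_def)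
  then have "infinite Y" using \<open>finite X\<close> infinite_Ioo[OF ab1(1)] finite_subset by blast
  then obtain a2 b2 where ab2: "a2 < b2" "{a2<..<b2} \<subseteq> Y" by (rule tame_infinite[OF Y])

  \<comment> \<open>Over \<open>Y\<close> each point of a fiber persists nearby. Finitely many
    points share a radius over each \<open>r\<close>, and \<open>lower_bound_interval\<close> turns
    these radii into one for a whole subinterval.\<close>
  define D where "D = (\<lambda>x. {d. \<forall>r'. \<bar>r' - x ! 0\<bar> < d \<longrightarrow> (\<forall>s\<in>A x. \<exists>t\<in>A [r']. \<bar>s - t\<bar> < e)})"
  have D: "def_fam (Suc 0) D" unfolding def_fam_def D_def mem_Collect_eq
    by (rule def_pred_fam[OF A] def_intros | simp)+
  have D2: "\<exists>d>0. {0<..<d} \<subseteq> D [r]" if r: "r \<in> {a2<..<b2}" for r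
  proof -
    have "\<exists>d>0. \<forall>r'. \<bar>r' - r\<bar> < d \<longrightarrow> (\<exists>t\<in>A [r']. \<bar>s - t\<bar> < e)" if s: "s \<in> A [r]" for s
    proof -
      have "s \<notin> W [r]" using r ab2(2) by (auto simp: Y_def)
      then obtain u v where uv: "u < r" "r < v" "\<forall>r'. u < r' \<and> r' < v \<longrightarrow> (\<exists>t\<in>A [r']. \<bar>s - t\<bar> < e)"
        using s by (auto simp: W_def not_le)
      show ?thesis
        by (intro exI[of _ "min (r - u) (v - r)"]) (use uv in \<open>auto simp: abs_less_iff\<close>)
    qed
    from finite_common_radius[of "A [r]" r "\<lambda>s r'. \<exists>t\<in>A [r']. \<bar>s - t\<bar> < e", OF fin this] obtain d where
      "d > 0" "\<forall>s\<in>A [r]. \<forall>r'. \<bar>r' - r\<bar> < d \<longrightarrow> (\<exists>t\<in>A [r']. \<bar>s - t\<bar> < e)" by blast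
    then show ?thesis by (intro exI[of _ d]) (auto simp: D_def)
  qed
  obtain a3 b3 d' where ab3: "a3 < b3" "{a3<..<b3} \<subseteq> {a2<..<b2}" "0 < d'" "\<And>r. r \<in> {a3<..<b3} \<Longrightarrow> d' \<in> D [r]"
    using lower_bound_interval[OF D ab2(1) D2] by metis
  have sub: "{a3<..<b3} \<subseteq> {a1<..<b1}" using ab3(2) ab2(2) by (auto simp: Y_def)
  have m: "matched e (A [r]) (A [r'])" if "r \<in> {a3<..<b3}" "r' \<in> {a3<..<b3}" "\<bar>r' - r\<bar> < d'" for r r'
  proof -
    have "d' \<in> D [r]" using ab3(4) that by blast
    then have "\<forall>s\<in>A [r]. \<exists>t\<in>A [r']. \<bar>s - t\<bar> < e" using that by (auto simp: D_def)
    moreover have "s = s'" if "s \<in> A [r]" "s' \<in> A [r]" "\<bar>s - t\<bar> < e" "\<bar>s' - t\<bar> < e" for s s' t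
    proof (rule ccontr)
      assume "s \<noteq> s'"
      moreover have "d \<in> G [r]" using ab1(4) sub \<open>r \<in> {a3<..<b3}\<close> by blast
      ultimately have "d \<le> \<bar>s - s'\<bar>" using that by (auto simp: G_def)
      then show False using that(3,4) unfolding e_def by linarith
    qed
    ultimately show ?thesis by (auto simp: matched_def)
  qed
  obtain r where r: "a3 < r" "r < b3" using dense[OF ab3(1)] by blast
  have "r \<notin> bad_points A"
    unfolding bad_points_def mem_Collect_eq not_not
  proof (rule exI[of _ e], rule exI[of _ "max a3 (r - d')"], rule exI[of _ "min b3 (r + d')"],
      intro conjI allI impI)
    fix r' assume "max a3 (r - d') < r' \<and> r' < min b3 (r + d')"
    then have "r' \<in> {a3<..<b3}" "\<bar>r' - r\<bar> < d'" "\<bar>r - r'\<bar> < d'" by (auto simp: abs_less_iff)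
    then show "matched e (A [r]) (A [r'])" "matched e (A [r']) (A [r])" using m r by auto
  qed (use r ab3(3) in auto)
  moreover have "r \<in> {a3<..<b3}" using r by simp
  then have "r \<in> {a<..<b}" using sub ab1(2) by blast
  ultimately show False using ab(2) by blast
qed

text \<open>Removing the minimum lowers the cardinality by one and keeps the family
  definable.\<close>

lemma def_pred_card:
  assumes "def_fam n A" "\<And>p. length p = n \<Longrightarrow> finite (A p)"
  shows "def_pred n (\<lambda>p. card (A p) = k)"
  using assms
proof (induction k arbitrary: A)
  case 0
  have "def_pred n (\<lambda>p. \<not> (\<exists>t\<in>A p. True))"
    by (rule def_pred_fam[OF 0(1)] def_intros | simp)+
  then show ?case by (rule def_pred_cong[THEN iffD1, rotated]) (use 0 in auto)
next
  case (Suc k)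
  define m where "m = (\<lambda>p. if A p = {} then 0 else Min (A p))"
  have m: "def_fun n m" unfolding m_def using def_fun_Min[OF Suc.prems] .
  have "def_fam n (\<lambda>p. {t. t \<in> A p \<and> t \<noteq> m p})" unfolding def_fam_def mem_Collect_eq
    by (rule def_pred_fam[OF Suc.prems(1)] def_fun_subst[OF m] def_intros | simp)+
  from Suc.IH[OF this] have "def_pred n (\<lambda>p. card {t. t \<in> A p \<and> t \<noteq> m p} = k)" using Suc.prems(2) by simp
  then have "def_pred n (\<lambda>p. (\<exists>t\<in>A p. True) \<and> card {t. t \<in> A p \<and> t \<noteq> m p} = k)"
    by (rule def_pred_conj[rotated]) (rule def_pred_fam[OF Suc.prems(1)] def_intros | simp)+
  then show ?case
  proof (rule def_pred_cong[THEN iffD1, rotated])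
    fix p :: "'a list" assume p: "length p = n"
    show "((\<exists>t\<in>A p. True) \<and> card {t. t \<in> A p \<and> t \<noteq> m p} = k) = (card (A p) = Suc k)"
    proof (cases "A p = {}")
      case False
      then have "m p \<in> A p" using Suc.prems(2)[OF p] by (simp add: m_def)
      then have "card (A p) = Suc (card (A p - {m p}))" by (rule card.remove[OF Suc.prems(2)[OF p]])
      moreover have "A p - {m p} = {t. t \<in> A p \<and> t \<noteq> m p}" by auto
      ultimately show ?thesis using False by auto
    qed simp
  qed
qed

text \<open>Mutual matching makes the cardinality locally constant off the bad points. The set of
  points with the same cardinality as \<open>r\<close> is definable, so
  \<open>loc_const_interval\<close> carries this over the whole segment.\<close>

lemma card_const_interval:
  assumes A: "def_fam (Suc 0) A" and fin: "\<And>r. finite (A [r])"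
    and "r \<le> q" and good: "bad_points A \<inter> {r..q} = {}"
  shows "card (A [r]) = card (A [q])"
proof -
  have fin': "finite (A p)" if "length p = Suc 0" for p using fin that by (cases p) auto
  define X where "X = {t. card (A [t]) = card (A [r])}"
  have "def_pred (Suc 0) (\<lambda>p. card (A p) = card (A [r]))" by (rule def_pred_card[OF A fin'])
  then have "def_pred (Suc 0) (\<lambda>p. p ! 0 \<in> X)"
  proof (rule def_pred_cong[THEN iffD1, rotated])
    fix p :: "'a list" assume "length p = Suc 0"
    then show "(card (A p) = card (A [r])) = (p ! 0 \<in> X)" by (cases p) (auto simp: X_def)
  qed
  then have "tame X" by (simp add: def_pred_line)
  moreover have "loc_const X t" if "r \<le> t" "t \<le> q" for t
  proof -
    have "t \<notin> bad_points A" using good that by auto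
    then obtain e u v where uv: "u < t" "t < v" "\<forall>r'. u < r' \<and> r' < v \<longrightarrow>
       matched e (A [t]) (A [r']) \<and> matched e (A [r']) (A [t])" by (auto simp: bad_points_def)
    have "card (A [r']) = card (A [t])" if "u < r'" "r' < v" for r'
      using uv(3) that matched_card[OF _ fin] by (metis le_antisym)
    then have "r' \<in> X \<longleftrightarrow> t \<in> X" if "u < r'" "r' < v" for r' using that unfolding X_def by fastforce
    then show ?thesis unfolding loc_const_def using uv(1,2) by blast
  qed
  ultimately have "r \<in> X \<longleftrightarrow> q \<in> X" using loc_const_interval[of X r q] \<open>r \<le> q\<close> by blast
  then show ?thesis by (simp add: X_def)
qed

text \<open>Minima are split off \<open>N\<close> times; each is a definable function, and a
  nonempty fiber loses one point every time.\<close>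

lemma enumerate_fam:
  assumes "def_fam n A" "\<And>p. length p = n \<Longrightarrow> finite (A p) \<and> card (A p) \<le> N"
  shows "\<exists>F. finite F \<and> (\<forall>f\<in>F. def_fun n f) \<and> (\<forall>p. length p = n \<longrightarrow> A p \<subseteq> (\<lambda>f. f p) ` F)"
  using assms
proof (induction N arbitrary: A)
  case 0
  then have "A p = {}" if "length p = n" for p using that by fastforce
  then show ?case by (intro exI[of _ "{}"]) auto
next
  case (Suc N)
  define m where "m = (\<lambda>p. if A p = {} then 0 else Min (A p))"
  have m: "def_fun n m" unfolding m_def using def_fun_Min[OF Suc.prems(1)] Suc.prems(2) by blast
  define A' where "A' = (\<lambda>p. {t. t \<in> A p \<and> t \<noteq> m p})"
  have "def_fam n A'" unfolding def_fam_def mem_Collect_eq A'_def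
    by (rule def_pred_fam[OF Suc.prems(1)] def_fun_subst[OF m] def_intros | simp)+
  moreover have A'2: "finite (A' p) \<and> card (A' p) \<le> N" if p: "length p = n" for p
  proof -
    have fin: "finite (A p)" "card (A p) \<le> Suc N" using Suc.prems(2)[OF p] by auto
    have A': "A' p = A p - {m p}" by (auto simp: A'_def)
    show ?thesis
    proof (cases "A p = {}")
      case False
      then have "m p \<in> A p" using fin by (simp add: m_def)
      then show ?thesis using fin A' by simp
    qed (simp add: A')
  qed
  ultimately have "\<exists>F. finite F \<and> (\<forall>f\<in>F. def_fun n f) \<and> (\<forall>p. length p = n \<longrightarrow> A' p \<subseteq> (\<lambda>f. f p) ` F)"
    by (rule Suc.IH)
  then obtain F where F: "finite F" "\<forall>f\<in>F. def_fun n f" "\<forall>p. length p = n \<longrightarrow> A' p \<subseteq> (\<lambda>f. f p) ` F"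
    by blast
  show ?case
    by (rule exI[of _ "insert m F"]) (use F m in \<open>auto simp: A'_def\<close>)
qed

text \<open>Counterpart of \<open>test_points\<close> for functions: when the values of
  \<open>F\<close> at \<open>p\<close> cover a finite set, the values of these functions at
  \<open>p\<close> cover its test points.\<close>

definition test_funs :: "('a list \<Rightarrow> 'a) set \<Rightarrow> ('a list \<Rightarrow> 'a) set" where
  "test_funs F = {\<lambda>p. 0} \<union> F \<union> {\<lambda>p. f p - 1 |f. f \<in> F} \<union> {\<lambda>p. f p + 1 |f. f \<in> F} \<union>
     {\<lambda>p. (f p + g p) / 2 |f g. f \<in> F \<and> g \<in> F}"

lemma finite_test_funs: "finite F \<Longrightarrow> finite (test_funs F)"
  unfolding test_funs_def by (intro finite_UnI finite_image_set2 finite_image_set) auto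

lemma def_fun_test_funs: "(\<And>f. f \<in> F \<Longrightarrow> def_fun n f) \<Longrightarrow> g \<in> test_funs F \<Longrightarrow> def_fun n g"
  unfolding test_funs_def by (auto intro!: def_fun_const def_fun_add def_fun_diff def_fun_divide)

lemma test_points_test_funs:
  assumes "D \<subseteq> (\<lambda>f. f p) ` F" "q \<in> test_points D"
  obtains g where "g \<in> test_funs F" "q = g p"
proof -
  have "\<exists>g\<in>test_funs F. q = g p"
    using assms(2) unfolding mem_test_points
  proof (elim disjE bexE)
    assume "q = 0" then show ?thesis by (auto simp: test_funs_def)
  next
    assume "q \<in> D" then show ?thesis using assms(1) by (auto simp: test_funs_def)
  next
    fix b assume "b \<in> D" and q: "q = b - 1"
    then obtain f where "f \<in> F" "b = f p" using assms(1) by blast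
    then show ?thesis using q by (intro bexI[of _ "\<lambda>p. f p - 1"]) (auto simp: test_funs_def)
  next
    fix b assume "b \<in> D" and q: "q = b + 1"
    then obtain f where "f \<in> F" "b = f p" using assms(1) by blast
    then show ?thesis using q by (intro bexI[of _ "\<lambda>p. f p + 1"]) (auto simp: test_funs_def)
  next
    fix b c assume "b \<in> D" "c \<in> D" and q: "q = (b + c) / 2"
    then obtain f g where "f \<in> F" "b = f p" "g \<in> F" "c = g p" using assms(1) by blast
    then show ?thesis using q by (intro bexI[of _ "\<lambda>p. (f p + g p) / 2"]) (auto simp: test_funs_def)
  qed
  then show ?thesis using that by blast
qed

text \<open>The induction hypothesis is used twice. It bounds the number of bad points in the last
  coordinate, which are therefore enumerated by finitely many functions. It then bounds the fibers
  over the graphs of the resulting test functions, and every other fiber has the same cardinality as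
  one of these.\<close>

theorem uniform_finiteness:
  assumes "def_fam n A" "\<And>p. length p = n \<Longrightarrow> finite (A p)"
  shows "\<exists>N. \<forall>p. length p = n \<longrightarrow> card (A p) \<le> N"
  using assms
proof (induction n arbitrary: A)
  case 0
  then show ?case by auto
next
  case (Suc n)
  note A = Suc.prems(1)
  define D where "D = (\<lambda>p. bad_points (\<lambda>x. A (p @ x)))"
  have D: "def_fam n D" unfolding D_def by (rule def_fam_bad_points[OF A])
  have A1: "def_fam (Suc 0) (\<lambda>x. A (p @ x))" if "length p = n" for p
    using def_fam_fix[of n "Suc 0" A p] A that by simp
  have finD: "finite (D p)" if "length p = n" for p
    unfolding D_def by (rule finite_bad_points[OF A1[OF that]]) (use Suc.prems(2) that in simp)
  then obtain N where "\<forall>p. length p = n \<longrightarrow> card (D p) \<le> N" using Suc.IH[OF D] by blast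
  then obtain F where F: "finite F" "\<forall>f\<in>F. def_fun n f" "\<forall>p. length p = n \<longrightarrow> D p \<subseteq> (\<lambda>f. f p) ` F"
    using enumerate_fam[OF D] finD by metis
  have "\<exists>N. \<forall>p. length p = n \<longrightarrow> card (A (p @ [g p])) \<le> N" if "g \<in> test_funs F" for g
  proof (rule Suc.IH)
    have g: "def_fun n g" using def_fun_test_funs that F(2) by blast
    show "def_fam n (\<lambda>p. A (p @ [g p]))" unfolding def_fam_def
      by (rule def_pred_fam[OF A] def_fun_subst[OF g] def_intros | simp)+
  qed (use Suc.prems(2) in simp)
  then obtain M where M: "\<And>g p. g \<in> test_funs F \<Longrightarrow> length p = n \<Longrightarrow> card (A (p @ [g p])) \<le> M g" by metis
  have "card (A x) \<le> Max (M ` test_funs F)" if x: "length x = Suc n" for x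
  proof -
    obtain p r where p: "x = p @ [r]" "length p = n"
      using x by (metis append_butlast_last_id length_append_singleton list.size(3) nat.inject old.nat.distinct(1))
    obtain q where q: "q \<in> test_points (D p)" "q = r \<or> D p \<inter> {min r q..max r q} = {}"
      using test_points_exists[OF finD[OF p(2)]] by metis
    have fin: "finite (A (p @ [t]))" for t using Suc.prems(2) p by simp
    have "card (A (p @ [r])) = card (A (p @ [q]))"
    proof (cases "q = r")
      case False
      then have "card (A (p @ [min r q])) = card (A (p @ [max r q]))"
        using card_const_interval[OF A1[OF p(2)] fin, of "min r q" "max r q"] q(2)
        by (auto simp: D_def min_le_iff_disj)
      then show ?thesis by (auto simp: min_def max_def split: if_splits)
    qed simp
    moreover obtain g where "g \<in> test_funs F" "q = g p"
      using test_points_test_funs[OF _ q(1)] F(3) p(2) by blast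
    ultimately have "card (A x) \<le> M g" using M p by simp
    also have "\<dots> \<le> Max (M ` test_funs F)"
      using \<open>g \<in> test_funs F\<close> finite_test_funs[OF F(1)] by simp
    finally show ?thesis .
  qed
  then show ?case by blast
qed

lemma finite_fam_funs:
  assumes "def_fam n A" "\<And>p. length p = n \<Longrightarrow> finite (A p)"
  shows "\<exists>F. finite F \<and> (\<forall>f\<in>F. def_fun n f) \<and> (\<forall>p. length p = n \<longrightarrow> A p \<subseteq> (\<lambda>f. f p) ` F)"
  using enumerate_fam[OF assms(1)] uniform_finiteness[OF assms] assms(2) by metis

end

section \<open>Piecewise continuity\<close>

definition near :: "nat \<Rightarrow> 'a::linordered_field \<Rightarrow> 'a list \<Rightarrow> 'a list \<Rightarrow> bool" where
  "near n d x y \<longleftrightarrow> (\<forall>i<n. \<bar>y ! i - x ! i\<bar> < d)"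

definition cont_at :: "nat \<Rightarrow> 'a::linordered_field list set \<Rightarrow> ('a list \<Rightarrow> 'a) \<Rightarrow> 'a list \<Rightarrow> bool" where
  "cont_at n D f x \<longleftrightarrow> (\<forall>e>0. \<exists>d>0. \<forall>y\<in>D. near n d x y \<longrightarrow> \<bar>f y - f x\<bar> < e)"

definition omit :: "nat \<Rightarrow> 'a list \<Rightarrow> 'a list" where
  "omit i x = take i x @ drop (Suc i) x"

lemma cont_at_mono: "cont_at n D f x \<Longrightarrow> D' \<subseteq> D \<Longrightarrow> cont_at n D' f x"
  unfolding cont_at_def by (meson subsetD)

lemma near_mono: "near n d x y \<Longrightarrow> d \<le> d' \<Longrightarrow> near n d' x y"
  unfolding near_def by (meson less_le_trans)

lemma length_omit: "length x = Suc m \<Longrightarrow> i \<le> m \<Longrightarrow> length (omit i x) = m"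
  by (simp add: omit_def)

lemma nth_omit: "length x = Suc m \<Longrightarrow> i \<le> m \<Longrightarrow> j < m \<Longrightarrow> omit i x ! j = x ! (if j < i then j else Suc j)"
  by (auto simp: omit_def nth_append)

lemma near_omit:
  assumes "near (Suc m) d x y" "length x = Suc m" "length y = Suc m" "i \<le> m"
  shows "near m d (omit i x) (omit i y)"
  using assms unfolding near_def by (auto simp: nth_omit)

lemma omit_snoc: "length p = m \<Longrightarrow> i < m \<Longrightarrow> omit i (p @ [t]) = omit i p @ [t]"
  by (simp add: omit_def)

lemma omit_last: "length p = m \<Longrightarrow> omit m (p @ [t]) = p"
  by (simp add: omit_def)

lemma snoc_cases: "length x = Suc n \<Longrightarrow> (\<And>p t. x = p @ [t] \<Longrightarrow> length p = n \<Longrightarrow> thesis) \<Longrightarrow> thesis"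
  by (metis append_butlast_last_id length_append_singleton list.size(3) nat.inject old.nat.distinct(1))

context o_minimal
begin

lemma def_pred_all_list:
  assumes "def_pred (n + m) (\<lambda>z. Q (take n z) (drop n z))"
  shows "def_pred n (\<lambda>x. \<forall>w. length w = m \<longrightarrow> Q x w)"
  using def_pred_not[OF def_pred_take[OF def_pred_not[OF assms]]] by simp

lemma def_map_omit:
  assumes "def_map n (Suc m) F" "i \<le> m" shows "def_map n m (\<lambda>x. omit i (F x))"
  unfolding omit_def
  by (rule def_map_append[where m=i and k="m - i"]) (use assms in \<open>auto intro!: def_map_take def_map_drop\<close>)

lemma definable_Collect: "def_pred n P \<Longrightarrow> {x. length x = n \<and> P x} \<in> S n"
  by (simp add: def_pred_def Rn_def)

text \<open>The tolerances that violate continuity at a point are closed downwards, so they contain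
  an interval. A tolerance violated at all points of a smaller box contradicts small oscillation on
  a still smaller box, which is a neighborhood of each of its points.\<close>

lemma no_box_cont:
  assumes f: "def_fun n f" and B: "open_box n B" "B \<subseteq> {x. length x = n \<and> \<not> cont_at n (Rn n) f x}"
  shows False
proof -
  define Z where "Z = (\<lambda>x. {e. 0 < e \<and> \<not> (\<exists>d. 0 < d \<and> (\<forall>y. length y = n \<longrightarrow> near n d x y \<longrightarrow> \<bar>f y - f x\<bar> < e))})"
  have "def_fam n Z" unfolding def_fam_def Z_def mem_Collect_eq near_def
    by (rule def_pred_all_list def_pred_all_less def_fun_subst[OF f] def_intros | simp)+
  moreover have "has_interval (Z x)" if "x \<in> B" for x
  proof -
    have "\<not> cont_at n (Rn n) f x" using that B(2) by blast
    then obtain e where e: "0 < e" "\<not> (\<exists>d>0. \<forall>y\<in>Rn n. near n d x y \<longrightarrow> \<bar>f y - f x\<bar> < e)"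
      unfolding cont_at_def by blast
    have "e' \<in> Z x" if "0 < e'" "e' < e" for e'
      unfolding Z_def mem_Collect_eq
    proof (intro conjI notI that)
      assume "\<exists>d. 0 < d \<and> (\<forall>y. length y = n \<longrightarrow> near n d x y \<longrightarrow> \<bar>f y - f x\<bar> < e')"
      then show False using e(2) \<open>e' < e\<close> unfolding Rn_def by (smt (verit, best) less_trans mem_Collect_eq)
    qed
    then have "{0<..<e} \<subseteq> Z x" by auto
    then show ?thesis using e(1) unfolding has_interval_def by blast
  qed
  ultimately obtain B1 u v where B1: "B1 \<subseteq> B" "open_box n B1" "u < v" "\<And>x. x \<in> B1 \<Longrightarrow> {u<..<v} \<subseteq> Z x"
    using fatten[OF _ B(1)] by metis
  obtain e where e: "u < e" "e < v" using dense[OF B1(3)] by blast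
  then have eZ: "e \<in> Z x" if "x \<in> B1" for x using B1(4)[OF that] by auto
  obtain x0 where "x0 \<in> B1" using open_box_nonempty[OF B1(2)] by blast
  then have "0 < e" using eZ by (auto simp: Z_def)
  from osc_box[OF f B1(2) this] obtain B2 where
    B2: "B2 \<subseteq> B1" "open_box n B2" "\<forall>x\<in>B2. \<forall>y\<in>B2. \<bar>f x - f y\<bar> < e" by blast
  obtain x where x: "x \<in> B2" using open_box_nonempty[OF B2(2)] by blast
  obtain d where "d > 0" "\<And>y. length y = n \<Longrightarrow> (\<And>i. i < n \<Longrightarrow> \<bar>y ! i - x ! i\<bar> < d) \<Longrightarrow> y \<in> B2"
    using open_box_nhd[OF B2(2) x] by metis
  then have "\<forall>y. length y = n \<longrightarrow> near n d x y \<longrightarrow> \<bar>f y - f x\<bar> < e"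
    using B2(3) x by (simp add: near_def)
  moreover have "e \<in> Z x" using eZ x B2(1) by blast
  ultimately show False using \<open>d > 0\<close> unfolding Z_def by blast
qed

text \<open>The base points whose fiber contains an interval form a set without a box, since
  fattening would otherwise give a box in \<open>Z\<close>; the induction hypothesis applies to it.
  Over the other base points the fibers are finite, so this part of \<open>Z\<close> is covered by
  finitely many graphs, on which omitting the last coordinate is injective.\<close>

lemma thin_cover:
  assumes "Z \<in> S n" "\<nexists>B. open_box n B \<and> B \<subseteq> Z"
  shows "\<exists>\<W>. finite \<W> \<and> \<W> \<subseteq> S n \<and> Z = \<Union>\<W> \<and> (\<forall>W\<in>\<W>. \<exists>i<n. inj_on (omit i) W)"
  using assms
proof (induction n arbitrary: Z)
  case 0
  have "Z \<subseteq> {[]}" using definable_subset[OF 0(1)] by (auto simp: Rn_def)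
  moreover have "[] \<notin> Z" using 0(2) open_box.Nil by blast
  ultimately have "Z = {}" by blast
  then show ?case by (intro exI[of _ "{}"]) auto
next
  case (Suc n)
  have Zlen: "length x = Suc n" if "x \<in> Z" for x using definable_subset[OF Suc.prems(1)] that by (auto simp: Rn_def)
  define X where "X = (\<lambda>p. {t. p @ [t] \<in> Z})"
  have X: "def_fam n X" unfolding def_fam_def X_def mem_Collect_eq
    by (rule def_pred_mem[OF Suc.prems(1)] def_intros | simp)+
  define Y where "Y = {p. length p = n \<and> (\<exists>u v. u < v \<and> (\<forall>t. u < t \<and> t < v \<longrightarrow> t \<in> X p))}"
  have Y: "Y \<in> S n" unfolding Y_def
    by (rule definable_Collect) (rule def_pred_fam[OF X] def_intros | simp)+
  have "\<nexists>B. open_box n B \<and> B \<subseteq> Y"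
  proof
    assume "\<exists>B. open_box n B \<and> B \<subseteq> Y"
    then obtain B where B: "open_box n B" "B \<subseteq> Y" by blast
    have "has_interval (X p)" if "p \<in> B" for p
      using that B(2) unfolding Y_def has_interval_def by fastforce
    then obtain B1 u v where B1: "open_box n B1" "u < v" "\<And>p. p \<in> B1 \<Longrightarrow> {u<..<v} \<subseteq> X p"
      using fatten[OF X B(1)] by metis
    have "B1 \<otimes>\<^sub>l line {u<..<v} \<subseteq> Z"
    proof
      fix x assume "x \<in> B1 \<otimes>\<^sub>l line {u<..<v}"
      then obtain p t where "x = p @ [t]" "p \<in> B1" "t \<in> {u<..<v}" by (rule lprod_lineE)
      then show "x \<in> Z" using B1(3)[of p] by (auto simp: X_def)
    qed
    then show False using Suc.prems(2) open_box.snoc[OF B1(1,2)] by blast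
  qed
  from Suc.IH[OF Y this] obtain \<W> where W: "finite \<W>" "\<W> \<subseteq> S n" "Y = \<Union>\<W>" "\<forall>W\<in>\<W>. \<exists>i<n. inj_on (omit i) W"
    by blast
  define \<W>1 where "\<W>1 = (\<lambda>W. {x. length x = Suc n \<and> x \<in> Z \<and> take n x \<in> W}) ` \<W>"
  define X' where "X' = (\<lambda>p. {t. t \<in> X p \<and> p \<notin> Y})"
  have X': "def_fam n X'" unfolding def_fam_def X'_def mem_Collect_eq
    by (rule def_pred_fam[OF X] def_pred_mem[OF Y] def_intros | simp)+
  have fin: "finite (X' p)" if p: "length p = n" for p
  proof (rule ccontr)
    assume inf: "infinite (X' p)"
    then obtain u v where uv: "u < v" "{u<..<v} \<subseteq> X' p" using tame_infinite[OF def_fam_tame[OF X' p]] by metis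
    then have "t \<in> X p" if "u < t \<and> t < v" for t using that by (auto simp: X'_def subset_iff)
    then have "p \<in> Y" using p uv(1) unfolding Y_def by blast
    then show False using inf by (simp add: X'_def)
  qed
  obtain F where F: "finite F" "\<forall>f\<in>F. def_fun n f" "\<forall>p. length p = n \<longrightarrow> X' p \<subseteq> (\<lambda>f. f p) ` F"
    using finite_fam_funs[OF X' fin] by blast
  define \<W>2 where "\<W>2 = (\<lambda>f. {x. length x = Suc n \<and> x \<in> Z \<and> take n x \<notin> Y \<and> x ! n = f (take n x)}) ` F"
  show ?case
  proof (intro exI[of _ "\<W>1 \<union> \<W>2"] conjI)
    show "finite (\<W>1 \<union> \<W>2)" using W(1) F(1) by (simp add: \<W>1_def \<W>2_def)
    have "{x. length x = Suc n \<and> x \<in> Z \<and> take n x \<in> W} \<in> S (Suc n)" if "W \<in> \<W>" for W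
    proof -
      have "W \<in> S n" using that W(2) by blast
      then show ?thesis
        by - (rule definable_Collect, (rule def_pred_mem[OF Suc.prems(1)] def_pred_mem[of W n] def_intros | assumption | simp)+)
    qed
    moreover have "{x. length x = Suc n \<and> x \<in> Z \<and> take n x \<notin> Y \<and> x ! n = f (take n x)} \<in> S (Suc n)" if "f \<in> F" for f
    proof -
      have f: "def_fun n f" using that F(2) by blast
      show ?thesis
        by (rule definable_Collect) (rule def_pred_mem[OF Suc.prems(1)] def_pred_mem[OF Y] def_fun_subst[OF f] def_intros | simp)+
    qed
    ultimately show "\<W>1 \<union> \<W>2 \<subseteq> S (Suc n)" by (auto simp: \<W>1_def \<W>2_def)
    show "Z = \<Union>(\<W>1 \<union> \<W>2)"
    proof
      show "\<Union>(\<W>1 \<union> \<W>2) \<subseteq> Z" by (auto simp: \<W>1_def \<W>2_def)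
      show "Z \<subseteq> \<Union>(\<W>1 \<union> \<W>2)"
      proof
        fix x assume x: "x \<in> Z"
        obtain p t where p: "x = p @ [t]" "length p = n" using snoc_cases[OF Zlen[OF x]] by blast
        show "x \<in> \<Union>(\<W>1 \<union> \<W>2)"
        proof (cases "p \<in> Y")
          case True
          then obtain W where "W \<in> \<W>" "p \<in> W" using W(3) by blast
          then show ?thesis using x p by (auto simp: \<W>1_def)
        next
          case False
          then have "t \<in> X' p" using x p by (simp add: X'_def X_def)
          then obtain f where "f \<in> F" "t = f p" using F(3) p by blast
          then show ?thesis using x p False by (auto simp: \<W>2_def)
        qed
      qed
    qed
    show "\<forall>W\<in>\<W>1 \<union> \<W>2. \<exists>i<Suc n. inj_on (omit i) W"
    proof
      fix V assume "V \<in> \<W>1 \<union> \<W>2"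
      then consider W where "W \<in> \<W>" "V = {x. length x = Suc n \<and> x \<in> Z \<and> take n x \<in> W}"
        | f where "f \<in> F" "V = {x. length x = Suc n \<and> x \<in> Z \<and> take n x \<notin> Y \<and> x ! n = f (take n x)}"
        by (auto simp: \<W>1_def \<W>2_def)
      then show "\<exists>i<Suc n. inj_on (omit i) V"
      proof cases
        case 1
        then obtain i where i: "i < n" "inj_on (omit i) W" using W(4) by blast
        have "inj_on (omit i) V"
        proof (rule inj_onI)
          fix x y assume xy: "x \<in> V" "y \<in> V" "omit i x = omit i y"
          obtain p t where p: "x = p @ [t]" "length p = n" using snoc_cases[of x n] xy 1 by blast
          obtain q s where q: "y = q @ [s]" "length q = n" using snoc_cases[of y n] xy 1 by blast
          have "omit i p = omit i q" "t = s" using xy(3) p q i by (auto simp: omit_snoc)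
          moreover have "p \<in> W" "q \<in> W" using xy p q 1 by auto
          ultimately show "x = y" using i p q by (simp add: inj_on_def)
        qed
        then show ?thesis using i by (intro exI[of _ i]) simp
      next
        case 2
        have "inj_on (omit n) V"
        proof (rule inj_onI)
          fix x y assume xy: "x \<in> V" "y \<in> V" "omit n x = omit n y"
          obtain p t where p: "x = p @ [t]" "length p = n" using snoc_cases[of x n] xy 2 by blast
          obtain q s where q: "y = q @ [s]" "length q = n" using snoc_cases[of y n] xy 2 by blast
          have "p = q" using xy(3) p q by (simp add: omit_last)
          then show "x = y" using xy p q 2 by auto
        qed
        then show ?thesis by (intro exI[of _ n]) simp
      qed
    qed
  qed
qed

text \<open>The discontinuities contain no box, so they split into pieces on which omitting some
  coordinate is injective. On such a piece \<open>f\<close> factors through \<open>omit i\<close>,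
  which does not increase distances, and the induction hypothesis treats the resulting function in
  one variable less. The pieces may overlap: only continuity relative to each is required.\<close>

theorem piecewise_continuity:
  assumes "def_fun n f"
  shows "\<exists>\<D>. finite \<D> \<and> \<D> \<subseteq> S n \<and> \<Union>\<D> = Rn n \<and> (\<forall>D\<in>\<D>. \<forall>x\<in>D. cont_at n D f x)"
  using assms
proof (induction n arbitrary: f)
  case 0
  have "Rn 0 \<in> S 0" using def_pred_const[of 0 True] by (simp add: def_pred_def)
  moreover have "cont_at 0 (Rn 0) f x" if "x \<in> Rn 0" for x
    using that by (auto simp: cont_at_def Rn_def intro!: exI[of _ 1])
  ultimately show ?case by (intro exI[of _ "{Rn 0}"]) auto
next
  case (Suc n)
  note f = Suc.prems
  define Z where "Z = {x. length x = Suc n \<and> \<not> cont_at (Suc n) (Rn (Suc n)) f x}"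
  have ca: "cont_at (Suc n) (Rn (Suc n)) f x \<longleftrightarrow> (\<forall>e. 0 < e \<longrightarrow> (\<exists>d. 0 < d \<and>
     (\<forall>y. length y = Suc n \<longrightarrow> near (Suc n) d x y \<longrightarrow> \<bar>f y - f x\<bar> < e)))" for x
    by (simp add: cont_at_def Rn_def)
  have dZ: "def_pred (Suc n) (\<lambda>x. cont_at (Suc n) (Rn (Suc n)) f x)"
    unfolding ca near_def
    by (rule def_pred_all_list def_pred_all_less def_fun_subst[OF f] def_intros | simp)+
  then have Z: "Z \<in> S (Suc n)" unfolding Z_def by (intro definable_Collect def_pred_not)
  have "\<nexists>B. open_box (Suc n) B \<and> B \<subseteq> Z" using no_box_cont[OF f] unfolding Z_def by blast
  from thin_cover[OF Z this] obtain \<W> where W: "finite \<W>" "\<W> \<subseteq> S (Suc n)" "Z = \<Union>\<W>"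
    "\<forall>W\<in>\<W>. \<exists>i<Suc n. inj_on (omit i) W" by blast
  have "\<exists>\<D>. finite \<D> \<and> \<D> \<subseteq> S (Suc n) \<and> \<Union>\<D> = W \<and> (\<forall>D\<in>\<D>. \<forall>x\<in>D. cont_at (Suc n) D f x)" if WW: "W \<in> \<W>" for W
  proof -
    have WS: "W \<in> S (Suc n)" using WW W(2) by blast
    have Wlen: "length x = Suc n" if "x \<in> W" for x using definable_subset[OF WS] that by (auto simp: Rn_def)
    obtain i where i: "i \<le> n" "inj_on (omit i) W" using W(4) WW less_Suc_eq_le by metis
    \<comment> \<open>\<open>V p\<close> holds the value of \<open>f\<close> at the unique point of
      \<open>W\<close> over \<open>p\<close>, if there is one. Its minimum names this value
      definably, with default \<open>0\<close> elsewhere.\<close>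
    define V where "V = (\<lambda>p. {s. \<exists>x. length x = Suc n \<and> x \<in> W \<and> omit i x = p \<and> s = f x})"
    have V: "def_fam n V"
    proof -
      have "omit i x = p \<longleftrightarrow> (\<forall>j<n. omit i x ! j = p ! j)" if "length x = Suc n" "length p = n" for x p :: "'a list"
        using length_omit[OF that(1) i(1)] that by (auto intro: nth_equalityI)
      then have "def_fam n V \<longleftrightarrow> def_pred (Suc n) (\<lambda>z. \<exists>x. length x = Suc n \<and> x \<in> W \<and>
          (\<forall>j<n. omit i x ! j = take n z ! j) \<and> z ! n = f x)"
        unfolding def_fam_def V_def mem_Collect_eq by (intro def_pred_cong) auto
      also have \<dots>
        by (rule def_pred_take, (rule def_pred_mem[OF WS] def_pred_all_less def_fun_subst[OF f] def_map_omit[OF _ i(1)] def_intros | simp)+)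
      finally show ?thesis .
    qed
    have VW: "V (omit i x) = {f x}" if "x \<in> W" for x
      using that i(2) Wlen by (auto simp: V_def inj_on_def)
    have fin: "finite (V p)" for p
    proof (cases "V p = {}")
      case False
      then obtain x where "x \<in> W" "omit i x = p" by (auto simp: V_def)
      then show ?thesis using VW by auto
    qed simp
    define g where "g = (\<lambda>p. if V p = {} then 0 else Min (V p))"
    have "def_fun n g" unfolding g_def by (rule def_fun_Min[OF V fin])
    from Suc.IH[OF this] obtain \<D> where D: "finite \<D>" "\<D> \<subseteq> S n" "\<Union>\<D> = Rn n" "\<forall>D\<in>\<D>. \<forall>x\<in>D. cont_at n D g x"
      by blast
    have gf: "g (omit i x) = f x" if "x \<in> W" for x using VW[OF that] by (simp add: g_def)
    define pull where "pull = (\<lambda>D. {x. length x = Suc n \<and> x \<in> W \<and> omit i x \<in> D})"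
    have "pull D \<in> S (Suc n)" if "D \<in> \<D>" for D
    proof -
      have DS: "D \<in> S n" using that D(2) by blast
      show ?thesis unfolding pull_def
        by (rule definable_Collect) (rule def_pred_mem[OF WS] def_pred_mem[OF DS] def_map_omit[OF _ i(1)] def_intros | simp)+
    qed
    moreover have "\<Union>(pull ` \<D>) = W"
    proof
      show "W \<subseteq> \<Union>(pull ` \<D>)"
      proof
        fix x assume x: "x \<in> W"
        then have "omit i x \<in> \<Union>\<D>" using D(3) length_omit[OF Wlen[OF x] i(1)] by (simp add: Rn_def)
        then show "x \<in> \<Union>(pull ` \<D>)" using x Wlen by (auto simp: pull_def)
      qed
    qed (auto simp: pull_def)
    moreover have "cont_at (Suc n) (pull D) f x" if "D \<in> \<D>" "x \<in> pull D" for D x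
      unfolding cont_at_def
    proof (intro allI impI)
      fix e :: 'a assume "0 < e"
      have "cont_at n D g (omit i x)" using D(4) that by (auto simp: pull_def)
      then obtain d where d: "d > 0" "\<forall>y\<in>D. near n d (omit i x) y \<longrightarrow> \<bar>g y - g (omit i x)\<bar> < e"
        using \<open>0 < e\<close> unfolding cont_at_def by blast
      have "\<bar>f y - f x\<bar> < e" if y: "y \<in> pull D" "near (Suc n) d x y" for y
      proof -
        have "near n d (omit i x) (omit i y)"
          using near_omit[OF y(2) _ _ i(1)] y(1) \<open>x \<in> pull D\<close> by (simp add: pull_def)
        then have "\<bar>g (omit i y) - g (omit i x)\<bar> < e" using d(2) y(1) by (simp add: pull_def)
        then show ?thesis using gf y(1) \<open>x \<in> pull D\<close> by (simp add: pull_def)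
      qed
      then show "\<exists>d>0. \<forall>y\<in>pull D. near (Suc n) d x y \<longrightarrow> \<bar>f y - f x\<bar> < e" using d(1) by blast
    qed
    ultimately show ?thesis using D(1) by (intro exI[of _ "pull ` \<D>"]) auto
  qed
  then obtain \<D> where D: "\<And>W. W \<in> \<W> \<Longrightarrow> finite (\<D> W) \<and> \<D> W \<subseteq> S (Suc n) \<and> \<Union>(\<D> W) = W \<and>
      (\<forall>D\<in>\<D> W. \<forall>x\<in>D. cont_at (Suc n) D f x)" by metis
  define C where "C = {x. length x = Suc n \<and> cont_at (Suc n) (Rn (Suc n)) f x}"
  have C: "C \<in> S (Suc n)" unfolding C_def by (rule definable_Collect[OF dZ])
  have CC: "cont_at (Suc n) C f x" if "x \<in> C" for x
    using that cont_at_mono[of "Suc n" "Rn (Suc n)" f x C] by (auto simp: C_def Rn_def)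
  have "C \<union> Z = Rn (Suc n)" by (auto simp: C_def Z_def Rn_def)
  moreover have "\<Union>(\<Union>(\<D> ` \<W>)) = (\<Union>W\<in>\<W>. \<Union>(\<D> W))" by blast
  then have "\<Union>(\<Union>(\<D> ` \<W>)) = Z" using D W(3) by simp
  ultimately have "\<Union>(insert C (\<Union>(\<D> ` \<W>))) = Rn (Suc n)" by simp
  moreover have "\<Union>(\<D> ` \<W>) \<subseteq> S (Suc n)" using D by blast
  moreover have "finite (\<Union>(\<D> ` \<W>))" using D W(1) by blast
  ultimately show ?case using C CC D by (intro exI[of _ "insert C (\<Union>(\<D> ` \<W>))"]) auto
qed

end

section \<open>The order topology and vertical homeomorphisms\<close>

lemma near_append:
  assumes "length x = k" "length y = k" "0 < d"
  shows "near (k + l) d (x @ z) (y @ z) \<longleftrightarrow> near k d x y"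
proof
  assume "near (k + l) d (x @ z) (y @ z)"
  then have "\<bar>(y @ z) ! i - (x @ z) ! i\<bar> < d" if "i < k" for i using that by (simp add: near_def)
  then show "near k d x y" using assms by (auto simp: near_def nth_append)
next
  assume "near k d x y"
  then show "near (k + l) d (x @ z) (y @ z)" using assms by (auto simp: near_def nth_append)
qed

lemma near_snoc:
  assumes "length p = k" "length q = k"
  shows "near (Suc k) d (p @ [s]) (q @ [t]) \<longleftrightarrow> near k d p q \<and> \<bar>t - s\<bar> < d"
  using assms by (auto simp: near_def nth_append less_Suc_eq)

lemma near_ball_openin:
  fixes x :: "'a::linordered_field list"
  shows "openin (Rtop n) {y \<in> Rn n. near n d x y}"
proof -
  have "{y \<in> Rn n. near n d x y} = {y \<in> Rn n. \<forall>i<n. x ! i - d < y ! i \<and> y ! i < x ! i + d}"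
    by (auto simp: near_def abs_less_iff algebra_simps)
  moreover have "openin (Rtop n) {y \<in> Rn n. \<forall>i<n. a i < y ! i \<and> y ! i < b i}" for a b :: "nat \<Rightarrow> 'a"
    unfolding Rtop_def by (rule topology_generated_by_Basis) blast
  ultimately show ?thesis by (simp only:)
qed

text \<open>A box contains a \<open>near\<close> ball around each of its points, with the least
  distance to a face as radius, and such balls are themselves boxes.\<close>

lemma openin_Rtop:
  fixes U :: "'a::linordered_field list set"
  shows "openin (Rtop n) U \<longleftrightarrow> U \<subseteq> Rn n \<and> (\<forall>x\<in>U. \<exists>d>0. \<forall>y\<in>Rn n. near n d x y \<longrightarrow> y \<in> U)"
proof
  assume "openin (Rtop n) U"
  then have "generate_topology_on
     (insert (Rn n) {{x \<in> Rn n. \<forall>i<n. a i < x ! i \<and> x ! i < b i} | a b. True}) U"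
    by (simp add: Rtop_def openin_topology_generated_by_iff)
  then show "U \<subseteq> Rn n \<and> (\<forall>x\<in>U. \<exists>d>0. \<forall>y\<in>Rn n. near n d x y \<longrightarrow> y \<in> U)"
  proof (induction rule: generate_topology_on.induct)
    case (Int A B)
    have "\<exists>d>0. \<forall>y\<in>Rn n. near n d x y \<longrightarrow> y \<in> A \<inter> B" if x: "x \<in> A \<inter> B" for x
    proof -
      obtain d where d: "d > 0" "\<forall>y\<in>Rn n. near n d x y \<longrightarrow> y \<in> A" using Int x by blast
      obtain d' where d': "d' > 0" "\<forall>y\<in>Rn n. near n d' x y \<longrightarrow> y \<in> B" using Int x by blast
      show ?thesis
        by (rule exI[of _ "min d d'"]) (use d d' near_mono[of n "min d d'"] in auto)
    qed
    then show ?case using Int by blast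
  next
    case (UN K)
    then show ?case by (meson Sup_least Union_iff)
  next
    case (Basis B)
    then consider "B = Rn n" | a b where "B = {x \<in> Rn n. \<forall>i<n. a i < x ! i \<and> x ! i < b i}" by blast
    then show ?case
    proof cases
      case 1
      then show ?thesis by (auto intro!: exI[of _ 1])
    next
      case (2 a b)
      have "\<exists>d>0. \<forall>y\<in>Rn n. near n d x y \<longrightarrow> y \<in> B" if x: "x \<in> B" for x
      proof -
        \<comment> \<open>The entry \<open>1\<close> keeps the set nonempty when
          \<open>n = 0\<close>.\<close>
        define D where "D = insert 1 ((\<lambda>i. min (x ! i - a i) (b i - x ! i)) ` {..<n})"
        have D: "finite D" by (simp add: D_def)
        have "0 < Min D" using x 2 by (subst Min_gr_iff) (auto simp: D_def)
        moreover have "y \<in> B" if y: "y \<in> Rn n" "near n (Min D) x y" for y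
        proof -
          have "a i < y ! i \<and> y ! i < b i" if i: "i < n" for i
          proof -
            have "Min D \<le> min (x ! i - a i) (b i - x ! i)" by (rule Min_le[OF D]) (use i in \<open>auto simp: D_def\<close>)
            moreover have "\<bar>y ! i - x ! i\<bar> < Min D" using y(2) i by (simp add: near_def)
            ultimately show ?thesis by (simp add: abs_less_iff)
          qed
          then show ?thesis using y 2 by simp
        qed
        ultimately show ?thesis by blast
      qed
      then show ?thesis using 2 by auto
    qed
  qed simp
next
  assume U: "U \<subseteq> Rn n \<and> (\<forall>x\<in>U. \<exists>d>0. \<forall>y\<in>Rn n. near n d x y \<longrightarrow> y \<in> U)"
  show "openin (Rtop n) U"
  proof (subst openin_subopen, rule ballI)
    fix x assume x: "x \<in> U"
    then obtain d where d: "d > 0" "\<forall>y\<in>Rn n. near n d x y \<longrightarrow> y \<in> U" using U by blast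
    then show "\<exists>T. openin (Rtop n) T \<and> x \<in> T \<and> T \<subseteq> U"
      by (intro exI[of _ "{y \<in> Rn n. near n d x y}"] conjI near_ball_openin)
        (use U x in \<open>auto simp: near_def\<close>)
  qed
qed

lemma topspace_Rtop: "topspace (Rtop n) = Rn n"
  by (auto simp: Rtop_def)

lemma continuous_map_Rtop:
  fixes f :: "'a::linordered_field list \<Rightarrow> 'a list"
  assumes Z: "Z \<subseteq> Rn n" and fZ: "\<And>x. x \<in> Z \<Longrightarrow> f x \<in> Z"
    and cont: "\<And>x e. x \<in> Z \<Longrightarrow> 0 < e \<Longrightarrow> \<exists>d>0. \<forall>y\<in>Z. near n d x y \<longrightarrow> near n e (f x) (f y)"
  shows "continuous_map (subtopology (Rtop n) Z) (subtopology (Rtop n) Z) f"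
proof -
  have top: "topspace (subtopology (Rtop n) Z) = Z" using Z by (auto simp: topspace_Rtop)
  have "continuous_map (subtopology (Rtop n) Z) (Rtop n) f"
    unfolding continuous_map top
  proof (intro conjI allI impI)
    show "f ` Z \<subseteq> topspace (Rtop n)" using fZ Z by (auto simp: topspace_Rtop)
    fix U :: "'a list set" assume U: "openin (Rtop n) U"
    show "openin (subtopology (Rtop n) Z) {x \<in> Z. f x \<in> U}"
    proof (subst openin_subopen, rule ballI)
      fix x assume x: "x \<in> {x \<in> Z. f x \<in> U}"
      then obtain e where e: "e > 0" "\<forall>y\<in>Rn n. near n e (f x) y \<longrightarrow> y \<in> U"
        using U unfolding openin_Rtop by blast
      obtain d where d: "d > 0" "\<forall>y\<in>Z. near n d x y \<longrightarrow> near n e (f x) (f y)"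
        using cont[of x e] x e(1) by blast
      show "\<exists>T. openin (subtopology (Rtop n) Z) T \<and> x \<in> T \<and> T \<subseteq> {x \<in> Z. f x \<in> U}"
      proof (intro exI[of _ "{y \<in> Rn n. near n d x y} \<inter> Z"] conjI)
        show "openin (subtopology (Rtop n) Z) ({y \<in> Rn n. near n d x y} \<inter> Z)"
          using near_ball_openin[of n d x] by (auto simp: openin_subtopology)
        show "x \<in> {y \<in> Rn n. near n d x y} \<inter> Z" using x Z d(1) by (auto simp: near_def)
        show "{y \<in> Rn n. near n d x y} \<inter> Z \<subseteq> {x \<in> Z. f x \<in> U}" using d(2) e(2) fZ Z by blast
      qed
    qed
  qed
  then show ?thesis using fZ by (auto simp: continuous_map_in_subtopology top)
qed

text \<open>Avoids case distinctions in the piecewise linear maps: definability follows from the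
  rules for minimum and maximum, continuity from a Lipschitz bound.\<close>

definition clamp01 :: "'a::linordered_field \<Rightarrow> 'a" where
  "clamp01 u = max 0 (min u 1)"

text \<open>The piecewise linear map with value \<open>c i\<close> at \<open>i \<le> r\<close> and slope \<open>1\<close> outside \<open>[0, r]\<close>.\<close>

definition pl_map :: "(nat \<Rightarrow> 'a::linordered_field) \<Rightarrow> nat \<Rightarrow> 'a \<Rightarrow> 'a" where
  "pl_map c r t = c 0 + t + (\<Sum>i<r. (c (Suc i) - c i - 1) * clamp01 (t - of_nat i))"

lemma pl_map_ge: "of_nat r \<le> t \<Longrightarrow> pl_map c r t = c r + (t - of_nat r)"
proof (induction r)
  case (Suc r)
  then have "of_nat r + 1 \<le> t" by (simp add: add.commute)
  then have "pl_map c r t = c r + (t - of_nat r)" "clamp01 (t - of_nat r) = 1"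
    using Suc.IH by (auto simp: clamp01_def)
  then show ?case by (simp add: pl_map_def)
qed (simp add: pl_map_def)

lemma pl_map_Suc: "pl_map c (Suc r) t = pl_map c r t + (c (Suc r) - c r - 1) * clamp01 (t - of_nat r)"
  by (simp add: pl_map_def)

lemma pl_map_Suc_le: "t \<le> of_nat r \<Longrightarrow> pl_map c (Suc r) t = pl_map c r t"
  by (simp add: pl_map_Suc clamp01_def)

lemma pl_map_of_nat: "j \<le> r \<Longrightarrow> pl_map c r (of_nat j) = c j"
proof (induction r)
  case (Suc r)
  show ?case
  proof (cases "j = Suc r")
    case True then show ?thesis using pl_map_ge[of "Suc r" "of_nat j"] by simp
  next
    case False then show ?thesis using Suc pl_map_Suc_le[of "of_nat j" r c] by simp
  qed
qed (simp add: pl_map_def)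

text \<open>Passing from \<open>r\<close> to \<open>Suc r\<close> changes the map only to the right
  of \<open>of_nat r\<close>. Points on different sides are compared through this
  breakpoint.\<close>

lemma pl_map_strict_mono:
  fixes c :: "nat \<Rightarrow> 'a::linordered_field"
  assumes "\<And>i. i < r \<Longrightarrow> c i < c (Suc i)" shows "strict_mono (pl_map c r)"
  using assms
proof (induction r)
  case 0
  then show ?case by (auto simp: strict_mono_def pl_map_def)
next
  case (Suc r)
  then have IH: "strict_mono (pl_map c r)" and d: "0 < c (Suc r) - c r" by auto
  have low: "pl_map c (Suc r) s < pl_map c (Suc r) t" if "s < t" "t \<le> of_nat r" for s t
    using that IH by (simp add: pl_map_Suc_le strict_mono_def)
  have high: "pl_map c (Suc r) s < pl_map c (Suc r) t" if st: "of_nat r \<le> s" "s < t" for s t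
  proof -
    define u where "u = s - of_nat r"
    define v where "v = t - of_nat r"
    define D where "D = c (Suc r) - c r"
    have uv: "0 \<le> u" "u < v" using st by (auto simp: u_def v_def)
    have eq: "pl_map c (Suc r) x = c r + (x - of_nat r - clamp01 (x - of_nat r)) + D * clamp01 (x - of_nat r)"
      if "of_nat r \<le> x" for x using that by (simp add: pl_map_Suc pl_map_ge D_def algebra_simps)
    \<comment> \<open>Both parts are nondecreasing in \<open>u \<ge> 0\<close>. The clamped part
      grows strictly below \<open>1\<close>, with positive factor \<open>D\<close>; the remainder
      grows strictly from \<open>1\<close> on.\<close>
    have "u - clamp01 u + D * clamp01 u < v - clamp01 v + D * clamp01 v"
    proof (cases "u < 1")
      case True
      then have "clamp01 u < clamp01 v" "u - clamp01 u \<le> v - clamp01 v"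
        using uv by (auto simp: clamp01_def max_def min_def)
      then show ?thesis using d mult_strict_left_mono[of "clamp01 u" "clamp01 v" D] by (simp add: D_def add_le_less_mono)
    next
      case False
      then have "clamp01 u = 1" "clamp01 v = 1" using uv by (auto simp: clamp01_def)
      then show ?thesis using uv by simp
    qed
    then show ?thesis using st eq[of s] eq[of t] by (simp add: u_def v_def)
  qed
  show ?case unfolding strict_mono_def
  proof (intro allI impI)
    fix s t :: 'a assume "s < t"
    then consider "t \<le> of_nat r" | "of_nat r \<le> s" | "s < of_nat r" "of_nat r < t" by force
    then show "pl_map c (Suc r) s < pl_map c (Suc r) t"
    proof cases
      case 3
      then show ?thesis using low[of s "of_nat r"] high[of "of_nat r" t] by simp
    qed (use low high \<open>s < t\<close> in auto)
  qed
qed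

lemma pl_map_surj:
  fixes c :: "nat \<Rightarrow> 'a::linordered_field"
  assumes "\<And>i. i < r \<Longrightarrow> c i < c (Suc i)" shows "surj (pl_map c r)"
  using assms
proof (induction r)
  case 0
  have "pl_map c 0 (y - c 0) = y" for y by (simp add: pl_map_def)
  then show ?case by (metis surj_def)
next
  case (Suc r)
  then have IH: "surj (pl_map c r)" and d: "0 < c (Suc r) - c r" by auto
  have "\<exists>t. pl_map c (Suc r) t = y" for y
  proof -
    consider "y \<le> c r" | "c r < y" "y \<le> c (Suc r)" | "c (Suc r) < y" by force
    then show ?thesis
    proof cases
      case 1
      obtain t where t: "pl_map c r t = y" using IH by (metis surjD)
      have "t \<le> of_nat r"
      proof (rule ccontr)
        assume "\<not> t \<le> of_nat r"
        then show False using pl_map_ge[of r t c] t 1 by simp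
      qed
      then show ?thesis using t pl_map_Suc_le by metis
    next
      case 2
      define u where "u = (y - c r) / (c (Suc r) - c r)"
      have u: "0 \<le> u" "u \<le> 1" "u * (c (Suc r) - c r) = y - c r" using 2 d by (auto simp: u_def)
      then have "pl_map c (Suc r) (of_nat r + u) = y"
        by (simp add: pl_map_Suc pl_map_ge clamp01_def algebra_simps)
      then show ?thesis ..
    next
      case 3
      have "pl_map c (Suc r) (of_nat (Suc r) + (y - c (Suc r))) = y"
        using 3 by (subst pl_map_ge) auto
      then show ?thesis ..
    qed
  qed
  then show ?case by (metis surj_def)
qed

section \<open>Arithmetic of relative continuity\<close>

lemma cont_at_const: "cont_at n D (\<lambda>x. c) x"
  by (auto simp: cont_at_def intro!: exI[of _ 1])

lemma cont_at_nth: "i < n \<Longrightarrow> cont_at n D (\<lambda>x. x ! i) x"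
  unfolding cont_at_def near_def by blast

lemma cont_at_add:
  assumes "cont_at n D f x" "cont_at n D g x" shows "cont_at n D (\<lambda>x. f x + g x) x"
  unfolding cont_at_def
proof (intro allI impI)
  fix e :: 'a assume e: "0 < e"
  then have e2: "0 < e / 2" by simp
  obtain d where d: "d > 0" "\<forall>y\<in>D. near n d x y \<longrightarrow> \<bar>f y - f x\<bar> < e / 2"
    using assms(1) e2 unfolding cont_at_def by blast
  obtain d' where d': "d' > 0" "\<forall>y\<in>D. near n d' x y \<longrightarrow> \<bar>g y - g x\<bar> < e / 2"
    using assms(2) e2 unfolding cont_at_def by blast
  have "\<bar>f y + g y - (f x + g x)\<bar> < e" if "y \<in> D" "near n (min d d') x y" for y
  proof -
    have "near n d x y" "near n d' x y" using that(2) near_mono min.cobounded1 min.cobounded2 by metis+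
    then have "\<bar>f y - f x\<bar> < e / 2" "\<bar>g y - g x\<bar> < e / 2" using d d' that by auto
    then show ?thesis by linarith
  qed
  then show "\<exists>d>0. \<forall>y\<in>D. near n d x y \<longrightarrow> \<bar>f y + g y - (f x + g x)\<bar> < e"
    using d(1) d'(1) by (intro exI[of _ "min d d'"]) auto
qed

lemma cont_at_lipschitz:
  assumes "cont_at n D f x" "\<And>a b. \<bar>h a - h b\<bar> \<le> \<bar>a - b\<bar>" shows "cont_at n D (\<lambda>x. h (f x)) x"
  unfolding cont_at_def
proof (intro allI impI)
  fix e :: 'a assume "0 < e"
  then obtain d where "d > 0" "\<forall>y\<in>D. near n d x y \<longrightarrow> \<bar>f y - f x\<bar> < e"
    using assms(1) unfolding cont_at_def by blast
  then show "\<exists>d>0. \<forall>y\<in>D. near n d x y \<longrightarrow> \<bar>h (f y) - h (f x)\<bar> < e"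
    using assms(2) le_less_trans by blast
qed

lemma cont_at_mult:
  assumes "cont_at n D f x" "cont_at n D g x" shows "cont_at n D (\<lambda>x. f x * g x) x"
  unfolding cont_at_def
proof (intro allI impI)
  fix e :: 'a assume e: "0 < e"
  define M where "M = \<bar>f x\<bar> + \<bar>g x\<bar> + 1"
  have M: "0 < M" by (simp add: M_def add_nonneg_pos)
  \<comment> \<open>The bound \<open>1\<close> makes the product of the two increments linear in
    \<open>\<eta>\<close>; the three error terms then sum to less than
    \<open>\<eta> * M\<close>.\<close>
  define \<eta> where "\<eta> = min 1 (e / M)"
  have \<eta>: "0 < \<eta>" "\<eta> \<le> 1" "\<eta> * M \<le> e" using e M by (auto simp: \<eta>_def min_def field_simps)
  obtain d where d: "d > 0" "\<forall>y\<in>D. near n d x y \<longrightarrow> \<bar>f y - f x\<bar> < \<eta>"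
    using assms(1) \<eta>(1) unfolding cont_at_def by blast
  obtain d' where d': "d' > 0" "\<forall>y\<in>D. near n d' x y \<longrightarrow> \<bar>g y - g x\<bar> < \<eta>"
    using assms(2) \<eta>(1) unfolding cont_at_def by blast
  have "\<bar>f y * g y - f x * g x\<bar> < e" if "y \<in> D" "near n (min d d') x y" for y
  proof -
    have "near n d x y" "near n d' x y" using that(2) near_mono min.cobounded1 min.cobounded2 by metis+
    then have fg: "\<bar>f y - f x\<bar> < \<eta>" "\<bar>g y - g x\<bar> < \<eta>" using d d' that by auto
    have "f y * g y - f x * g x = (f y - f x) * (g y - g x) + f x * (g y - g x) + (f y - f x) * g x"
      by (simp add: algebra_simps)
    then have "\<bar>f y * g y - f x * g x\<bar> \<le> \<bar>f y - f x\<bar> * \<bar>g y - g x\<bar> + \<bar>f x\<bar> * \<bar>g y - g x\<bar> + \<bar>f y - f x\<bar> * \<bar>g x\<bar>"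
      by (metis (no_types) abs_mult abs_triangle_ineq add_right_mono order_trans)
    also have "\<bar>f y - f x\<bar> * \<bar>g y - g x\<bar> < \<eta> * 1"
      using fg \<eta> by (intro mult_strict_mono) auto
    also have "\<bar>f x\<bar> * \<bar>g y - g x\<bar> \<le> \<bar>f x\<bar> * \<eta>" using fg by (intro mult_left_mono) auto
    also have "\<bar>f y - f x\<bar> * \<bar>g x\<bar> \<le> \<eta> * \<bar>g x\<bar>" using fg by (intro mult_right_mono) auto
    finally show ?thesis using \<eta>(3) by (simp add: M_def algebra_simps)
  qed
  then show "\<exists>d>0. \<forall>y\<in>D. near n d x y \<longrightarrow> \<bar>f y * g y - f x * g x\<bar> < e"
    using d(1) d'(1) by (intro exI[of _ "min d d'"]) auto
qed

lemma cont_at_diff: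
  assumes "cont_at n D f x" "cont_at n D g x" shows "cont_at n D (\<lambda>x. f x - g x) x"
  using cont_at_add[OF assms(1) cont_at_mult[OF cont_at_const[of n D "-1" x] assms(2)]] by simp

lemma cont_at_sum:
  "(\<And>i. i \<in> I \<Longrightarrow> cont_at n D (f i) x) \<Longrightarrow> cont_at n D (\<lambda>x. \<Sum>i\<in>I. f i x) x"
  by (induction I rule: infinite_finite_induct) (auto intro: cont_at_const cont_at_add)

lemma clamp01_lipschitz: "\<bar>clamp01 a - clamp01 b\<bar> \<le> \<bar>a - b\<bar>"
  by (auto simp: clamp01_def max_def min_def)

lemma cont_at_base:
  assumes "cont_at k C f p" "length p = k" "C \<subseteq> Rn k"
  shows "cont_at (Suc k) (C \<otimes>\<^sub>l Rn 1) (\<lambda>z. f (take k z)) (p @ [t])"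
  unfolding cont_at_def
proof (intro allI impI)
  fix e :: 'a assume "0 < e"
  then obtain d where d: "d > 0" "\<forall>y\<in>C. near k d p y \<longrightarrow> \<bar>f y - f p\<bar> < e"
    using assms(1) unfolding cont_at_def by blast
  have "\<bar>f (take k y) - f (take k (p @ [t]))\<bar> < e" if y: "y \<in> C \<otimes>\<^sub>l Rn 1" "near (Suc k) d (p @ [t]) y" for y
  proof -
    obtain q s where q: "y = q @ [s]" "q \<in> C" using y(1) by (auto simp: lprod_def Rn_def length_Suc_conv)
    then have "length q = k" using assms(3) by (auto simp: Rn_def)
    then show ?thesis using y(2) q d(2) assms(2) by (simp add: near_snoc)
  qed
  then show "\<exists>d>0. \<forall>y\<in>C \<otimes>\<^sub>l Rn 1. near (Suc k) d (p @ [t]) y \<longrightarrow> \<bar>f (take k y) - f (take k (p @ [t]))\<bar> < e"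
    using d(1) by blast
qed

section \<open>Homeomorphisms that preserve the base coordinates\<close>

lemma Rn_1: "Rn 1 = line UNIV"
  by (auto simp: Rn_def line_def length_Suc_conv)

definition vertical :: "nat \<Rightarrow> ('a list \<Rightarrow> 'a \<Rightarrow> 'a) \<Rightarrow> 'a list \<Rightarrow> 'a list" where
  "vertical k \<psi> z = take k z @ [\<psi> (take k z) (z ! k)]"

lemma vertical_snoc [simp]: "length p = k \<Longrightarrow> vertical k \<psi> (p @ [t]) = p @ [\<psi> p t]"
  by (auto simp: vertical_def)

context o_minimal
begin

lemma definable_lprod_line: "C \<in> S k \<Longrightarrow> C \<otimes>\<^sub>l Rn 1 \<in> S (Suc k)"
  using definable_prod[of C k "Rn 1" 1] definable_Collect[OF def_pred_const[of 1 True]] by (simp add: Rn_def)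

text \<open>The main point is continuity of the inverse \<open>\<theta>\<close>. By monotonicity,
  \<open>\<theta> q u\<close> lies between \<open>t - e\<close> and \<open>t + e\<close> as soon as
  \<open>u\<close> lies between the values of \<open>\<psi> q\<close> at these two points, and those
  values vary continuously with \<open>q\<close>.\<close>

lemma vertical_homeo:
  assumes C: "C \<in> S k" and d\<psi>: "def_fun (Suc k) (\<lambda>z. \<psi> (take k z) (z ! k))"
    and mono: "\<And>p. p \<in> C \<Longrightarrow> strict_mono (\<psi> p)" and surj: "\<And>p. p \<in> C \<Longrightarrow> surj (\<psi> p)"
    and cont: "\<And>p t. p \<in> C \<Longrightarrow> cont_at (Suc k) (C \<otimes>\<^sub>l Rn 1) (\<lambda>z. \<psi> (take k z) (z ! k)) (p @ [t])"
  shows "definable_homeo_over S k C (vertical k \<psi>)"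
proof -
  define Z where "Z = C \<otimes>\<^sub>l Rn 1"
  have Clen: "length p = k" if "p \<in> C" for p using definable_subset[OF C] that by (auto simp: Rn_def)
  have Zmem: "p @ [t] \<in> Z \<longleftrightarrow> p \<in> C" for p t by (simp add: Z_def Rn_1 del: One_nat_def)
  have ZE: "\<exists>p t. z = p @ [t] \<and> p \<in> C \<and> length p = k" if "z \<in> Z" for z
    using that Clen unfolding Z_def Rn_1 by (auto elim!: lprod_lineE)
  have ZS: "Z \<in> S (Suc k)" unfolding Z_def by (rule definable_lprod_line[OF C])
  have ZR: "Z \<subseteq> Rn (Suc k)" using definable_subset[OF ZS] .
  define \<theta> where "\<theta> = (\<lambda>p. inv (\<psi> p))"
  have \<psi>\<theta>: "\<psi> p (\<theta> p s) = s" if "p \<in> C" for p s using surj[OF that] by (simp add: \<theta>_def surj_f_inv_f)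
  have \<theta>\<psi>: "\<theta> p (\<psi> p s) = s" if "p \<in> C" for p s
    using strict_mono_imp_inj_on[OF mono[OF that]] by (simp add: \<theta>_def inv_f_f)
  have less: "\<psi> p s < \<psi> p t \<longleftrightarrow> s < t" if "p \<in> C" for p s t using mono[OF that] by (rule strict_mono_less)

  have contZ: "\<exists>d>0. \<forall>q\<in>C. \<forall>s. near k d p q \<and> \<bar>s - t\<bar> < d \<longrightarrow> \<bar>\<psi> q s - \<psi> p t\<bar> < e"
    if p: "p \<in> C" and e: "0 < e" for p t e
  proof -
    obtain d where d: "d > 0"
      "\<forall>y\<in>Z. near (Suc k) d (p @ [t]) y \<longrightarrow> \<bar>\<psi> (take k y) (y ! k) - \<psi> (take k (p @ [t])) ((p @ [t]) ! k)\<bar> < e"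
      using cont[OF p, of t] e unfolding cont_at_def Z_def by blast
    have "\<bar>\<psi> q s - \<psi> p t\<bar> < e" if "q \<in> C" "near k d p q" "\<bar>s - t\<bar> < d" for q s
      using d(2)[rule_format, of "q @ [s]"] that p Clen[OF p] Clen[OF that(1)] by (simp add: Zmem near_snoc nth_append)
    then show ?thesis using d(1) by blast
  qed

  have c1: "continuous_map (subtopology (Rtop (Suc k)) Z) (subtopology (Rtop (Suc k)) Z) (vertical k \<psi>)"
  proof (rule continuous_map_Rtop[OF ZR])
    fix z assume "z \<in> Z"
    then obtain p t where p: "z = p @ [t]" "p \<in> C" "length p = k" using ZE by blast
    then show "vertical k \<psi> z \<in> Z" by (simp add: Zmem)
    fix e :: 'a assume e: "0 < e"
    obtain d where d: "d > 0" "\<forall>q\<in>C. \<forall>s. near k d p q \<and> \<bar>s - t\<bar> < d \<longrightarrow> \<bar>\<psi> q s - \<psi> p t\<bar> < e"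
      using contZ[OF p(2) e] by blast
    have "near (Suc k) e (vertical k \<psi> z) (vertical k \<psi> y)" if y: "y \<in> Z" "near (Suc k) (min d e) z y" for y
    proof -
      obtain q s where q: "y = q @ [s]" "q \<in> C" "length q = k" using ZE[OF y(1)] by blast
      have "near k (min d e) p q" "\<bar>s - t\<bar> < min d e" using y(2) p q by (auto simp: near_snoc)
      then have "near k d p q" "near k e p q" "\<bar>s - t\<bar> < d" using near_mono by (auto intro: near_mono)
      then show ?thesis using d(2) p q by (simp add: near_snoc)
    qed
    then show "\<exists>d>0. \<forall>y\<in>Z. near (Suc k) d z y \<longrightarrow> near (Suc k) e (vertical k \<psi> z) (vertical k \<psi> y)"
      using d(1) e by (intro exI[of _ "min d e"]) auto
  qed
  have c2: "continuous_map (subtopology (Rtop (Suc k)) Z) (subtopology (Rtop (Suc k)) Z) (vertical k \<theta>)"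
  proof (rule continuous_map_Rtop[OF ZR])
    fix z assume "z \<in> Z"
    then obtain p s where p: "z = p @ [s]" "p \<in> C" "length p = k" using ZE by blast
    then show "vertical k \<theta> z \<in> Z" by (simp add: Zmem)
    fix e :: 'a assume e: "0 < e"
    define t where "t = \<theta> p s"
    have t: "\<psi> p t = s" using \<psi>\<theta>[OF p(2)] by (simp add: t_def)
    have "\<psi> p (t - e) < s" "s < \<psi> p (t + e)" using less[OF p(2)] e t by auto
    \<comment> \<open>Half the smaller distance from \<open>s\<close> to the two bounding values: a
      bound and \<open>u\<close> may both move by less than \<open>\<eta>\<close> without
      crossing.\<close>
    define \<eta> where "\<eta> = min (s - \<psi> p (t - e)) (\<psi> p (t + e) - s) / 2"
    have \<eta>: "0 < \<eta>" "2 * \<eta> \<le> s - \<psi> p (t - e)" "2 * \<eta> \<le> \<psi> p (t + e) - s"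
      using \<open>\<psi> p (t - e) < s\<close> \<open>s < \<psi> p (t + e)\<close> by (auto simp: \<eta>_def)
    obtain d where d: "d > 0" "\<forall>q\<in>C. \<forall>s. near k d p q \<and> \<bar>s - (t - e)\<bar> < d \<longrightarrow> \<bar>\<psi> q s - \<psi> p (t - e)\<bar> < \<eta>"
      using contZ[OF p(2) \<eta>(1)] by blast
    obtain d' where d': "d' > 0" "\<forall>q\<in>C. \<forall>s. near k d' p q \<and> \<bar>s - (t + e)\<bar> < d' \<longrightarrow> \<bar>\<psi> q s - \<psi> p (t + e)\<bar> < \<eta>"
      using contZ[OF p(2) \<eta>(1)] by blast
    define m where "m = min (min d d') (min \<eta> e)"
    have m: "0 < m" "m \<le> d" "m \<le> d'" "m \<le> \<eta>" "m \<le> e" using d(1) d'(1) \<eta>(1) e by (auto simp: m_def)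
    have "near (Suc k) e (vertical k \<theta> z) (vertical k \<theta> y)" if y: "y \<in> Z" "near (Suc k) m z y" for y
    proof -
      obtain q u where q: "y = q @ [u]" "q \<in> C" "length q = k" using ZE[OF y(1)] by blast
      have nq: "near k m p q" and u: "\<bar>u - s\<bar> < m" using y(2) p q by (auto simp: near_snoc)
      have "\<bar>\<psi> q (t - e) - \<psi> p (t - e)\<bar> < \<eta>" using d q(2) near_mono[OF nq m(2)] by simp
      then have "\<psi> q (t - e) < u" using u \<eta>(2) m(4) by linarith
      then have lo: "t - e < \<theta> q u" using less[OF q(2)] \<psi>\<theta>[OF q(2)] by metis
      have "\<bar>\<psi> q (t + e) - \<psi> p (t + e)\<bar> < \<eta>" using d' q(2) near_mono[OF nq m(3)] by simp
      then have "u < \<psi> q (t + e)" using u \<eta>(3) m(4) by linarith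
      then have "\<theta> q u < t + e" using less[OF q(2)] \<psi>\<theta>[OF q(2)] by metis
      then have "\<bar>\<theta> q u - \<theta> p s\<bar> < e" using lo unfolding t_def by linarith
      then show ?thesis using near_mono[OF nq m(5)] p q by (simp add: near_snoc)
    qed
    then show "\<exists>d>0. \<forall>y\<in>Z. near (Suc k) d z y \<longrightarrow> near (Suc k) e (vertical k \<theta> z) (vertical k \<theta> y)"
      using m(1) by blast
  qed
  have inv: "vertical k \<theta> (vertical k \<psi> z) = z" "vertical k \<psi> (vertical k \<theta> z) = z" if z: "z \<in> Z" for z
  proof -
    obtain p t where "z = p @ [t]" "p \<in> C" "length p = k" using ZE[OF z] by blast
    then show "vertical k \<theta> (vertical k \<psi> z) = z" "vertical k \<psi> (vertical k \<theta> z) = z"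
      by (simp_all add: \<theta>\<psi> \<psi>\<theta>)
  qed
  have "homeomorphic_maps (subtopology (Rtop (Suc k)) Z) (subtopology (Rtop (Suc k)) Z) (vertical k \<psi>) (vertical k \<theta>)"
    using c1 c2 inv by (auto simp: homeomorphic_maps_def)
  then have homeo: "homeomorphic_map (subtopology (Rtop (Suc k)) Z) (subtopology (Rtop (Suc k)) Z) (vertical k \<psi>)"
    using homeomorphic_map_maps by blast

  \<comment> \<open>The graph expressed by conditions on its coordinates, to which the definability
    rules apply.\<close>
  have graph: "{z @ vertical k \<psi> z | z. z \<in> Z} =
     {w. length w = Suc k + Suc k \<and> take (Suc k) w \<in> Z \<and>
       (\<forall>i<k. drop (Suc k) w ! i = take (Suc k) w ! i) \<and>
       drop (Suc k) w ! k = \<psi> (take k (take (Suc k) w)) (take (Suc k) w ! k)}" (is "?L = ?R")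
  proof
    show "?L \<subseteq> ?R"
    proof
      fix w assume "w \<in> ?L"
      then obtain p t where "w = (p @ [t]) @ (p @ [\<psi> p t])" "p \<in> C" "length p = k" using ZE by force
      then show "w \<in> ?R" by (auto simp: Zmem nth_append)
    qed
    show "?R \<subseteq> ?L"
    proof
      fix w assume w: "w \<in> ?R"
      define z where "z = take (Suc k) w"
      have z: "z \<in> Z" using w by (simp add: z_def)
      have "length z = Suc k" using ZR z by (auto simp: Rn_def)
      have "drop (Suc k) w = vertical k \<psi> z"
      proof (rule nth_equalityI)
        show "length (drop (Suc k) w) = length (vertical k \<psi> z)" using w \<open>length z = Suc k\<close> by (simp add: vertical_def)
        fix i assume "i < length (drop (Suc k) w)"
        then have "i < k \<or> i = k" using w by auto
        then show "drop (Suc k) w ! i = vertical k \<psi> z ! i"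
          using w \<open>length z = Suc k\<close> by (auto simp: vertical_def nth_append z_def min_def)
      qed
      then have "w = z @ vertical k \<psi> z" by (metis append_take_drop_id z_def)
      then show "w \<in> ?L" using z by blast
    qed
  qed
  have "?R \<in> S (Suc k + Suc k)"
    by (rule definable_Collect)
      (rule def_pred_mem[OF ZS] def_fun_subst[OF d\<psi>] def_pred_all_less def_intros | simp)+
  then have "{z @ vertical k \<psi> z | z. z \<in> Z} \<in> S (Suc k + Suc k)" unfolding graph .
  moreover have "take k (vertical k \<psi> z) = take k z" if "z \<in> Z" for z
    using ZE[OF that] by auto
  ultimately show ?thesis
    using homeo unfolding definable_homeo_over_def Z_def[symmetric] Let_def by blast
qed

text \<open>
  For \<open>k = 0\<close> the map is required to be the identity, because the base case of \<^const>\<open>cdcd_rec\<close>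
  has no homeomorphism.
\<close>

definition is_column ::
    "nat \<Rightarrow> ('a list \<Rightarrow> 'a) set \<Rightarrow> 'a list set \<Rightarrow> 'a set \<Rightarrow> ('a list \<Rightarrow> 'a \<Rightarrow> 'a) \<Rightarrow> bool" where
  "is_column k H C P \<psi> \<longleftrightarrow> finite P \<and> P \<noteq> {} \<and> (\<forall>a\<in>P. \<exists>g\<in>H. \<forall>p\<in>C. \<psi> p a = g p) \<and>
     (\<forall>g\<in>H. \<exists>a\<in>P. \<forall>p\<in>C. \<psi> p a = g p) \<and> (\<forall>p\<in>C. strict_mono (\<psi> p) \<and> surj (\<psi> p)) \<and>
     (if k = 0 then \<psi> = (\<lambda>p t. t) else definable_homeo_over S k C (vertical k \<psi>))"

text \<open>By the trichotomy, the order of the functions at one point \<open>p0\<close> is their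
  order on all of \<open>C\<close>, and functions equal at \<open>p0\<close> agree on
  \<open>C\<close>. After choosing one function for each value at \<open>p0\<close> and sorting,
  \<open>pl_map\<close> interpolates between consecutive ones, with the integers from
  \<open>0\<close> to \<open>r\<close> as dividing points of the line.\<close>

lemma column_exists:
  assumes C: "C \<in> S k" "C \<noteq> {}" and H: "finite H" "H \<noteq> {}" "\<And>g. g \<in> H \<Longrightarrow> def_fun k g"
    and cont: "\<And>g p. g \<in> H \<Longrightarrow> p \<in> C \<Longrightarrow> cont_at k C g p"
    and tri: "\<And>g h. g \<in> H \<Longrightarrow> h \<in> H \<Longrightarrow> (\<forall>p\<in>C. g p < h p) \<or> (\<forall>p\<in>C. g p = h p) \<or> (\<forall>p\<in>C. h p < g p)"
  shows "\<exists>P \<psi>. is_column k H C P \<psi>"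
proof (cases "k = 0")
  case True
  then have "C = {[]}" using C definable_subset[OF C(1)] by (auto simp: Rn_def)
  then show ?thesis unfolding is_column_def using H True
    by (intro exI[of _ "(\<lambda>g. g []) ` H"] exI[of _ "\<lambda>p t. t"]) (auto simp: strict_mono_def)
next
  case False
  have Clen: "length p = k" if "p \<in> C" for p using definable_subset[OF C(1)] that by (auto simp: Rn_def)
  obtain p0 where p0: "p0 \<in> C" using C(2) by blast
  define V where "V = (\<lambda>g. g p0) ` H"
  have V: "finite V" "V \<noteq> {}" using H by (auto simp: V_def)
  define r where "r = card V - 1"
  define L where "L = sorted_list_of_set V"
  have L: "length L = Suc r" "set L = V" "sorted L" "distinct L"
    using V by (auto simp: L_def r_def card_gt_0_iff)
  define f where "f = (\<lambda>j. SOME g. g \<in> H \<and> g p0 = L ! j)"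
  have f: "f j \<in> H" "f j p0 = L ! j" if "j \<le> r" for j
  proof -
    have "L ! j \<in> V" using L that by (metis less_Suc_eq_le nth_mem)
    then have "\<exists>g. g \<in> H \<and> g p0 = L ! j" by (auto simp: V_def)
    from someI_ex[OF this] show "f j \<in> H" "f j p0 = L ! j" by (auto simp: f_def)
  qed
  have inc: "f i p < f (Suc i) p" if "i < r" "p \<in> C" for i p
  proof -
    have "L ! i < L ! Suc i" using L that by (simp add: sorted_nth_mono nth_eq_iff_index_eq le_neq_trans)
    then have "f i p0 < f (Suc i) p0" using f that by simp
    then have "\<forall>p\<in>C. f i p < f (Suc i) p"
      using tri[of "f i" "f (Suc i)"] f(1) that p0 by (metis less_asym less_irrefl less_imp_le Suc_leI)
    then show ?thesis using that by blast
  qed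
  define \<psi> where "\<psi> = (\<lambda>p. pl_map (\<lambda>i. f i p) r)"
  have mono: "strict_mono (\<psi> p)" and sur: "surj (\<psi> p)" if "p \<in> C" for p
    using pl_map_strict_mono[of r "\<lambda>i. f i p"] pl_map_surj[of r "\<lambda>i. f i p"] inc that by (auto simp: \<psi>_def)
  have val: "\<psi> p (of_nat j) = f j p" if "j \<le> r" for p j using that by (simp add: \<psi>_def pl_map_of_nat)
  have fd: "def_fun n (\<lambda>z. f i (F z))" if "def_map n k F" "i \<le> r" for i n F using def_fun_subst[OF H(3)[OF f(1)] that(1)] that by simp
  have d\<psi>: "def_fun (Suc k) (\<lambda>z. \<psi> (take k z) (z ! k))"
    unfolding \<psi>_def pl_map_def clamp01_def
    by (rule def_fun_sum def_intros fd | simp)+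
  have "definable_homeo_over S k C (vertical k \<psi>)"
  proof (rule vertical_homeo[OF C(1) d\<psi> mono sur])
    fix p t assume p: "p \<in> C"
    have 1: "cont_at (Suc k) (C \<otimes>\<^sub>l Rn 1) (\<lambda>z. f i (take k z)) (p @ [t])" if "i \<le> r" for i
      by (rule cont_at_base[OF cont[OF f(1)[OF that] p] Clen[OF p] definable_subset[OF C(1)]])
    show "cont_at (Suc k) (C \<otimes>\<^sub>l Rn 1) (\<lambda>z. \<psi> (take k z) (z ! k)) (p @ [t])"
      unfolding \<psi>_def pl_map_def
      by (intro cont_at_add cont_at_sum cont_at_mult cont_at_diff cont_at_const 1 cont_at_nth
        cont_at_lipschitz[OF _ clamp01_lipschitz]) auto
  qed
  moreover have "\<exists>j\<le>r. \<forall>p\<in>C. f j p = g p" if g: "g \<in> H" for g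
  proof -
    have "g p0 \<in> set L" using g L(2) by (simp add: V_def)
    then obtain j where j: "j \<le> r" "L ! j = g p0" using L(1) by (metis in_set_conv_nth less_Suc_eq_le)
    then have "\<forall>p\<in>C. f j p = g p" using tri[of "f j" g] f[OF j(1)] g p0 by fastforce
    then show ?thesis using j by auto
  qed
  ultimately show ?thesis unfolding is_column_def using f(1) val mono sur False
    by (intro exI[of _ "of_nat ` {..r}"] exI[of _ \<psi>]) (auto simp: Bex_def)
qed

end

section \<open>Decomposing columns\<close>

lemma partition_line_cells:
  fixes P :: "'a::linordered_field set"
  assumes P: "finite P" shows "partition_on UNIV (line_cells P)"
proof (rule partition_onI)
  have cells: "D \<in> line_cells P \<longleftrightarrow> (\<exists>a\<in>P. D = {a}) \<or>
      (\<exists>a b. a \<in> P \<and> b \<in> P \<and> a < b \<and> {a<..<b} \<inter> P = {} \<and> D = {a<..<b}) \<or>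
      (P = {} \<and> D = UNIV) \<or> (P \<noteq> {} \<and> (D = {..<Min P} \<or> D = {Max P<..}))" for D
    by (auto simp: line_cells_def)
  show "\<Union>(line_cells P) = UNIV"
  proof (intro equalityI subset_UNIV subsetI)
    fix t
    show "t \<in> \<Union>(line_cells P)"
    proof (cases "P = {} \<or> t \<in> P \<or> t < Min P \<or> Max P < t")
      case True
      then consider "P = {}" | "t \<in> P" | "P \<noteq> {}" "t < Min P" | "P \<noteq> {}" "Max P < t" by blast
      then have "\<exists>D. D \<in> line_cells P \<and> t \<in> D"
      proof cases
        case 1 then show ?thesis unfolding cells by (intro exI[of _ UNIV]) simp
      next
        case 2 then show ?thesis unfolding cells by (intro exI[of _ "{t}"]) simp
      next
        case 3 then show ?thesis unfolding cells by (intro exI[of _ "{..<Min P}"]) simp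
      next
        case 4 then show ?thesis unfolding cells by (intro exI[of _ "{Max P<..}"]) simp
      qed
      then show ?thesis by blast
    next
      case False
      define L where "L = {a \<in> P. a < t}"
      define U where "U = {a \<in> P. t < a}"
      have fin: "finite L" "finite U" using P by (auto simp: L_def U_def)
      have "Min P \<in> P" "Max P \<in> P" using P False by auto
      then have "Min P \<in> L" "Max P \<in> U" using False by (auto simp: L_def U_def not_less le_less)
      then have L: "Max L \<in> L" and U: "Min U \<in> U" using fin Max_in Min_in by blast+
      have "{Max L<..<Min U} \<inter> P = {}"
      proof (rule equals0I)
        fix s assume s: "s \<in> {Max L<..<Min U} \<inter> P"
        moreover have "s \<noteq> t" using s False by blast
        ultimately have "s \<in> L \<or> s \<in> U" by (auto simp: L_def U_def)
        moreover have "\<not> s \<le> Max L" "\<not> Min U \<le> s" using s by simp_all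
        ultimately show False using fin Max_ge[of L s] Min_le[of U s] by blast
      qed
      moreover have "a \<in> P" "a < t" if "a \<in> L" for a using that by (simp_all add: L_def)
      then have "Max L \<in> P" "Max L < t" using L by blast+
      moreover have "a \<in> P" "t < a" if "a \<in> U" for a using that by (simp_all add: U_def)
      then have "Min U \<in> P" "t < Min U" using U by blast+
      moreover from \<open>Max L < t\<close> \<open>t < Min U\<close> have "Max L < Min U" by (rule less_trans)
      ultimately have "{Max L<..<Min U} \<in> line_cells P" unfolding cells by blast
      moreover have "t \<in> {Max L<..<Min U}" using \<open>Max L < t\<close> \<open>t < Min U\<close> by simp
      ultimately show ?thesis by blast
    qed
  qed
  have "D \<noteq> {}" if DD: "D \<in> line_cells P" for D
  proof -
    have "{..<a} \<noteq> {}" "{a<..} \<noteq> {}" for a :: 'a using lt_ex gt_ex by auto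
    moreover have "{a<..<b} \<noteq> {}" if "a < b" for a b :: 'a using that by simp
    ultimately show ?thesis using DD unfolding cells by (metis UNIV_not_empty insert_not_empty)
  qed
  then show "{} \<notin> line_cells P" by blast
  have cell_of: "(t \<in> P \<and> D = {t}) \<or> (\<exists>a b. a \<in> P \<and> b \<in> P \<and> a < t \<and> t < b \<and> {a<..<b} \<inter> P = {} \<and> D = {a<..<b}) \<or>
      (P = {} \<and> D = UNIV) \<or> (P \<noteq> {} \<and> t < Min P \<and> D = {..<Min P}) \<or> (P \<noteq> {} \<and> Max P < t \<and> D = {Max P<..})"
    if "D \<in> line_cells P" "t \<in> D" for D t
    using that(1)[unfolded cells] that(2) by (elim disjE exE bexE conjE) auto
  have ends: "\<not> t < Min P" "\<not> Max P < t" if "a \<in> P" "b \<in> P" "a \<le> t" "t \<le> b" for a b t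
    using order_trans[OF Min_le[OF P that(1)] that(3)] order_trans[OF that(4) Max_ge[OF P that(2)]]
    by (simp_all add: not_less)
  have ends2: "\<not> (t < Min P \<and> Max P < t)" if "P \<noteq> {}" for t
    using Min_in[OF P that] Max_ge[OF P, of "Min P"] by (meson less_trans not_le)
  have btw: "a = a' \<and> b = b'" if "a \<in> P" "b \<in> P" "{a<..<b} \<inter> P = {}" "a' \<in> P" "b' \<in> P" "{a'<..<b'} \<inter> P = {}"
    "a < t" "t < b" "a' < t" "t < b'" for a b a' b' t
  proof -
    have "a \<notin> {a'<..<b'}" "a' \<notin> {a<..<b}" "b \<notin> {a'<..<b'}" "b' \<notin> {a<..<b}" using that by blast+
    then show ?thesis using that(7-10) by simp
  qed
  have inside: False if "t \<in> P" "a < t" "t < b" "{a<..<b} \<inter> P = {}" for a b t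
    using that by (metis IntI empty_iff greaterThanLessThan_iff)
  have disj: "D = E" if DE: "D \<in> line_cells P" "E \<in> line_cells P" and t: "t \<in> D" "t \<in> E" for D E t
    using cell_of[OF DE(1) t(1)] cell_of[OF DE(2) t(2)]
    by (elim disjE exE conjE)
      (simp_all, (use btw inside ends ends2 order_refl less_imp_le in \<open>metis empty_iff\<close>)+)
  show "disjnt D E" if "D \<in> line_cells P" "E \<in> line_cells P" "D \<noteq> E" for D E
    using disj that by (auto simp: disjnt_def)
qed

lemma fiber_memb: "x \<in> fiber k T y \<longleftrightarrow> x @ y \<in> T" if "length x = k" "\<And>w. w \<in> T \<Longrightarrow> length w \<ge> k"
proof
  assume "x \<in> fiber k T y"
  then obtain w where "w \<in> T" "drop k w = y" "x = take k w" by (auto simp: fiber_def)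
  then show "x @ y \<in> T" by (metis append_take_drop_id)
next
  assume "x @ y \<in> T"
  then show "x \<in> fiber k T y" using that unfolding fiber_def by (intro image_eqI[of _ _ "x @ y"]) auto
qed

text \<open>The induction hypothesis is applied with concatenated pairs as parameters. Splitting
  them again doubles the number of parameters and leaves the concatenation unchanged.\<close>

lemma regroup_pairs:
  assumes "set zs \<subseteq> {y @ y' | y y'. y \<in> Y \<and> y' \<in> Y}"
  shows "\<exists>ys. length ys = 2 * length zs \<and> set ys \<subseteq> Y \<and> concat ys = concat zs"
  using assms
proof (induction zs)
  case (Cons z zs)
  then obtain ys where ys: "length ys = 2 * length zs" "set ys \<subseteq> Y" "concat ys = concat zs" by auto
  obtain y y' where "z = y @ y'" "y \<in> Y" "y' \<in> Y" using Cons.prems by auto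
  then show ?case using ys by (intro exI[of _ "y # y' # ys"]) auto
qed simp

lemma length_concat_eq: "set zs \<subseteq> Rn l \<Longrightarrow> length (concat zs) = length zs * l"
  by (induction zs) (auto simp: Rn_def)

lemma strict_mono_surj_image:
  fixes h :: "'a::linorder \<Rightarrow> 'a"
  assumes "strict_mono h" "surj h"
  shows "h ` {a<..<b} = {h a<..<h b}" "h ` {..<b} = {..<h b}" "h ` {a<..} = {h a<..}"
proof -
  have l: "h s < h t \<longleftrightarrow> s < t" for s t using assms(1) by (rule strict_mono_less)
  have "h ` X = Y" if "\<And>u. u \<in> X \<longleftrightarrow> h u \<in> Y" for X Y
    using that assms(2) by (auto simp: image_iff) (metis surjD)
  then show "h ` {a<..<b} = {h a<..<h b}" "h ` {..<b} = {..<h b}" "h ` {a<..} = {h a<..}"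
    by (simp_all add: l)
qed

lemma image_vertical:
  assumes "C \<subseteq> Rn k"
  shows "vertical k \<psi> ` (C \<otimes>\<^sub>l line D) = {p @ [t] | p t. p \<in> C \<and> t \<in> \<psi> p ` D}"
proof -
  have "C \<otimes>\<^sub>l line D = (\<lambda>(p, t). p @ [t]) ` (C \<times> D)" by (auto simp: lprod_def line_def)
  then have "vertical k \<psi> ` (C \<otimes>\<^sub>l line D) = (\<lambda>(p, t). vertical k \<psi> (p @ [t])) ` (C \<times> D)"
    by (simp add: image_image case_prod_unfold)
  also have "\<dots> = (\<lambda>(p, t). p @ [\<psi> p t]) ` (C \<times> D)"
    by (rule image_cong) (use assms in \<open>auto simp: Rn_def\<close>)
  finally show ?thesis by auto
qed

lemma partition_columns:
  assumes \<C>: "partition_on (Rn k) \<C>" and P: "\<And>C. C \<in> \<C> \<Longrightarrow> finite (P C)"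
    and bij: "\<And>C p. C \<in> \<C> \<Longrightarrow> p \<in> C \<Longrightarrow> inj (\<psi> C p) \<and> surj (\<psi> C p)"
  shows "partition_on (Rn (Suc k))
    (\<Union>C\<in>\<C>. {vertical k (\<psi> C) ` (C \<otimes>\<^sub>l line D) | D. D \<in> line_cells (P C :: 'a::linordered_field set)})"
proof -
  have sub: "C \<subseteq> Rn k" if "C \<in> \<C>" for C using \<C> that by (auto dest: partition_onD1)
  have ne: "C \<noteq> {}" if "C \<in> \<C>" for C using \<C> that by (auto dest: partition_onD3)
  have eq: "C = C'" if "C \<in> \<C>" "C' \<in> \<C>" "p \<in> C" "p \<in> C'" for C C' p
    using partition_onD2[OF \<C>] that by (auto simp: disjoint_def)
  note lc = partition_line_cells[OF P]
  define cells where "cells = (\<Union>C\<in>\<C>. {vertical k (\<psi> C) ` (C \<otimes>\<^sub>l line D) | D. D \<in> line_cells (P C)})"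
  have mem: "E \<in> cells \<longleftrightarrow> (\<exists>C\<in>\<C>. \<exists>D\<in>line_cells (P C). E = {p @ [t] | p t. p \<in> C \<and> t \<in> \<psi> C p ` D})" for E
    using image_vertical[OF sub] by (auto simp: cells_def)
  have "partition_on (Rn (Suc k)) cells"
  proof (rule partition_onI)
  show "\<Union>cells = Rn (Suc k)"
  proof
    show "\<Union>cells \<subseteq> Rn (Suc k)"
    proof
      fix x assume "x \<in> \<Union>cells"
      then obtain E where "E \<in> cells" "x \<in> E" by blast
      then obtain C p t where "C \<in> \<C>" "p \<in> C" "x = p @ [t]" using mem[of E] by blast
      then show "x \<in> Rn (Suc k)" using sub by (auto simp: Rn_def)
    qed
    show "Rn (Suc k) \<subseteq> \<Union>cells"
    proof
      fix x :: "'a list" assume "x \<in> Rn (Suc k)"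
      then obtain p t where x: "x = p @ [t]" "length p = k" using snoc_cases[of x k] by (auto simp: Rn_def)
      then have "p \<in> \<Union>\<C>" using partition_onD1[OF \<C>] unfolding Rn_def by blast
      then obtain C where C: "C \<in> \<C>" "p \<in> C" by blast
      obtain s where s: "t = \<psi> C p s" using bij[OF C] by (metis surjD)
      have "s \<in> \<Union>(line_cells (P C))" using partition_onD1[OF lc[OF C(1)]] by simp
      then obtain D where "D \<in> line_cells (P C)" "s \<in> D" by blast
      then have "{p @ [t] | p t. p \<in> C \<and> t \<in> \<psi> C p ` D} \<in> cells" "x \<in> {p @ [t] | p t. p \<in> C \<and> t \<in> \<psi> C p ` D}"
        using mem C x s by blast+
      then show "x \<in> \<Union>cells" by blast
    qed
  qed
  have "E \<noteq> {}" if EE: "E \<in> cells" for E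
  proof -
    obtain C D where CD: "C \<in> \<C>" "D \<in> line_cells (P C)" "E = {p @ [t] | p t. p \<in> C \<and> t \<in> \<psi> C p ` D}"
      using EE mem[of E] by blast
    have "C \<noteq> {}" "D \<noteq> {}" using CD ne[OF CD(1)] partition_onD3[OF lc[OF CD(1)]] by metis+
    then show ?thesis using CD(3) by blast
  qed
  then show "{} \<notin> cells" by blast
  show "disjnt E E'" if E: "E \<in> cells" and E': "E' \<in> cells" and neq: "E \<noteq> E'" for E E'
  proof (rule ccontr)
    assume "\<not> disjnt E E'"
    then obtain x where x: "x \<in> E" "x \<in> E'" by (auto simp: disjnt_def)
    obtain C D where CD: "C \<in> \<C>" "D \<in> line_cells (P C)" "E = {p @ [t] | p t. p \<in> C \<and> t \<in> \<psi> C p ` D}"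
      using E mem[of E] by blast
    obtain C' D' where CD': "C' \<in> \<C>" "D' \<in> line_cells (P C')" "E' = {p @ [t] | p t. p \<in> C' \<and> t \<in> \<psi> C' p ` D'}"
      using E' mem[of E'] by blast
    obtain p s where s: "x = p @ [\<psi> C p s]" "p \<in> C" "s \<in> D" using x(1) CD(3) by blast
    obtain p' s' where s': "x = p' @ [\<psi> C' p' s']" "p' \<in> C'" "s' \<in> D'" using x(2) CD'(3) by blast
    have pp: "p = p'" "C = C'" using s s' eq CD(1) CD'(1) by auto
    then have "s = s'" using s s' bij[OF CD(1) s(2)] by (auto dest: injD)
    then have "D = D'" using partition_onD2[OF lc[OF CD(1)]] CD(2) CD'(2) s(3) s'(3) pp
      by (auto simp: disjoint_def)
    then show False using neq CD(3) CD'(3) pp by simp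
  qed
qed
  then show ?thesis by (simp only: cells_def)
qed

context o_minimal
begin

lemma fiber_iff: "T \<in> S (k + m) \<Longrightarrow> length x = k \<Longrightarrow> x \<in> fiber k T y \<longleftrightarrow> x @ y \<in> T"
  using definable_subset[of T "k + m"] by (intro fiber_memb) (auto simp: Rn_def)

lemma fiber_subset: "T \<in> S (k + m) \<Longrightarrow> fiber k T y \<subseteq> Rn k"
  using definable_subset[of T "k + m"] by (auto simp: fiber_def Rn_def)

lemma fiber_eq: "T \<in> S (k + m) \<Longrightarrow> fiber k T y = {x. length x = k \<and> x @ y \<in> T}"
  using fiber_iff fiber_subset by (fastforce simp: Rn_def)

lemma fiber_definable: "T \<in> S (k + m) \<Longrightarrow> length y = m \<Longrightarrow> fiber k T y \<in> S k"
  unfolding fiber_eq by (rule definable_Collect) (rule def_pred_mem def_map_const def_intros | assumption | simp)+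

text \<open>Each boundary is finite by o-minimality; uniform finiteness then bounds its size over
  all \<open>p\<close>, so that finitely many functions suffice.\<close>

lemma bdry_funs:
  assumes "finite \<X>" "\<And>X. X \<in> \<X> \<Longrightarrow> def_fam n X"
  shows "\<exists>F. finite F \<and> (\<forall>f\<in>F. def_fun n f) \<and> (\<forall>X\<in>\<X>. \<forall>p. length p = n \<longrightarrow> bdry (X p) \<subseteq> (\<lambda>f. f p) ` F)"
proof -
  have "\<exists>F. finite F \<and> (\<forall>f\<in>F. def_fun n f) \<and> (\<forall>p. length p = n \<longrightarrow> bdry (X p) \<subseteq> (\<lambda>f. f p) ` F)" if "X \<in> \<X>" for X
    using finite_fam_funs[OF def_fam_bdry[OF assms(2)[OF that]]] finite_bdry def_fam_tame[OF assms(2)[OF that]] by blast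
  then obtain F where F: "\<And>X. X \<in> \<X> \<Longrightarrow> finite (F X) \<and> (\<forall>f\<in>F X. def_fun n f) \<and>
     (\<forall>p. length p = n \<longrightarrow> bdry (X p) \<subseteq> (\<lambda>f. f p) ` F X)" by metis
  show ?thesis
    by (rule exI[of _ "\<Union>(F ` \<X>)"]) (use F assms(1) in \<open>auto, blast\<close>)
qed

lemma no_bdry_uniform:
  assumes X: "tame X" and J: "bdry X \<inter> J = {}" and conv: "\<And>a b t. a \<in> J \<Longrightarrow> b \<in> J \<Longrightarrow> a \<le> t \<Longrightarrow> t \<le> b \<Longrightarrow> t \<in> J"
    and "s \<in> J" "t \<in> J"
  shows "s \<in> X \<longleftrightarrow> (t::'a) \<in> X"
proof -
  have "min s t \<in> J" "max s t \<in> J" using assms(4,5) by (simp_all add: min_def max_def)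
  then have "min s t \<in> X \<longleftrightarrow> max s t \<in> X"
  proof (intro loc_const_interval[OF X])
    fix u assume "min s t \<le> u" "u \<le> max s t"
    then have "u \<in> J" using conv \<open>min s t \<in> J\<close> \<open>max s t \<in> J\<close> by blast
    then show "loc_const X u" using J by (auto simp: bdry_def)
  qed (simp add: min_def max_def)
  then show ?thesis by (auto simp: min_def max_def split: if_splits)
qed

end

section \<open>Germs and shapes of the cells in a column\<close>

definition right_germ :: "('a::linorder) set \<Rightarrow> 'a \<Rightarrow> bool" where
  "right_germ X c \<longleftrightarrow> (\<exists>v. c < v \<and> (\<forall>t. c < t \<and> t < v \<longrightarrow> t \<in> X))"

definition left_germ :: "('a::linorder) set \<Rightarrow> 'a \<Rightarrow> bool" where
  "left_germ X c \<longleftrightarrow> (\<exists>u. u < c \<and> (\<forall>t. u < t \<and> t < c \<longrightarrow> t \<in> X))"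

text \<open>Both rays take \<open>a\<close> as their endpoint, so a cell with a single bound can
  repeat it as second argument. The whole line is not among the shapes because every column has a
  dividing point.\<close>

definition cell_shape :: "nat \<Rightarrow> 'a \<Rightarrow> 'a \<Rightarrow> ('a::linorder) set" where
  "cell_shape i a b = (if i = 0 then {a} else if i = 1 then {a<..<b} else if i = 2 then {..<a} else {a<..})"

definition uniform_on :: "'b set \<Rightarrow> ('b \<Rightarrow> bool) \<Rightarrow> bool" where
  "uniform_on C Q \<longleftrightarrow> (\<forall>p\<in>C. Q p) \<or> (\<forall>p\<in>C. \<not> Q p)"

text \<open>An open cell of the line contains no point of \<open>P\<close>, every function of
  \<open>H\<close> is the image of such a point, and \<open>\<psi> p\<close> is injective. Hence no
  function of \<open>H\<close> enters the image of an open cell.\<close>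

lemma column_cell_shape:
  fixes P :: "'a::linordered_field set" and \<psi> :: "'b \<Rightarrow> 'a \<Rightarrow> 'a"
  assumes P: "finite P" "P \<noteq> {}" and D: "D \<in> line_cells P"
    and PH: "\<forall>a\<in>P. \<exists>g\<in>H. \<forall>p\<in>C. \<psi> p a = g p" and HP: "\<forall>g\<in>H. \<exists>a\<in>P. \<forall>p\<in>C. \<psi> p a = g p"
    and \<psi>: "\<forall>p\<in>C. strict_mono (\<psi> p) \<and> surj (\<psi> p)"
  shows "\<exists>i<4. \<exists>g\<in>H. \<exists>h\<in>H. (\<forall>p\<in>C. \<psi> p ` D = cell_shape i (g p) (h p)) \<and>
     (i \<noteq> 0 \<longrightarrow> (\<forall>f\<in>H. \<forall>p\<in>C. f p \<notin> \<psi> p ` D))"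
proof -
  have img: "\<psi> p ` {a<..<b} = {\<psi> p a<..<\<psi> p b}" "\<psi> p ` {..<b} = {..<\<psi> p b}" "\<psi> p ` {a<..} = {\<psi> p a<..}"
    if "p \<in> C" for p a b
    using strict_mono_surj_image[of "\<psi> p"] \<psi> that by auto
  have avoid: "\<forall>f\<in>H. \<forall>p\<in>C. f p \<notin> \<psi> p ` D" if DP: "D \<inter> P = {}"
  proof (intro ballI)
    fix f p assume "f \<in> H" and p: "p \<in> C"
    then obtain a where a: "a \<in> P" "f p = \<psi> p a" using HP by metis
    have "inj (\<psi> p)" using \<psi> p strict_mono_imp_inj_on by blast
    then show "f p \<notin> \<psi> p ` D" using a DP by (auto dest: injD)
  qed
  have "(\<exists>a\<in>P. D = {a}) \<or>
      (\<exists>a b. a \<in> P \<and> b \<in> P \<and> {a<..<b} \<inter> P = {} \<and> D = {a<..<b}) \<or> D = {..<Min P} \<or> D = {Max P<..}"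
    using D P by (auto simp: line_cells_def)
  then show ?thesis
  proof (elim disjE bexE exE conjE)
    fix a assume a: "a \<in> P" "D = {a}"
    then obtain g where g: "g \<in> H" "\<forall>p\<in>C. \<psi> p a = g p" using PH by blast
    show ?thesis
      by (rule exI[of _ 0]) (use a g in \<open>auto simp: cell_shape_def\<close>)
  next
    fix a b assume a: "a \<in> P" "b \<in> P" "{a<..<b} \<inter> P = {}" "D = {a<..<b}"
    then obtain g h where g: "g \<in> H" "\<forall>p\<in>C. \<psi> p a = g p" "h \<in> H" "\<forall>p\<in>C. \<psi> p b = h p" using PH by blast
    have "\<forall>p\<in>C. \<psi> p ` D = cell_shape 1 (g p) (h p)" using img g a by (simp add: cell_shape_def)
    moreover have "\<forall>f\<in>H. \<forall>p\<in>C. f p \<notin> \<psi> p ` D" using a by (intro avoid) simp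
    ultimately show ?thesis using g by (intro exI[of _ 1]) auto
  next
    assume D: "D = {..<Min P}"
    obtain g where g: "g \<in> H" "\<forall>p\<in>C. \<psi> p (Min P) = g p" using PH Min_in[OF P] by blast
    have "\<forall>p\<in>C. \<psi> p ` D = cell_shape 2 (g p) (g p)" using img g D by (simp add: cell_shape_def)
    moreover have "\<forall>f\<in>H. \<forall>p\<in>C. f p \<notin> \<psi> p ` D"
      by (intro avoid) (use D P in \<open>auto simp: disjoint_iff not_less\<close>)
    ultimately show ?thesis using g by (intro exI[of _ 2]) auto
  next
    assume D: "D = {Max P<..}"
    obtain g where g: "g \<in> H" "\<forall>p\<in>C. \<psi> p (Max P) = g p" using PH Max_in[OF P] by blast
    have "\<forall>p\<in>C. \<psi> p ` D = cell_shape 3 (g p) (g p)" using img g D by (simp add: cell_shape_def)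
    moreover have "\<forall>f\<in>H. \<forall>p\<in>C. f p \<notin> \<psi> p ` D"
      by (intro avoid) (use D P in \<open>auto simp: disjoint_iff not_less\<close>)
    ultimately show ?thesis using g by (intro exI[of _ 3]) auto
  qed
qed

text \<open>Equality has no clause of its own: it is what remains when both strict comparisons fail,
  and each of these is uniform.\<close>

definition base_regular ::
    "nat \<Rightarrow> ('a::linordered_field list \<Rightarrow> 'a) set \<Rightarrow> 'a list set set \<Rightarrow> 'a list set \<Rightarrow> 'a list set \<Rightarrow> bool" where
  "base_regular k G \<T> Y C \<longleftrightarrow>
     (\<forall>g\<in>G. \<forall>y\<in>Y. \<forall>p\<in>C. cont_at k C (\<lambda>x. g (x @ y)) p) \<and>
       (\<forall>y\<in>Y. \<forall>y'\<in>Y. \<forall>g\<in>G. (\<forall>h\<in>G. uniform_on C (\<lambda>p. g (p @ y) < h (p @ y'))) \<and>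
         (\<forall>T\<in>\<T>. uniform_on C (\<lambda>p. p @ g (p @ y) # y' \<in> T) \<and>
           uniform_on C (\<lambda>p. right_germ {t. p @ t # y' \<in> T} (g (p @ y))) \<and>
           uniform_on C (\<lambda>p. left_germ {t. p @ t # y' \<in> T} (g (p @ y)))))"

section \<open>The induction statement and its reduction to the base\<close>

context o_minimal
begin

lemma right_germ_iff:
  assumes "tame X" "bdry X \<inter> {c<..<d} = {}" "c < t" "t < (d::'a)"
  shows "t \<in> X \<longleftrightarrow> right_germ X c"
proof -
  have *: "s \<in> X \<longleftrightarrow> t \<in> X" if "c < s" "s < d" for s
    using no_bdry_uniform[OF assms(1,2), of s t] that assms(3,4) by simp
  show ?thesis
  proof
    assume "t \<in> X"
    then have "\<forall>s. c < s \<and> s < d \<longrightarrow> s \<in> X" using * by blast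
    moreover have "c < d" using assms(3,4) by simp
    ultimately show "right_germ X c" unfolding right_germ_def by blast
  next
    assume "right_germ X c"
    then obtain v where v: "c < v" "\<forall>t. c < t \<and> t < v \<longrightarrow> t \<in> X" by (auto simp: right_germ_def)
    obtain s where "c < s" "s < min v d" using dense[of c "min v d"] v assms(3,4) by auto
    then show "t \<in> X" using *[of s] v by simp
  qed
qed

lemma left_germ_iff:
  assumes "tame X" "bdry X \<inter> {d<..<c} = {}" "(d::'a) < t" "t < c"
  shows "t \<in> X \<longleftrightarrow> left_germ X c"
proof -
  have *: "s \<in> X \<longleftrightarrow> t \<in> X" if "d < s" "s < c" for s
    using no_bdry_uniform[OF assms(1,2), of s t] that assms(3,4) by simp
  show ?thesis
  proof
    assume "t \<in> X"
    then have "\<forall>s. d < s \<and> s < c \<longrightarrow> s \<in> X" using * by blast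
    moreover have "d < c" using assms(3,4) by simp
    ultimately show "left_germ X c" unfolding left_germ_def by blast
  next
    assume "left_germ X c"
    then obtain u where v: "u < c" "\<forall>t. u < t \<and> t < c \<longrightarrow> t \<in> X" by (auto simp: left_germ_def)
    obtain s where "max u d < s" "s < c" using dense[of "max u d" c] v assms(3,4) by auto
    then show "t \<in> X" using *[of s] v by simp
  qed
qed

definition cell_catalogue :: "nat \<Rightarrow> nat \<Rightarrow> nat \<Rightarrow> 'a list set set \<Rightarrow> 'a list set set \<Rightarrow> bool" where
  "cell_catalogue k l N \<T> \<U> \<longleftrightarrow> finite \<U> \<and> \<U> \<subseteq> S (k + N * l) \<and>
     (\<forall>Y. finite Y \<longrightarrow> Y \<noteq> {} \<longrightarrow> Y \<subseteq> Rn l \<longrightarrow>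
       (\<exists>\<C> \<subseteq> {fiber k U (concat ys) | U ys. U \<in> \<U> \<and> length ys = N \<and> set ys \<subseteq> Y}.
         partition_on (Rn k) \<C> \<and> (k \<noteq> 0 \<longrightarrow> cdcd_rec S k \<C>) \<and>
         (\<forall>T\<in>\<T>. \<forall>y\<in>Y. \<forall>C\<in>\<C>. C \<subseteq> fiber k T y \<or> C \<inter> fiber k T y = {})))"

text \<open>The only cell is a single point, which lies inside or outside any set and needs no
  parameters.\<close>

lemma cell_catalogue_0: "cell_catalogue 0 l 0 \<T> {Rn 0}"
proof -
  have "Rn 0 \<in> S 0" using def_pred_const[of 0 True] by (simp add: def_pred_def)
  have R0: "Rn 0 = {[]}" by (auto simp: Rn_def)
  have "C \<subseteq> fiber 0 T y \<or> C \<inter> fiber 0 T y = {}" if "C \<in> {Rn 0}" for C T and y :: "'a list"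
    using that by (auto simp: R0)
  moreover have "fiber 0 (Rn 0) [] = Rn 0" by (auto simp: fiber_def R0)
  moreover have "partition_on (Rn 0) {Rn 0}" by (simp add: R0 partition_on_def)
  ultimately show ?thesis using \<open>Rn 0 \<in> S 0\<close> unfolding cell_catalogue_def
    by (auto intro!: exI[of _ "{Rn 0}"])
qed

text \<open>Packs a condition on a base point and two parameters into one set, to which the
  induction hypothesis applies with \<open>y @ y'\<close> as a single parameter.\<close>

definition section_set :: "nat \<Rightarrow> nat \<Rightarrow> ('a list \<Rightarrow> 'a list \<Rightarrow> 'a list \<Rightarrow> bool) \<Rightarrow> 'a list set" where
  "section_set k l Q = {w. length w = k + (l + l) \<and> Q (take k w) (take l (drop k w)) (drop (k + l) w)}"

lemma section_set_mem:
  "length p = k \<Longrightarrow> length y = l \<Longrightarrow> length y' = l \<Longrightarrow> p @ y @ y' \<in> section_set k l Q \<longleftrightarrow> Q p y y'"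
  by (simp add: section_set_def)

text \<open>Each clause of \<open>base_regular\<close> is expressed by finitely many sets in
  \<open>\<T>'\<close>, chosen independently of \<open>Y\<close>. For continuity, \<open>g\<close>
  is split on all \<open>k + l\<close> coordinates jointly; a base cell that stays in one piece for
  a given parameter inherits continuity with this parameter frozen.\<close>

lemma base_data:
  assumes \<T>: "finite \<T>" "\<T> \<subseteq> S (Suc k + l)"
  obtains G \<T>' where "finite G" "G \<noteq> {}" "\<And>g. g \<in> G \<Longrightarrow> def_fun (k + l) g" "finite \<T>'" "\<T>' \<subseteq> S (k + (l + l))"
    "\<And>T p y. T \<in> \<T> \<Longrightarrow> length p = k \<Longrightarrow> length y = l \<Longrightarrow>
       tame {t. p @ t # y \<in> T} \<and> bdry {t. p @ t # y \<in> T} \<subseteq> (\<lambda>g. g (p @ y)) ` G"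
    "\<And>C Y. C \<noteq> {} \<Longrightarrow> C \<subseteq> Rn k \<Longrightarrow> Y \<subseteq> Rn l \<Longrightarrow>
       (\<And>T' y y'. T' \<in> \<T>' \<Longrightarrow> y \<in> Y \<Longrightarrow> y' \<in> Y \<Longrightarrow> C \<subseteq> fiber k T' (y @ y') \<or> C \<inter> fiber k T' (y @ y') = {}) \<Longrightarrow>
       base_regular k G \<T> Y C"
proof -
  have \<T>S: "T \<in> S (Suc (k + l))" if "T \<in> \<T>" for T using that \<T>(2) by auto
  \<comment> \<open>In \<open>T\<close> the new coordinate sits between the base point and the
    parameter, so \<open>t\<close> is inserted at position \<open>k\<close>.\<close>
  define X where "X = (\<lambda>T w. {t::'a. take k w @ t # drop k w \<in> T})"
  have X: "def_fam (k + l) (X T)" if "T \<in> \<T>" for T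
    unfolding def_fam_def X_def mem_Collect_eq
    by (rule def_pred_mem[OF \<T>S[OF that]] def_intros | simp)+
  have "\<exists>F. finite F \<and> (\<forall>f\<in>F. def_fun (k + l) f) \<and>
     (\<forall>Z\<in>X ` \<T>. \<forall>w. length w = k + l \<longrightarrow> bdry (Z w) \<subseteq> (\<lambda>f. f w) ` F)"
    by (rule bdry_funs) (use X \<T>(1) in auto)
  then obtain F where F: "finite F" "\<forall>f\<in>F. def_fun (k + l) f"
      "\<forall>T\<in>\<T>. \<forall>w. length w = k + l \<longrightarrow> bdry (X T w) \<subseteq> (\<lambda>f. f w) ` F"
    unfolding ball_simps by blast
  \<comment> \<open>The added zero function guarantees a dividing function, so that no column
    consists of the whole line alone.\<close>
  define G where "G = insert (\<lambda>w. 0) F"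
  have G: "finite G" "G \<noteq> {}" and dG: "\<And>g. g \<in> G \<Longrightarrow> def_fun (k + l) g"
    using F by (auto simp: G_def def_fun_const)
  obtain \<D> where \<D>: "\<And>g. g \<in> G \<Longrightarrow> finite (\<D> g) \<and> \<D> g \<subseteq> S (k + l) \<and> \<Union>(\<D> g) = Rn (k + l) \<and>
      (\<forall>D\<in>\<D> g. \<forall>x\<in>D. cont_at (k + l) D g x)"
    using piecewise_continuity[OF dG] by metis
  define Q1 where "Q1 = (\<lambda>D (p::'a list) (y::'a list) (y'::'a list). p @ y \<in> D)"
  define Q2 where "Q2 = (\<lambda>(g::'a list \<Rightarrow> 'a, h::'a list \<Rightarrow> 'a) p y y'. g (p @ y) < h (p @ y'))"
  define Q3 where "Q3 = (\<lambda>(g::'a list \<Rightarrow> 'a, T) p y y'. p @ g (p @ y) # y' \<in> T)"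
  define Q4 where "Q4 = (\<lambda>(g::'a list \<Rightarrow> 'a, T) p y y'. right_germ {t. p @ t # y' \<in> T} (g (p @ y)))"
  define Q5 where "Q5 = (\<lambda>(g::'a list \<Rightarrow> 'a, T) p y y'. left_germ {t. p @ t # y' \<in> T} (g (p @ y)))"
  define \<T>' where "\<T>' = section_set k l ` (Q1 ` \<Union>(\<D> ` G) \<union> Q2 ` (G \<times> G) \<union> Q3 ` (G \<times> \<T>) \<union> Q4 ` (G \<times> \<T>) \<union> Q5 ` (G \<times> \<T>))"
  have fin: "finite \<T>'" using G(1) \<D> \<T>(1) by (simp add: \<T>'_def)
  have S1: "section_set k l (Q1 D) \<in> S (k + (l + l))" if "g \<in> G" "D \<in> \<D> g" for g D
  proof -
    have D: "D \<in> S (k + l)" using \<D> that by blast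
    show ?thesis unfolding section_set_def Q1_def
      by (rule definable_Collect) (rule def_pred_mem[OF D] def_intros | simp)+
  qed
  have S2: "section_set k l (Q2 (g, h)) \<in> S (k + (l + l))" if "g \<in> G" "h \<in> G" for g h
    unfolding section_set_def Q2_def split
    by (rule definable_Collect) (rule def_fun_subst[OF dG[OF that(1)]] def_fun_subst[OF dG[OF that(2)]] def_intros | simp)+
  have S3: "section_set k l (Q3 (g, T)) \<in> S (k + (l + l))" if "g \<in> G" "T \<in> \<T>" for g T
    unfolding section_set_def Q3_def split
    by (rule definable_Collect) (rule def_pred_mem[OF \<T>S[OF that(2)]] def_fun_subst[OF dG[OF that(1)]] def_intros | simp)+
  have S4: "section_set k l (Q4 (g, T)) \<in> S (k + (l + l))" if "g \<in> G" "T \<in> \<T>" for g T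
    unfolding section_set_def Q4_def split right_germ_def mem_Collect_eq
    by (rule definable_Collect) (rule def_pred_mem[OF \<T>S[OF that(2)]] def_fun_subst[OF dG[OF that(1)]] def_intros | simp)+
  have S5: "section_set k l (Q5 (g, T)) \<in> S (k + (l + l))" if "g \<in> G" "T \<in> \<T>" for g T
    unfolding section_set_def Q5_def split left_germ_def mem_Collect_eq
    by (rule definable_Collect) (rule def_pred_mem[OF \<T>S[OF that(2)]] def_fun_subst[OF dG[OF that(1)]] def_intros | simp)+
  have \<T>'S: "\<T>' \<subseteq> S (k + (l + l))" using S1 S2 S3 S4 S5 by (auto simp: \<T>'_def)
  show ?thesis
  proof (rule that[OF G dG fin \<T>'S])
    fix T and p y :: "'a list" assume T: "T \<in> \<T>" and len: "length p = k" "length y = l"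
    have "X T (p @ y) = {t. p @ t # y \<in> T}" using len by (simp add: X_def)
    moreover have "tame (X T (p @ y))" using def_fam_tame[OF X[OF T]] len by simp
    moreover have "bdry (X T (p @ y)) \<subseteq> (\<lambda>f. f (p @ y)) ` F" using F(3) T len by simp
    then have "bdry (X T (p @ y)) \<subseteq> (\<lambda>g. g (p @ y)) ` G" unfolding G_def by blast
    ultimately show "tame {t. p @ t # y \<in> T} \<and> bdry {t. p @ t # y \<in> T} \<subseteq> (\<lambda>g. g (p @ y)) ` G" by simp
  next
    fix C Y assume C: "C \<noteq> {}" "C \<subseteq> Rn k" and Y: "Y \<subseteq> Rn l"
      and ad: "\<And>T' y y'. T' \<in> \<T>' \<Longrightarrow> y \<in> Y \<Longrightarrow> y' \<in> Y \<Longrightarrow> C \<subseteq> fiber k T' (y @ y') \<or> C \<inter> fiber k T' (y @ y') = {}"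
    have Ylen: "length y = l" if "y \<in> Y" for y using Y that by (auto simp: Rn_def)
    have Clen: "length p = k" if "p \<in> C" for p using C(2) that by (auto simp: Rn_def)
    have uni: "uniform_on C (\<lambda>p. Q p y y')" if Q: "section_set k l Q \<in> \<T>'" and y: "y \<in> Y" "y' \<in> Y" for Q y y'
    proof -
      have "section_set k l Q \<in> S (k + (l + l))" using Q \<T>'S by blast
      then have "p \<in> fiber k (section_set k l Q) (y @ y') \<longleftrightarrow> Q p y y'" if "p \<in> C" for p
        using fiber_iff Clen[OF that] Ylen[OF y(1)] Ylen[OF y(2)] by (simp add: section_set_mem)
      then show ?thesis using ad[OF Q y] unfolding uniform_on_def by blast
    qed
    have mem: "section_set k l (Q1 D) \<in> \<T>'" if "g \<in> G" "D \<in> \<D> g" for g D using that unfolding \<T>'_def by blast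
    have mem2: "section_set k l (Q2 (g, h)) \<in> \<T>'" if "g \<in> G" "h \<in> G" for g h using that unfolding \<T>'_def by blast
    have mem3: "section_set k l (Q3 (g, T)) \<in> \<T>'" "section_set k l (Q4 (g, T)) \<in> \<T>'" "section_set k l (Q5 (g, T)) \<in> \<T>'"
      if "g \<in> G" "T \<in> \<T>" for g T using that unfolding \<T>'_def by blast+
    have "cont_at k C (\<lambda>x. g (x @ y)) p" if g: "g \<in> G" and y: "y \<in> Y" and p: "p \<in> C" for g y p
    proof -
      have "p @ y \<in> \<Union>(\<D> g)" using \<D>[OF g] Clen[OF p] Ylen[OF y] by (simp add: Rn_def)
      then obtain D where D: "D \<in> \<D> g" "p @ y \<in> D" by blast
      have "\<forall>q\<in>C. q @ y \<in> D"
        using uni[OF mem[OF g D(1)] y y] D(2) p by (auto simp: uniform_on_def Q1_def)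
      moreover have "cont_at (k + l) D g (p @ y)" using \<D>[OF g] D by blast
      ultimately show ?thesis
        unfolding cont_at_def using near_append[of p k _ _ l y] Clen p by metis
    qed
    moreover have "uniform_on C (\<lambda>p. g (p @ y) < h (p @ y'))" if "g \<in> G" "h \<in> G" "y \<in> Y" "y' \<in> Y" for g h y y'
      using uni[OF mem2[OF that(1,2)] that(3,4)] by (simp add: Q2_def)
    moreover have "uniform_on C (\<lambda>p. p @ g (p @ y) # y' \<in> T) \<and>
           uniform_on C (\<lambda>p. right_germ {t. p @ t # y' \<in> T} (g (p @ y))) \<and>
           uniform_on C (\<lambda>p. left_germ {t. p @ t # y' \<in> T} (g (p @ y)))"
      if "g \<in> G" "T \<in> \<T>" "y \<in> Y" "y' \<in> Y" for g T y y'
      using uni[OF mem3(1)[OF that(1,2)] that(3,4)] uni[OF mem3(2)[OF that(1,2)] that(3,4)]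
        uni[OF mem3(3)[OF that(1,2)] that(3,4)] by (simp add: Q3_def Q4_def Q5_def)
    ultimately show "base_regular k G \<T> Y C" unfolding base_regular_def by blast
  qed
qed

text \<open>An open cell lies on one side of its bound \<open>a\<close>, and without boundary points
  inside, the germ at \<open>a\<close> decides all of it. Rays are cut to bounded intervals by
  \<open>t - 1\<close> or \<open>t + 1\<close> to fit the germ lemmas.\<close>

lemma shape_membership:
  assumes X: "tame X" and bd: "bdry X \<inter> cell_shape i a b = {}" and "i \<noteq> 0" "t \<in> cell_shape i a (b::'a)"
  shows "t \<in> X \<longleftrightarrow> (if i = 2 then left_germ X a else right_germ X a)"
proof -
  consider "i = 1" "a < t" "t < b" | "i = 2" "t < a" | "i \<noteq> 2" "i \<noteq> 1" "a < t"
    using assms(3,4) by (auto simp: cell_shape_def split: if_splits)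
  then show ?thesis
  proof cases
    case 1
    then show ?thesis using right_germ_iff[OF X, of a b t] bd by (simp add: cell_shape_def)
  next
    case 2
    have "bdry X \<inter> {t - 1<..<a} = {}" using bd 2 by (auto simp: cell_shape_def)
    then show ?thesis using left_germ_iff[OF X, of "t - 1" a t] 2 by simp
  next
    case 3
    have "bdry X \<inter> {a<..<t + 1} = {}" using bd 3 assms(3) by (auto simp: cell_shape_def)
    then show ?thesis using right_germ_iff[OF X, of a "t + 1" t] 3 by simp
  qed
qed

end

section \<open>Uniform decompositions\<close>

context o_minimal
begin

text \<open>The blocks of \<open>w\<close> are the base point, the new coordinate, the
  \<open>M\<close> parameter coordinates of \<open>U\<close>, and one parameter each for
  \<open>g\<close> and \<open>h\<close>. Both final blocks are present for every shape, so all cells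
  have the same number of parameters.\<close>

definition stacked_cell :: "nat \<Rightarrow> nat \<Rightarrow> nat \<Rightarrow> 'a list set \<Rightarrow> ('a list \<Rightarrow> 'a) \<Rightarrow> ('a list \<Rightarrow> 'a) \<Rightarrow> nat \<Rightarrow> 'a list set" where
  "stacked_cell k l M U g h i = {w. length w = Suc k + (M + (l + l)) \<and>
     take k w @ take M (drop (Suc k) w) \<in> U \<and>
     w ! k \<in> cell_shape i (g (take k w @ take l (drop (Suc k + M) w))) (h (take k w @ drop (Suc k + M + l) w))}"

lemma stacked_cell_definable:
  assumes U: "U \<in> S (k + M)" and g: "def_fun (k + l) g" and h: "def_fun (k + l) h"
  shows "stacked_cell k l M U g h i \<in> S (Suc k + (M + (l + l)))"
proof -
  have shape: "t \<in> cell_shape i a b \<longleftrightarrow> (i = 0 \<and> t = a) \<or> (i = 1 \<and> a < t \<and> t < b) \<or> (i = 2 \<and> t < a) \<or>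
      (i \<noteq> 0 \<and> i \<noteq> 1 \<and> i \<noteq> 2 \<and> a < t)" for t a b :: 'a
    by (auto simp: cell_shape_def)
  show ?thesis unfolding stacked_cell_def shape
    by (rule definable_Collect) (rule def_pred_mem[OF U] def_fun_subst[OF g] def_fun_subst[OF h] def_intros | simp)+
qed

lemma stacked_cell_fiber:
  assumes U: "U \<in> S (k + M)" and g: "def_fun (k + l) g" and h: "def_fun (k + l) h"
    and len: "length z = M" "length y = l" "length y' = l"
  shows "fiber (Suc k) (stacked_cell k l M U g h i) (z @ y @ y') =
    {p @ [t] | p t. p \<in> fiber k U z \<and> t \<in> cell_shape i (g (p @ y)) (h (p @ y'))}" (is "?L = ?R")
proof -
  have L: "p @ [t] \<in> ?L \<longleftrightarrow> p \<in> fiber k U z \<and> t \<in> cell_shape i (g (p @ y)) (h (p @ y'))"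
    if p: "length p = k" for p t
  proof -
    have "p @ [t] \<in> ?L \<longleftrightarrow> (p @ [t]) @ z @ y @ y' \<in> stacked_cell k l M U g h i"
      using fiber_iff[OF stacked_cell_definable[OF U g h]] p by simp
    also have "\<dots> \<longleftrightarrow> p @ z \<in> U \<and> t \<in> cell_shape i (g (p @ y)) (h (p @ y'))"
      using p len by (auto simp: stacked_cell_def nth_append)
    finally show ?thesis using fiber_iff[OF U p] by simp
  qed
  have "x \<in> ?L \<longleftrightarrow> x \<in> ?R" if len: "length x = Suc k" for x
  proof -
    obtain p t where "x = p @ [t]" "length p = k" using snoc_cases[OF len] by blast
    then show ?thesis using L by simp
  qed
  moreover have "?L \<subseteq> Rn (Suc k)" using fiber_subset[OF stacked_cell_definable[OF U g h]] .
  moreover have "?R \<subseteq> Rn (Suc k)" using fiber_subset[OF U] by (fastforce simp: Rn_def)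
  ultimately show ?thesis unfolding Rn_def by blast
qed

lemma cell_catalogueD:
  assumes "cell_catalogue k l N \<T> \<U>" "finite Y" "Y \<noteq> {}" "Y \<subseteq> Rn l"
  shows "\<exists>\<C> \<subseteq> {fiber k U (concat ys) | U ys. U \<in> \<U> \<and> length ys = N \<and> set ys \<subseteq> Y}.
         partition_on (Rn k) \<C> \<and> (k \<noteq> 0 \<longrightarrow> cdcd_rec S k \<C>) \<and>
         (\<forall>T\<in>\<T>. \<forall>y\<in>Y. \<forall>C\<in>\<C>. C \<subseteq> fiber k T y \<or> C \<inter> fiber k T y = {})"
  using assms by (simp add: cell_catalogue_def)

text \<open>A base cell uses \<open>N\<close> concatenated pairs, which count as
  \<open>2 * N\<close> parameters; two more belong to the functions bounding the cell. The new
  catalogue is formed from \<open>\<U>'\<close>, \<open>G\<close> and the four shapes alone, hence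
  before \<open>Y\<close> is known.\<close>

lemma cell_catalogue_step:
  assumes IH: "\<And>l \<T>. finite \<T> \<Longrightarrow> \<T> \<subseteq> S (k + l) \<Longrightarrow> \<exists>\<U>. cell_catalogue k l N \<T> \<U>"
    and \<T>: "finite \<T>" "\<T> \<subseteq> S (Suc k + l)"
  shows "\<exists>\<U>. cell_catalogue (Suc k) l (2 * N + 2) \<T> \<U>"
proof (rule base_data[OF \<T>])
  fix G \<T>' assume G: "finite G" "G \<noteq> {}" "\<And>g. g \<in> G \<Longrightarrow> def_fun (k + l) g"
    and \<T>': "finite \<T>'" "\<T>' \<subseteq> S (k + (l + l))"
    and bd: "\<And>T p y. T \<in> \<T> \<Longrightarrow> length p = k \<Longrightarrow> length y = l \<Longrightarrow>
       tame {t. p @ t # y \<in> T} \<and> bdry {t. p @ t # y \<in> T} \<subseteq> (\<lambda>g. g (p @ y)) ` G"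
    and base: "\<And>C Y. C \<noteq> {} \<Longrightarrow> C \<subseteq> Rn k \<Longrightarrow> Y \<subseteq> Rn l \<Longrightarrow>
       (\<And>T' y y'. T' \<in> \<T>' \<Longrightarrow> y \<in> Y \<Longrightarrow> y' \<in> Y \<Longrightarrow> C \<subseteq> fiber k T' (y @ y') \<or> C \<inter> fiber k T' (y @ y') = {}) \<Longrightarrow>
       base_regular k G \<T> Y C"
  obtain \<U>' where cat: "cell_catalogue k (l + l) N \<T>' \<U>'" using IH[OF \<T>'] by blast
  have \<U>': "finite \<U>'" "\<U>' \<subseteq> S (k + N * (l + l))" using cat by (auto simp: cell_catalogue_def)
  define M where "M = N * (l + l)"
  have M: "(2 * N + 2) * l = M + (l + l)" by (simp add: M_def algebra_simps)
  define \<U> where "\<U> = (\<lambda>(U, g, h, i). stacked_cell k l M U g h i) ` (\<U>' \<times> G \<times> G \<times> {..<4})"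
  have "stacked_cell k l M U g h i \<in> S (Suc k + (M + (l + l)))" if "U \<in> \<U>'" "g \<in> G" "h \<in> G" for U g h i
    using that \<U>'(2) by (intro stacked_cell_definable G(3)) (auto simp: M_def)
  then have \<U>: "finite \<U>" "\<U> \<subseteq> S (Suc k + (2 * N + 2) * l)"
    using \<U>' G unfolding M by (auto simp: \<U>_def)
  have "\<exists>\<C> \<subseteq> {fiber (Suc k) U (concat ys) | U ys. U \<in> \<U> \<and> length ys = 2 * N + 2 \<and> set ys \<subseteq> Y}.
         partition_on (Rn (Suc k)) \<C> \<and> (Suc k \<noteq> 0 \<longrightarrow> cdcd_rec S (Suc k) \<C>) \<and>
         (\<forall>T\<in>\<T>. \<forall>y\<in>Y. \<forall>C\<in>\<C>. C \<subseteq> fiber (Suc k) T y \<or> C \<inter> fiber (Suc k) T y = {})"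
    if Y: "finite Y" "Y \<noteq> {}" "Y \<subseteq> Rn l" for Y
  proof -
    have Ylen: "length y = l" if "y \<in> Y" for y using Y(3) that by (auto simp: Rn_def)
    \<comment> \<open>All ordered pairs, so that any two parameters are compared over every base
      cell.\<close>
    define Y2 where "Y2 = {y @ y' | y y'. y \<in> Y \<and> y' \<in> Y}"
    have "Y2 = (\<lambda>(y, y'). y @ y') ` (Y \<times> Y)" by (auto simp: Y2_def)
    then have Y2: "finite Y2" "Y2 \<noteq> {}" "Y2 \<subseteq> Rn (l + l)" using Y Ylen by (auto simp: Rn_def)
    obtain \<C>' where \<C>': "\<C>' \<subseteq> {fiber k U (concat ys) | U ys. U \<in> \<U>' \<and> length ys = N \<and> set ys \<subseteq> Y2}"
      "partition_on (Rn k) \<C>'" "k \<noteq> 0 \<longrightarrow> cdcd_rec S k \<C>'"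
      "\<forall>T\<in>\<T>'. \<forall>y\<in>Y2. \<forall>C\<in>\<C>'. C \<subseteq> fiber k T y \<or> C \<inter> fiber k T y = {}"
      using cell_catalogueD[OF cat Y2] by (elim exE conjE) (rule that; assumption)
    \<comment> \<open>One set of dividing functions serves all base cells; their order, and with it
      the column, depends on the cell.\<close>
    define H where "H = (\<lambda>(g, y) x. g (x @ y)) ` (G \<times> Y)"
    have HE: "\<exists>g y. g \<in> G \<and> y \<in> Y \<and> h = (\<lambda>x. g (x @ y))" if "h \<in> H" for h using that by (auto simp: H_def)
    have HI: "(\<lambda>x. g (x @ y)) \<in> H" if "g \<in> G" "y \<in> Y" for g y using that by (auto simp: H_def)
    have H: "finite H" "H \<noteq> {}" using G Y by (auto simp: H_def)
    have dH: "def_fun k h" if h: "h \<in> H" for h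
    proof -
      obtain g y where "g \<in> G" "y \<in> Y" "h = (\<lambda>x. g (x @ y))" using HE[OF h] by blast
      then show ?thesis using Ylen by (auto intro!: def_fun_subst[OF G(3)] def_map_append def_map_id def_map_const)
    qed
    have ne: "C \<noteq> {}" if "C \<in> \<C>'" for C using partition_onD3[OF \<C>'(2)] that by auto
    have sub: "C \<subseteq> Rn k" if "C \<in> \<C>'" for C using partition_onD1[OF \<C>'(2)] that by auto
    have zlen: "length (concat zs) = M" if "length zs = N" "set zs \<subseteq> Y2" for zs
      using length_concat_eq[of zs "l + l"] Y2(3) that by (auto simp: M_def)
    have CS: "C \<in> S k" if C: "C \<in> \<C>'" for C
    proof -
      obtain U zs where U: "C = fiber k U (concat zs)" "U \<in> \<U>'" "length zs = N" "set zs \<subseteq> Y2" using C \<C>'(1) by blast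
      then show ?thesis using fiber_definable[of U k M] \<U>'(2) zlen by (auto simp: M_def)
    qed
    have "base_regular k G \<T> Y C" if C: "C \<in> \<C>'" for C
      by (rule base[OF ne[OF C] sub[OF C] Y(3)]) (use C \<C>'(4) in \<open>auto simp: Y2_def\<close>)
    note base' = this[unfolded base_regular_def]
    have "\<exists>P \<psi>. is_column k H C P \<psi>" if C: "C \<in> \<C>'" for C
    proof (rule column_exists[OF CS[OF C] ne[OF C] H dH])
      fix h p assume "h \<in> H" "p \<in> C"
      then show "cont_at k C h p" using HE[of h] base'[OF C] by blast
    next
      fix h h' assume "h \<in> H" "h' \<in> H"
      then obtain g y g' y' where *: "g \<in> G" "y \<in> Y" "h = (\<lambda>x. g (x @ y))" "g' \<in> G" "y' \<in> Y" "h' = (\<lambda>x. g' (x @ y'))"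
        using HE by meson
      then have "uniform_on C (\<lambda>p. h p < h' p)" "uniform_on C (\<lambda>p. h' p < h p)" using base'[OF C] by blast+
      then show "(\<forall>p\<in>C. h p < h' p) \<or> (\<forall>p\<in>C. h p = h' p) \<or> (\<forall>p\<in>C. h' p < h p)"
        unfolding uniform_on_def by (meson linorder_neqE)
    qed
    then obtain P \<psi> where "\<And>C. C \<in> \<C>' \<Longrightarrow> is_column k H C (P C) (\<psi> C)" by metis
    note P\<psi> = this[unfolded is_column_def]
    define \<C> where "\<C> = (\<Union>C\<in>\<C>'. {vertical k (\<psi> C) ` (C \<otimes>\<^sub>l line D) | D. D \<in> line_cells (P C)})"
    have part: "partition_on (Rn (Suc k)) \<C>" unfolding \<C>_def
    proof (rule partition_columns[OF \<C>'(2)])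
      fix C p assume C: "C \<in> \<C>'" "p \<in> C"
      then have "strict_mono (\<psi> C p)" "surj (\<psi> C p)" using P\<psi>[OF C(1)] by simp_all
      then show "inj (\<psi> C p) \<and> surj (\<psi> C p)" using strict_mono_imp_inj_on by blast
    qed (use P\<psi> in simp)
    have rec: "cdcd_rec S (Suc k) \<C>"
    proof (cases "k = 0")
      case True
      \<comment> \<open>Here the base is one point and the column map is the identity, so the column
        is exactly the base case of \<open>cdcd_rec\<close>.\<close>
      have "\<Union>\<C>' = {[]}" using partition_onD1[OF \<C>'(2)] True by (auto simp: Rn_def)
      have "C = {[]}" if C: "C \<in> \<C>'" for C
      proof -
        have "C \<subseteq> {[]}" using sub[OF C] True by (auto simp: Rn_def)
        then show ?thesis using ne[OF C] subset_singletonD by metis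
      qed
      moreover have "\<C>' \<noteq> {}" using \<open>\<Union>\<C>' = {[]}\<close> by auto
      ultimately have C': "\<C>' = {{[]}}" by blast
      have "\<psi> {[]} = (\<lambda>p t. t)" "finite (P {[]})" using P\<psi>[of "{[]}"] C' True by auto
      then have "vertical 0 (\<psi> {[]}) ` ({[]} \<otimes>\<^sub>l line D) = line D" for D
        by (subst image_vertical) (auto simp: Rn_def line_def)
      then have "\<C> = line ` line_cells (P {[]})" using C' True by (auto simp: \<C>_def)
      then show ?thesis using cdcd_rec.base[OF \<open>finite (P {[]})\<close>, of S] True by simp
    next
      case False
      then show ?thesis unfolding \<C>_def
        by (intro cdcd_rec.step) (use \<C>'(3) P\<psi> in \<open>auto\<close>)
    qed
    have cells: "\<exists>U ys. E = fiber (Suc k) U (concat ys) \<and> U \<in> \<U> \<and> length ys = 2 * N + 2 \<and> set ys \<subseteq> Y"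
      and adapt: "\<And>T y. T \<in> \<T> \<Longrightarrow> y \<in> Y \<Longrightarrow> E \<subseteq> fiber (Suc k) T y \<or> E \<inter> fiber (Suc k) T y = {}"
      if "E \<in> \<C>" for E
    proof -
      obtain C D where CD: "C \<in> \<C>'" "D \<in> line_cells (P C)" "E = vertical k (\<psi> C) ` (C \<otimes>\<^sub>l line D)"
        using \<open>E \<in> \<C>\<close> by (auto simp: \<C>_def)
      have E: "E = {p @ [t] | p t. p \<in> C \<and> t \<in> \<psi> C p ` D}" unfolding CD(3) by (rule image_vertical[OF sub[OF CD(1)]])
      have Clen: "length p = k" if "p \<in> C" for p using sub[OF CD(1)] that by (auto simp: Rn_def)
      have "\<exists>i<4. \<exists>g\<in>H. \<exists>h\<in>H. (\<forall>p\<in>C. \<psi> C p ` D = cell_shape i (g p) (h p)) \<and>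
         (i \<noteq> 0 \<longrightarrow> (\<forall>f\<in>H. \<forall>p\<in>C. f p \<notin> \<psi> C p ` D))"
        using P\<psi>[OF CD(1)] CD(2) by (intro column_cell_shape[of "P C"]) blast+
      then obtain i g' h' where "i < 4" and gh: "g' \<in> H" "h' \<in> H"
        and shape': "\<forall>p\<in>C. \<psi> C p ` D = cell_shape i (g' p) (h' p)"
        and avoid: "i \<noteq> 0 \<longrightarrow> (\<forall>f\<in>H. \<forall>p\<in>C. f p \<notin> \<psi> C p ` D)" by blast
      obtain g y where g: "g \<in> G" "y \<in> Y" "g' = (\<lambda>x. g (x @ y))" using HE[OF gh(1)] by blast
      obtain h y' where h: "h \<in> G" "y' \<in> Y" "h' = (\<lambda>x. h (x @ y'))" using HE[OF gh(2)] by blast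
      have shape: "\<psi> C p ` D = cell_shape i (g (p @ y)) (h (p @ y'))" if "p \<in> C" for p
        using shape' that g h by simp
      obtain U zs where U: "C = fiber k U (concat zs)" "U \<in> \<U>'" "length zs = N" "set zs \<subseteq> Y2" using CD(1) \<C>'(1) by blast
      have US: "U \<in> S (k + M)" using U(2) \<U>'(2) by (auto simp: M_def)
      obtain ys where ys: "length ys = 2 * N" "set ys \<subseteq> Y" "concat ys = concat zs"
        using regroup_pairs[of zs Y] U(3,4) unfolding Y2_def by auto
      have "E = {p @ [t] | p t. p \<in> C \<and> t \<in> cell_shape i (g (p @ y)) (h (p @ y'))}"
        unfolding E by (simp add: shape cong: conj_cong)
      also have "\<dots> = fiber (Suc k) (stacked_cell k l M U g h i) (concat zs @ y @ y')"
        unfolding U(1) using zlen[OF U(3,4)] Ylen g h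
        by (intro stacked_cell_fiber[OF US G(3) G(3), symmetric]) auto
      also have "concat zs @ y @ y' = concat (ys @ [y, y'])" using ys by simp
      finally have "E = fiber (Suc k) (stacked_cell k l M U g h i) (concat (ys @ [y, y']))" .
      moreover have "stacked_cell k l M U g h i \<in> \<U>"
        unfolding \<U>_def using U(2) g(1) h(1) \<open>i < 4\<close> by (intro image_eqI[of _ _ "(U, g, h, i)"]) auto
      ultimately show "\<exists>U ys. E = fiber (Suc k) U (concat ys) \<and> U \<in> \<U> \<and> length ys = 2 * N + 2 \<and> set ys \<subseteq> Y"
        using ys g(2) h(2) by (intro exI[of _ "stacked_cell k l M U g h i"] exI[of _ "ys @ [y, y']"]) auto
      fix T v assume T: "T \<in> \<T>" and v: "v \<in> Y"
      define X where "X = (\<lambda>p. {t. p @ t # v \<in> T})"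
      have TS: "T \<in> S (Suc k + l)" using T \<T>(2) by blast
      have Eiff: "p @ [t] \<in> fiber (Suc k) T v \<longleftrightarrow> t \<in> X p" if "p \<in> C" for p t
        using fiber_iff[OF TS, of "p @ [t]" v] Clen[OF that] by (simp add: X_def)
      \<comment> \<open>\<open>Q p\<close> decides membership for the whole part of the cell over
        \<open>p\<close>; being uniform in \<open>p\<close>, it puts the entire cell inside or
        outside.\<close>
      obtain Q where Q: "uniform_on C Q" "\<And>p t. p \<in> C \<Longrightarrow> t \<in> \<psi> C p ` D \<Longrightarrow> t \<in> X p \<longleftrightarrow> Q p"
      proof (cases "i = 0")
        case True
        have "uniform_on C (\<lambda>p. p @ g (p @ y) # v \<in> T)" using base'[OF CD(1)] g T v by blast
        then show ?thesis by (rule that) (use shape True in \<open>auto simp: cell_shape_def X_def\<close>)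
      next
        case False
        have germs: "uniform_on C (\<lambda>p. right_germ (X p) (g (p @ y)))" "uniform_on C (\<lambda>p. left_germ (X p) (g (p @ y)))"
          using base'[OF CD(1)] g T v unfolding X_def by blast+
        show ?thesis
        proof (rule that)
          show "uniform_on C (\<lambda>p. if i = 2 then left_germ (X p) (g (p @ y)) else right_germ (X p) (g (p @ y)))"
            using germs by (cases "i = 2") simp_all
          fix p t assume p: "p \<in> C" and t: "t \<in> \<psi> C p ` D"
          have X: "tame (X p)" "bdry (X p) \<subseteq> (\<lambda>g. g (p @ v)) ` G"
            using bd[OF T Clen[OF p] Ylen[OF v]] by (auto simp: X_def)
          \<comment> \<open>Since \<open>v\<close> is in \<open>Y\<close>, the boundary points over
            \<open>v\<close> are values of functions in \<open>H\<close>, and open cells avoid all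
            of these.\<close>
          have "bdry (X p) \<inter> \<psi> C p ` D = {}"
          proof (rule equals0I)
            fix s assume s: "s \<in> bdry (X p) \<inter> \<psi> C p ` D"
            then obtain f where f: "f \<in> G" "s = f (p @ v)" using X(2) by blast
            have "\<forall>f\<in>H. \<forall>p\<in>C. f p \<notin> \<psi> C p ` D" using avoid False by simp
            from bspec[OF bspec[OF this HI[OF f(1) v]] p] show False using s f(2) by simp
          qed
          then show "t \<in> X p \<longleftrightarrow> (if i = 2 then left_germ (X p) (g (p @ y)) else right_germ (X p) (g (p @ y)))"
            using shape_membership[OF X(1) _ False] t unfolding shape[OF p] by blast
        qed
      qed
      show "E \<subseteq> fiber (Suc k) T v \<or> E \<inter> fiber (Suc k) T v = {}"
        using Q(1) unfolding uniform_on_def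
      proof
        assume "\<forall>p\<in>C. Q p"
        then have "E \<subseteq> fiber (Suc k) T v" unfolding E using Q(2) Eiff by blast
        then show ?thesis ..
      next
        assume "\<forall>p\<in>C. \<not> Q p"
        then have "x \<notin> fiber (Suc k) T v" if "x \<in> E" for x using that Q(2) Eiff unfolding E by blast
        then show ?thesis by blast
      qed
    qed
    show ?thesis
      by (rule exI[of _ \<C>]) (use part rec cells adapt in blast)
  qed
  then have "cell_catalogue (Suc k) l (2 * N + 2) \<T> \<U>" using \<U> unfolding cell_catalogue_def by blast
  then show ?thesis ..
qed

lemma cell_catalogue_exists:
  assumes "finite \<T>" "\<T> \<subseteq> S (k + l)"
  shows "\<exists>\<U>. cell_catalogue k l (2 * (2 ^ k - 1)) \<T> \<U>"
  using assms
proof (induction k arbitrary: l \<T>)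
  case 0
  then show ?case using cell_catalogue_0 by auto
next
  case (Suc k)
  \<comment> \<open>The closed form satisfies the recursion with start \<open>0\<close>; truncated
    subtraction is harmless because \<open>2 ^ k\<close> is positive.\<close>
  have "(2::nat) * (2 ^ Suc k - 1) = 2 * (2 * (2 ^ k - 1)) + 2"
    by (cases "(2::nat) ^ k") simp_all
  then show ?case using cell_catalogue_step[OF Suc.IH Suc.prems] by simp
qed

end

theorem theorem2p5:
  fixes S :: "nat \<Rightarrow> ('a::real_closed_field) list set set"
    and T :: "'a list set"
    and k l :: nat
  assumes "o_minimal S"
    and "k \<ge> 1"
    and "T \<in> S (k + l)"
    and "closedin (Rtop (k + l)) T"
  shows "\<exists>(C1::real) (C2::real) (I::nat set) (T' :: nat \<Rightarrow> 'a list set).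
    C1 > 0 \<and> C2 > 0 \<and>
    finite I \<and> real (card I) \<le> C1 \<and>
    (\<forall>\<alpha>\<in>I. T' \<alpha> \<in> S (k + 2 * (2 ^ k - 1) * l)) \<and>
    (\<forall>(n::nat) (A :: nat \<Rightarrow> 'a list set) (y :: nat \<Rightarrow> 'a list).
      n \<ge> 1 \<and> (\<forall>i\<in>{1..n}. y i \<in> Rn l \<and> A i = fiber k T (y i)) \<longrightarrow>
      (\<exists>\<C> \<subseteq> {fiber k (T' \<alpha>) (concat (map y js)) | \<alpha> js.
                \<alpha> \<in> I \<and> length js = 2 * (2 ^ k - 1) \<and> set js \<subseteq> {1..n}}.
        cdcd S k \<C> \<and> adapted \<C> (A ` {1..n}) \<and>
        real (card \<C>) \<le> C2 * real n ^ (2 * (2 ^ k - 1))))"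
proof -
  interpret o_minimal S by fact
  define N :: nat where "N = 2 * (2 ^ k - 1)"
  obtain \<U> where cat: "cell_catalogue k l N {T} \<U>"
    using cell_catalogue_exists[of "{T}" k l] assms(3) by (auto simp: N_def)
  then have \<U>: "finite \<U>" "\<U> \<subseteq> S (k + N * l)" by (auto simp: cell_catalogue_def)
  obtain T' where T': "bij_betw T' {0..<card \<U>} \<U>" using ex_bij_betw_nat_finite[OF \<U>(1)] by blast
  define I where "I = {0..<card \<U>}"
  have TI: "T' ` I = \<U>" using T' by (simp add: I_def bij_betw_def)
  have main: "\<exists>\<C> \<subseteq> {fiber k (T' \<alpha>) (concat (map y js)) | \<alpha> js.
                \<alpha> \<in> I \<and> length js = N \<and> set js \<subseteq> {1..n}}.
        cdcd S k \<C> \<and> adapted \<C> (A ` {1..n}) \<and> real (card \<C>) \<le> (real (card I) + 1) * real n ^ N"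
    if n: "n \<ge> 1" and yA: "\<forall>i\<in>{1..n}. y i \<in> Rn l \<and> A i = fiber k T (y i)"
    for n :: nat and A :: "nat \<Rightarrow> 'a list set" and y :: "nat \<Rightarrow> 'a list"
  proof -
    \<comment> \<open>Passing to the set of parameters absorbs repetitions among the
      \<open>y i\<close>; \<open>n \<ge> 1\<close> makes it nonempty.\<close>
    define Y where "Y = y ` {1..n}"
    have Y: "finite Y" "Y \<noteq> {}" "Y \<subseteq> Rn l" using n yA by (auto simp: Y_def)
    obtain \<C> where \<C>: "\<C> \<subseteq> {fiber k U (concat ys) | U ys. U \<in> \<U> \<and> length ys = N \<and> set ys \<subseteq> Y}"
      "partition_on (Rn k) \<C>" "k \<noteq> 0 \<longrightarrow> cdcd_rec S k \<C>"
      "\<forall>T\<in>{T}. \<forall>y\<in>Y. \<forall>C\<in>\<C>. C \<subseteq> fiber k T y \<or> C \<inter> fiber k T y = {}"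
      using cell_catalogueD[OF cat Y] by (elim exE conjE) (rule that; assumption)
    define J where "J = {js. set js \<subseteq> {1..n} \<and> length js = N}"
    have J: "finite J" "card J = n ^ N" unfolding J_def
      using finite_lists_length_eq[of "{1..n}" N] card_lists_length_eq[of "{1..n}" N] by auto
    \<comment> \<open>Cells are counted by their names: an index in \<open>I\<close> together with a
      list of \<open>N\<close> indices up to \<open>n\<close>.\<close>
    have sub: "\<C> \<subseteq> (\<lambda>(\<alpha>, js). fiber k (T' \<alpha>) (concat (map y js))) ` (I \<times> J)"
    proof
      fix C assume "C \<in> \<C>"
      then obtain U ys where U: "C = fiber k U (concat ys)" "U \<in> \<U>" "length ys = N" "set ys \<subseteq> Y" using \<C>(1) by blast
      obtain \<alpha> where \<alpha>: "\<alpha> \<in> I" "U = T' \<alpha>" using U(2) TI by blast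
      have "ys \<in> map y ` lists {1..n}"
        using U(4) unfolding lists_image[symmetric] Y_def by auto
      then obtain js where js: "ys = map y js" "set js \<subseteq> {1..n}" by auto
      then show "C \<in> (\<lambda>(\<alpha>, js). fiber k (T' \<alpha>) (concat (map y js))) ` (I \<times> J)"
        using U \<alpha> by (intro image_eqI[of _ _ "(\<alpha>, js)"]) (auto simp: J_def)
    qed
    have fin: "finite (I \<times> J)" using J by (simp add: I_def)
    have "card \<C> \<le> card (I \<times> J)"
      by (rule surj_card_le[OF fin sub])
    then have "real (card \<C>) \<le> real (card I) * real n ^ N"
      using J(2) by (simp add: card_cartesian_product flip: of_nat_power of_nat_mult)
    \<comment> \<open>The summand \<open>1\<close> makes the constants positive even for an empty
      catalogue.\<close>
    also have "\<dots> \<le> (real (card I) + 1) * real n ^ N" by (intro mult_right_mono) auto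
    finally have card: "real (card \<C>) \<le> (real (card I) + 1) * real n ^ N" .
    have "\<C> \<subseteq> S k"
    proof
      fix C assume "C \<in> \<C>"
      then obtain U ys where U: "C = fiber k U (concat ys)" "U \<in> \<U>" "length ys = N" "set ys \<subseteq> Y" using \<C>(1) by blast
      then have "length (concat ys) = N * l" using length_concat_eq[of ys l] Y(3) by auto
      then show "C \<in> S k" using fiber_definable[of U k "N * l"] U \<U>(2) by auto
    qed
    then have cd: "cdcd S k \<C>"
      using \<C>(2,3) finite_subset[OF sub finite_imageI[OF fin]] assms(2) by (auto simp: cdcd_def)
    have "adapted \<C> (A ` {1..n})" unfolding adapted_def
    proof
      fix B assume "B \<in> A ` {1..n}"
      then obtain v where v: "v \<in> Y" "B = fiber k T v" using yA by (auto simp: Y_def)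
      have "B \<subseteq> \<Union>\<C>" using fiber_subset[OF assms(3)] partition_onD1[OF \<C>(2)] v(2) by blast
      moreover have "\<forall>C\<in>\<C>. C \<subseteq> B \<or> C \<inter> B = {}" using \<C>(4) v by blast
      ultimately have "B = \<Union>{C \<in> \<C>. C \<subseteq> B}" by blast
      then show "\<exists>\<D>\<subseteq>\<C>. B = \<Union>\<D>"
        by - (rule exI[of _ "{C \<in> \<C>. C \<subseteq> B}"], rule conjI[OF Collect_restrict])
    qed
    moreover have "(\<lambda>(\<alpha>, js). fiber k (T' \<alpha>) (concat (map y js))) ` (I \<times> J) \<subseteq>
        {fiber k (T' \<alpha>) (concat (map y js)) | \<alpha> js. \<alpha> \<in> I \<and> length js = N \<and> set js \<subseteq> {1..n}}"
      by (auto simp: J_def)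
    ultimately show ?thesis using cd card order_trans[OF sub]
      by (intro exI[of _ \<C>] conjI)
  qed
  show ?thesis unfolding N_def[symmetric]
  proof (rule exI[of _ "real (card I) + 1"], rule exI[of _ "real (card I) + 1"], rule exI[of _ I],
      rule exI[of _ T'], intro conjI)
    show "\<forall>\<alpha>\<in>I. T' \<alpha> \<in> S (k + N * l)" using TI \<U>(2) by blast
  qed (use main in \<open>auto simp: I_def simp del: One_nat_def\<close>)
qed

end
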